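(* Let $H$ be a non-swallowing Markov hole for $f=f_\gamma$. For any $t\in[0,1]$, $$\log\underline\lambda_t\ \ge\ p^H(t)-p(t),$$ where $\log\underline\lambda_t=\liminf_{k\to\infty}\frac1k\log m_t(\mathring I^k)$.
   Context: Map and pressure. Fix $\gamma\in(0,1)$, $I=[0,1]$, and let $f=f_\gamma:I\to I$, $f(x)=x(1+2^\gamma x^\gamma)$ for $x\in[0,1/2)$ and $f(x)=2x-1$ for $x\in[1/2,1]$. Put $\phi=-\log|Df|$. For a measurable map $T$ and a measurable $\psi$ with values in $[-\infty,\infty]$, the pressure is $P_T(\psi)=\sup\{h_\mu(T)+\int\psi\,d\mu:\ \mu$ an ergodic $T$-invariant probability measure, $-\int\psi\,d\mu<\infty\}$. A measure $m$ is $\psi$-conformal for $T$ if $m(A)=\int_{T(A)}e^{\psi\circ(T|_A)^{-1}}dm$ for every measurable $A$ on which $T$ is injective. Let $p(t)=P_f(t\phi)$; for $t\in[0,1]$, $m_t$ is the unique $(t\phi-p(t))$-conformal probability measure ($m_1$ is Lebesgue measure). Holes. Let $J_0=[1/2,1)$ and, for $n\ge1$, let $J_n\subset[0,1/2)$ be the interval with $f(J_n)=J_{n-1}$. Let $\mathcal P_1=\{J_n\}_{n\ge0}$ and $\mathcal P_n=\mathcal P_1\vee\bigvee_{k=0}^{n-1}f^{-k}\{[0,1/2),[1/2,1)\}$. A Markov hole is a nonempty set $H$ which is a union of elements of $\mathcal P_{N_0}$ for some fixed $N_0$ and a finite union of intervals. Set $\mathring I^n=\bigcap_{i=0}^nf^{-i}(I\setminus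 H)$, $\mathring f^n=f^n|_{\mathring I^n}$. Let $Y=[1/2,1]$; for $x\in Y\setminus H$ let $\tau_H(x)$ be the least $n\ge1$ with $f^n(x)\in Y\cup H$, and let $\mathring F(x)=f^{\tau_H(x)}(x)$, defined for those $x\in Y\setminus H$ with $f^{\tau_H(x)}(x)\in Y\setminus H$. Let $\mathcal Q$ be the coarsest (finite) partition of $Y\setminus H$ into intervals such that each set $\mathring F(Z\cap\{\tau_H=n\})$ ($Z\in\mathcal P_{N_0}$, $n\ge1$) is a union of elements of $\mathcal Q$. $H$ is non-swallowing if (1) for all $Q_1,Q_2\in\mathcal Q$ there is $n\in\mathbb N$ with $\mathring f^n(Q_1)\cap Q_2\ne\emptyset$, and (2) for all $\delta>0$, $\mathring F((1/2,1/2+\delta))$ has positive Lebesgue measure. (Identities between intervals are up to endpoints.) Let $\phi^H=\phi$ on $I\setminus H$, $\phi^H=-\infty$ on $H$, and $p^H(t)=P_f(t\phi^H)$. *)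

theory Defs
  imports "HOL-Probability.Probability"
begin

section \<open>Ergodic theory: entropy, pressure, conformal measures\<close>

definition invariant_prob :: "'a measure \<Rightarrow> ('a \<Rightarrow> 'a) \<Rightarrow> 'a measure \<Rightarrow> bool" where
  "invariant_prob X T \<mu> \<longleftrightarrow>
     sets \<mu> = sets X \<and> prob_space \<mu> \<and> T \<in> measurable \<mu> \<mu> \<and>
     (\<forall>A\<in>sets \<mu>. emeasure \<mu> (T -` A \<inter> space \<mu>) = emeasure \<mu> A)"

definition ergodic_prob :: "'a measure \<Rightarrow> ('a \<Rightarrow> 'a) \<Rightarrow> 'a measure \<Rightarrow> bool" where
  "ergodic_prob X T \<mu> \<longleftrightarrow>
     invariant_prob X T \<mu> \<and>
     (\<forall>A\<in>sets \<mu>. T -` A \<inter> space \<mu> = A \<longrightarrow> measure \<mu> A = 0 \<or> measure \<mu> A = 1)"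

definition finite_measurable_partition :: "'a measure \<Rightarrow> 'a set set \<Rightarrow> bool" where
  "finite_measurable_partition \<mu> \<xi> \<longleftrightarrow>
     finite \<xi> \<and> \<xi> \<subseteq> sets \<mu> \<and> partition_on (space \<mu>) \<xi>"

text \<open>Cells of measure zero contribute nothing, since \<open>0 * ln 0 = 0\<close>.\<close>

definition partition_entropy :: "'a measure \<Rightarrow> 'a set set \<Rightarrow> real" where
  "partition_entropy \<mu> \<xi> = - (\<Sum>A\<in>\<xi>. measure \<mu> A * ln (measure \<mu> A))"

text \<open>The preimage \<open>T\<^sup>-\<^sup>k \<xi>\<close> of a family of sets, inside \<open>S\<close>.\<close>

definition pull_back :: "'a set \<Rightarrow> ('a \<Rightarrow> 'a) \<Rightarrow> nat \<Rightarrow> 'a set set \<Rightarrow> 'a set set" where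
  "pull_back S T k \<xi> = (\<lambda>A. (T ^^ k) -` A \<inter> S) ` \<xi>"

definition entropy_of_partition :: "'a measure \<Rightarrow> ('a \<Rightarrow> 'a) \<Rightarrow> 'a set set \<Rightarrow> real" where
  "entropy_of_partition \<mu> T \<xi> =
     lim (\<lambda>n. partition_entropy \<mu>
                (common_refinement ((\<lambda>k. pull_back (space \<mu>) T k \<xi>) ` {..<n})) / real n)"

definition KS_entropy :: "'a measure \<Rightarrow> ('a \<Rightarrow> 'a) \<Rightarrow> ereal" where
  "KS_entropy \<mu> T =
     (SUP \<xi> \<in> Collect (finite_measurable_partition \<mu>). ereal (entropy_of_partition \<mu> T \<xi>))"

text \<open>\<open>e2ennreal\<close> truncates negative values to \<open>0\<close>, so the two integrals below are those of the
  positive and of the negative part of \<open>\<psi>\<close>.\<close>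

definition ext_integral :: "'a measure \<Rightarrow> ('a \<Rightarrow> ereal) \<Rightarrow> ereal" where
  "ext_integral \<mu> \<psi> =
     enn2ereal (\<integral>\<^sup>+x. e2ennreal (\<psi> x) \<partial>\<mu>) - enn2ereal (\<integral>\<^sup>+x. e2ennreal (- \<psi> x) \<partial>\<mu>)"

text \<open>The condition \<open>- \<integral> \<psi> d\<mu> < \<infinity>\<close> is the finiteness of the integral of the negative part; in
  this form it also excludes the measures for which \<open>\<integral> \<psi> d\<mu>\<close> is the undefined \<open>\<infinity> - \<infinity>\<close>, a term to
  which \<open>ext_integral\<close> would assign the value \<open>\<infinity>\<close>.\<close>

definition pressure :: "'a measure \<Rightarrow> ('a \<Rightarrow> 'a) \<Rightarrow> ('a \<Rightarrow> ereal) \<Rightarrow> ereal" where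
  "pressure X T \<psi> =
     (SUP \<mu> \<in> {\<mu>. ergodic_prob X T \<mu> \<and> (\<integral>\<^sup>+x. e2ennreal (- \<psi> x) \<partial>\<mu>) < \<infinity>}.
        KS_entropy \<mu> T + ext_integral \<mu> \<psi>)"

definition exp_ereal :: "ereal \<Rightarrow> ennreal" where
  "exp_ereal x =
     (if x = \<infinity> then \<infinity> else if x = -\<infinity> then 0 else ennreal (exp (real_of_ereal x)))"

definition ln_ereal :: "real \<Rightarrow> ereal" where
  "ln_ereal x = (if x = 0 then -\<infinity> else ereal (ln x))"

definition conformal :: "('a \<Rightarrow> 'a) \<Rightarrow> ('a \<Rightarrow> ereal) \<Rightarrow> 'a measure \<Rightarrow> bool" where
  "conformal T \<psi> m \<longleftrightarrow>
     (\<forall>A\<in>sets m. inj_on T A \<longrightarrow>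
        emeasure m A = (\<integral>\<^sup>+y. exp_ereal (\<psi> (inv_into A T y)) * indicator (T ` A) y \<partial>m))"


section \<open>The map and its geometric potential\<close>

definition intermittent :: "real \<Rightarrow> real \<Rightarrow> real" where
  "intermittent \<gamma> x =
     (if x < 1/2 then x * (1 + 2 powr \<gamma> * x powr \<gamma>) else 2 * x - 1)"

abbreviation unit_borel :: "real measure" where
  "unit_borel \<equiv> restrict_space borel {0..1}"

text \<open>At the endpoints of the two branches (in particular at the discontinuity \<open>1/2\<close>) the derivative
  is the one-sided derivative of the branch to which the point belongs.\<close>

definition D_intermittent :: "real \<Rightarrow> real \<Rightarrow> real" where
  "D_intermittent \<gamma> x =
     vector_derivative (intermittent \<gamma>) (at x within (if x < 1/2 then {0..<1/2} else {1/2..1}))"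

definition geom_potential :: "real \<Rightarrow> real \<Rightarrow> ereal" where
  "geom_potential \<gamma> x = ereal (- ln \<bar>D_intermittent \<gamma> x\<bar>)"

definition punctured_potential :: "real \<Rightarrow> real set \<Rightarrow> real \<Rightarrow> ereal" where
  "punctured_potential \<gamma> H x = (if x \<in> H then -\<infinity> else geom_potential \<gamma> x)"

text \<open>The multiple \<open>t \<psi>\<close> for \<open>t \<ge> 0\<close>, with \<open>t * (-\<infinity>) = -\<infinity>\<close> also for \<open>t = 0\<close>. In \<open>ereal\<close> one has
  \<open>0 * (-\<infinity>) = 0\<close>, which would make the hole invisible to the pressure of \<open>t \<phi>\<^sup>H\<close> at \<open>t = 0\<close>.\<close>

definition scale_potential :: "real \<Rightarrow> ('a \<Rightarrow> ereal) \<Rightarrow> 'a \<Rightarrow> ereal" where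
  "scale_potential t \<psi> x = (if \<psi> x = -\<infinity> then -\<infinity> else ereal t * \<psi> x)"

definition closed_pressure :: "real \<Rightarrow> real \<Rightarrow> ereal" where
  "closed_pressure \<gamma> t =
     pressure unit_borel (intermittent \<gamma>) (scale_potential t (geom_potential \<gamma>))"

definition open_pressure :: "real \<Rightarrow> real set \<Rightarrow> real \<Rightarrow> ereal" where
  "open_pressure \<gamma> H t =
     pressure unit_borel (intermittent \<gamma>) (scale_potential t (punctured_potential \<gamma> H))"

definition geom_conformal_prob :: "real \<Rightarrow> real \<Rightarrow> real measure \<Rightarrow> bool" where
  "geom_conformal_prob \<gamma> t m \<longleftrightarrow>
     sets m = sets unit_borel \<and> prob_space m \<and>
     conformal (intermittent \<gamma>)
       (\<lambda>x. scale_potential t (geom_potential \<gamma>) x - closed_pressure \<gamma> t) m"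


section \<open>Markov holes\<close>

text \<open>The left branch maps \<open>[0,1/2)\<close> bijectively onto \<open>[0,1)\<close>, so the preimage of \<open>J\<^sub>n\<close> under it is
  the only subset of \<open>[0,1/2)\<close> with image \<open>J\<^sub>n\<close>.\<close>

primrec J_int :: "real \<Rightarrow> nat \<Rightarrow> real set" where
  "J_int \<gamma> 0 = {1/2..<1}"
| "J_int \<gamma> (Suc n) = {x \<in> {0..<1/2}. intermittent \<gamma> x \<in> J_int \<gamma> n}"

definition P_part :: "real \<Rightarrow> nat \<Rightarrow> real set set" where
  "P_part \<gamma> n =
     common_refinement
       (insert (range (J_int \<gamma>))
         ((\<lambda>k. pull_back {0..1} (intermittent \<gamma>) k {{0..<1/2}, {1/2..<1}}) ` {..<n}))"

text \<open>Identities between intervals are meant up to endpoints. All cells of \<open>P_part\<close> are of the form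
  \<open>[a,b)\<close>; \<open>half_open H\<close> is the representative of this form of a finite union \<open>H \<subseteq> [0,1]\<close> of
  intervals of positive length. Two such unions agree up to endpoints iff their representatives
  are equal.\<close>

definition half_open :: "real set \<Rightarrow> real set" where
  "half_open A = {x \<in> {0..<1}. \<exists>\<epsilon>>0. {x<..<x + \<epsilon>} \<subseteq> A}"

definition markov_hole :: "real \<Rightarrow> nat \<Rightarrow> real set \<Rightarrow> bool" where
  "markov_hole \<gamma> N H \<longleftrightarrow>
     H \<noteq> {} \<and> H \<subseteq> {0..1} \<and>
     (\<exists>\<I>. finite \<I> \<and> (\<forall>I\<in>\<I>. is_interval I \<and> interior I \<noteq> {}) \<and> H = \<Union>\<I>) \<and>
     (\<exists>\<U>\<subseteq>P_part \<gamma> N. half_open H = half_open (\<Union>\<U>))"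

definition survivors :: "real \<Rightarrow> real set \<Rightarrow> nat \<Rightarrow> real set" where
  "survivors \<gamma> H n = {x \<in> {0..1}. \<forall>i\<le>n. (intermittent \<gamma> ^^ i) x \<in> {0..1} - H}"

text \<open>The value is \<open>\<infinity>\<close> if the orbit of \<open>x\<close> never meets \<open>Y \<union> H\<close> after time \<open>0\<close>.\<close>

definition return_time :: "real \<Rightarrow> real set \<Rightarrow> real \<Rightarrow> enat" where
  "return_time \<gamma> H x = Inf (enat ` {n. 1 \<le> n \<and> (intermittent \<gamma> ^^ n) x \<in> {1/2..1} \<union> H})"

definition open_return_map :: "real \<Rightarrow> real set \<Rightarrow> real \<Rightarrow> real" where
  "open_return_map \<gamma> H x = (intermittent \<gamma> ^^ the_enat (return_time \<gamma> H x)) x"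

definition open_return_dom :: "real \<Rightarrow> real set \<Rightarrow> real set" where
  "open_return_dom \<gamma> H =
     {x \<in> {1/2..1} - H. return_time \<gamma> H x \<noteq> \<infinity> \<and> open_return_map \<gamma> H x \<in> {1/2..1} - H}"

definition open_return_image :: "real \<Rightarrow> real set \<Rightarrow> real set \<Rightarrow> real set" where
  "open_return_image \<gamma> H A = open_return_map \<gamma> H ` (A \<inter> open_return_dom \<gamma> H)"

text \<open>For half-open \<open>H\<close>. The fixed point \<open>1\<close>, which lies in no cell and is its own only preimage, is
  left out of \<open>Y \<setminus> H\<close>, so that every set occurring here is exactly a finite union of
  intervals \<open>[a,b)\<close> and no degenerate cell \<open>{1}\<close> arises.\<close>

definition return_compatible :: "real \<Rightarrow> nat \<Rightarrow> real set \<Rightarrow> real set set \<Rightarrow> bool" where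
  "return_compatible \<gamma> N H \<Q> \<longleftrightarrow>
     finite \<Q> \<and> partition_on ({1/2..<1} - H) \<Q> \<and> (\<forall>Q\<in>\<Q>. is_interval Q) \<and>
     (\<forall>Z\<in>P_part \<gamma> N. \<forall>n\<ge>1. \<exists>\<U>\<subseteq>\<Q>.
        open_return_image \<gamma> H (Z \<inter> {x. return_time \<gamma> H x = enat n}) = \<Union>\<U>)"

definition coarsest_return_partition :: "real \<Rightarrow> nat \<Rightarrow> real set \<Rightarrow> real set set \<Rightarrow> bool" where
  "coarsest_return_partition \<gamma> N H \<Q> \<longleftrightarrow>
     return_compatible \<gamma> N H \<Q> \<and>
     (\<forall>\<Q>'. return_compatible \<gamma> N H \<Q>' \<longrightarrow> refines ({1/2..<1} - H) \<Q>' \<Q>)"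

definition non_swallowing :: "real \<Rightarrow> nat \<Rightarrow> real set \<Rightarrow> bool" where
  "non_swallowing \<gamma> N H \<longleftrightarrow>
     (\<exists>\<Q>. coarsest_return_partition \<gamma> N (half_open H) \<Q> \<and>
        (\<forall>Q1\<in>\<Q>. \<forall>Q2\<in>\<Q>. \<exists>n.
           (intermittent \<gamma> ^^ n) ` (Q1 \<inter> survivors \<gamma> (half_open H) n) \<inter> Q2 \<noteq> {})) \<and>
     (\<forall>\<delta>>0. emeasure lebesgue (open_return_image \<gamma> (half_open H) {1/2<..<1/2 + \<delta>}) > 0)"

definition log_lower_escape :: "real \<Rightarrow> real set \<Rightarrow> real measure \<Rightarrow> ereal" where
  "log_lower_escape \<gamma> H m =
     liminf (\<lambda>k. ereal (1 / real k) * ln_ereal (measure m (survivors \<gamma> H k)))"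

end

theory Submission
  imports Defs
begin

text \<open>
  The map \<open>f\<close> sends each of the two branches \<open>[0,1/2)\<close> and \<open>[1/2,1)\<close> onto \<open>[0,1)\<close>, so a point is described by
  its \<^emph>\<open>code\<close>, the word that records which branch is visited at each time, and every word of length \<open>n\<close>
  occurs on a cylinder that \<open>f\<^sup>n\<close> maps onto the whole interval. Three facts about codes carry the proof.

  \<^item> Although \<open>f\<close> has a neutral fixed point at \<open>0\<close>, the length \<open>L\<close> of an interval inside a branch grows to at
  least \<open>L (1 + (2 L)\<^sup>\<gamma>)\<close> in one step (\<open>f_expand\<close>). Hence cylinders shrink uniformly, the code separates points,
  and on cylinders of length \<open>n\<close> the Birkhoff sums of \<open>log f'\<close> vary by \<open>o(n)\<close> (\<open>birkhoff_distortion\<close>).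

  \<^item> By conformality and this distortion bound, the cylinder of a code of length \<open>n\<close> has \<open>m\<^sub>t\<close>-mass at least
  \<open>exp (t S\<^sub>n \<phi> - n p(t) - o(n))\<close> times the mass of \<open>(0,1)\<close> (\<open>measure_cyl_ge\<close>).

  \<^item> A Markov hole is, up to finitely many points, a union of cylinders of one length \<open>N\<close>
  (\<open>cyl_hole_dichotomy\<close>), and a non-swallowing hole misses the cylinder next to \<open>0\<close>
  (\<open>zero_cyl_avoids_hole\<close>).

  Let now \<open>\<mu>\<close> be ergodic with \<open>\<mu>(H) = 0\<close>. If \<open>\<mu>\<close> has no atoms, then it charges only cylinders whose subwords
  of length \<open>N\<close> avoid the hole, and such cylinders lie in the surviving set. The Gibbs inequality
  \<open>H\<^sub>\<mu> + \<Sum> \<mu>(w) a(w) \<le> log \<Sum> exp a(w)\<close>, summed over these cylinders with \<open>a(w)\<close> the Birkhoff sum of \<open>t \<phi>\<close>,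
  bounds the free energy of \<open>\<mu>\<close> at time \<open>n\<close> by \<open>log m\<^sub>t\<close> of the surviving set plus \<open>n p(t) + o(n)\<close>
  (\<open>survivors_ge_entropy\<close>). This concerns the entropy of the codes; the entropy of an arbitrary finite
  partition is no larger, because the code is a generator (\<open>conditional_entropy_small\<close>).
  If \<open>\<mu>\<close> has an atom, it sits on a finite orbit, so its entropy vanishes and its free energy is at most
  \<open>0\<close>. Then it is enough that the cylinders next to \<open>0\<close> survive, because \<open>\<phi>(0) = 0\<close> makes their mass decay
  no faster than \<open>exp (- n p(t) - o(n))\<close> (\<open>survivors_ge_neutral\<close>).

  It remains to see that \<open>m\<^sub>t\<close> charges \<open>(0,1)\<close>. The only conformal measure that could fail to do so is the
  point mass at the fixed point \<open>1\<close>, which needs \<open>p(t) = - t log 2\<close>. The point mass at \<open>0\<close> gives \<open>p(t) \<ge> 0\<close>, which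
  leaves \<open>t = 0\<close> and \<open>p(0) = 0\<close>; this is excluded by the ergodic measure of entropy \<open>log 2\<close> under which the code is
  a sequence of fair coin tosses (\<open>bernoulli_ergodic\<close>, \<open>bernoulli_entropy\<close>).
\<close>

section \<open>Entropy of finite-valued maps\<close>

text \<open>
  A finite partition is handled as the family of fibres of a map with finitely many values. Joint refinement
  then becomes pairing of maps, and the order of refinement becomes functional dependence.
\<close>

definition map_entropy :: "'a measure \<Rightarrow> ('a \<Rightarrow> 'b) \<Rightarrow> real" where
  "map_entropy M X =
     - (\<Sum>v\<in>X ` space M. measure M (X -` {v} \<inter> space M) * ln (measure M (X -` {v} \<inter> space M)))"

abbreviation cond_entropy :: "'a measure \<Rightarrow> ('a \<Rightarrow> 'b) \<Rightarrow> ('a \<Rightarrow> 'c) \<Rightarrow> real" where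
  "cond_entropy M X Y \<equiv> map_entropy M (\<lambda>\<omega>. (X \<omega>, Y \<omega>)) - map_entropy M Y"

text \<open>
  The probability of the fibre through a point. The entropy is the mean of \<open>- ln\<close> of this function
  (\<open>map_entropy_integral\<close>), so that inequalities between entropies can be proved pointwise.
\<close>

definition fibre_prob :: "'a measure \<Rightarrow> ('a \<Rightarrow> 'b) \<Rightarrow> 'a \<Rightarrow> real" where
  "fibre_prob M X \<omega> = measure M {\<omega>' \<in> space M. X \<omega>' = X \<omega>}"

lemma fibre_eq: "X -` {v} \<inter> space M = {\<omega> \<in> space M. X \<omega> = v}"
  by auto

lemma simple_function_fibre [measurable]:
  assumes "simple_function M X" shows "{\<omega> \<in> space M. X \<omega> = v} \<in> sets M"
proof -
  have "X -` {v} \<inter> space M \<in> sets M"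
    using simple_functionD(2)[OF assms] by blast
  then show ?thesis by (simp add: fibre_eq)
qed

lemma simple_function_fibre_prob:
  assumes "simple_function M X" shows "simple_function M (fibre_prob M X)"
proof -
  have "fibre_prob M X = (\<lambda>v. measure M {\<omega>' \<in> space M. X \<omega>' = v}) \<circ> X"
    by (auto simp: fibre_prob_def)
  then show ?thesis using simple_function_compose[OF assms] by metis
qed

context prob_space begin

lemma simple_integrable:
  fixes g :: "'a \<Rightarrow> real"
  assumes "simple_function M g" shows "integrable M g"
proof (rule integrable_const_bound)
  have fin: "finite (g ` space M)" using assms by (rule simple_functionD)
  show "AE x in M. norm (g x) \<le> Max (insert 0 ((\<lambda>y. \<bar>y\<bar>) ` g ` space M))"
    using fin by (intro AE_I2) (auto intro!: Max_ge)
  show "g \<in> borel_measurable M" using assms by (rule borel_measurable_simple_function)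
qed

lemma integral_simple_function_of:
  fixes g :: "'b \<Rightarrow> real"
  assumes X: "simple_function M X"
  shows "(\<integral>\<omega>. g (X \<omega>) \<partial>M) = (\<Sum>v\<in>X ` space M. prob {\<omega>\<in>space M. X \<omega> = v} * g v)"
proof -
  have fin: "finite (X ` space M)" using X by (rule simple_functionD)
  have "(\<integral>\<omega>. g (X \<omega>) \<partial>M) =
      (\<integral>\<omega>. (\<Sum>v\<in>X ` space M. indicator {\<omega>\<in>space M. X \<omega> = v} \<omega> * g v) \<partial>M)"
  proof (intro Bochner_Integration.integral_cong refl)
    fix \<omega> assume \<omega>: "\<omega> \<in> space M"
    have "(\<Sum>v\<in>X ` space M. indicator {\<omega>\<in>space M. X \<omega> = v} \<omega> * g v) =
        (\<Sum>v\<in>{X \<omega>}. indicator {\<omega>\<in>space M. X \<omega> = v} \<omega> * g v)"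
      using \<omega> fin by (intro sum.mono_neutral_right) auto
    then show "g (X \<omega>) = (\<Sum>v\<in>X ` space M. indicator {\<omega>\<in>space M. X \<omega> = v} \<omega> * g v)"
      using \<omega> by simp
  qed
  also have "\<dots> = (\<Sum>v\<in>X ` space M. (\<integral>\<omega>. indicator {\<omega>\<in>space M. X \<omega> = v} \<omega> * g v \<partial>M))"
    using X by (intro Bochner_Integration.integral_sum)
      (auto intro!: integrable_mult_left integrable_real_indicator simple_function_fibre simp: emeasure_eq_measure)
  also have "\<dots> = (\<Sum>v\<in>X ` space M. prob {\<omega>\<in>space M. X \<omega> = v} * g v)"
  proof (intro sum.cong refl)
    fix v
    have "{\<omega>\<in>space M. X \<omega> = v} \<inter> space M = {\<omega>\<in>space M. X \<omega> = v}" by auto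
    then show "(\<integral>\<omega>. indicator {\<omega>\<in>space M. X \<omega> = v} \<omega> * g v \<partial>M) = prob {\<omega>\<in>space M. X \<omega> = v} * g v"
      by simp
  qed
  finally show ?thesis .
qed

lemma map_entropy_integral:
  assumes X: "simple_function M X"
  shows "map_entropy M X = (\<integral>\<omega>. - ln (fibre_prob M X \<omega>) \<partial>M)"
  using integral_simple_function_of[OF X, of "\<lambda>v. - ln (prob {\<omega>\<in>space M. X \<omega> = v})"]
  by (simp add: map_entropy_def fibre_prob_def fibre_eq sum_negf)

lemma integrable_ln_fibre_prob:
  assumes X: "simple_function M X" shows "integrable M (\<lambda>\<omega>. ln (fibre_prob M X \<omega>))"
  using simple_function_compose[OF simple_function_fibre_prob[OF X], of ln]
  by (intro simple_integrable) (simp add: comp_def)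

lemma AE_fibre_prob_pos:
  assumes X: "simple_function M X" shows "AE \<omega> in M. fibre_prob M X \<omega> > 0"
proof -
  have fin: "finite (X ` space M)" using X by (rule simple_functionD)
  have "AE \<omega> in M. \<forall>v\<in>X ` space M. prob {\<omega>\<in>space M. X \<omega> = v} = 0 \<longrightarrow> X \<omega> \<noteq> v"
  proof (rule AE_finite_allI[OF fin])
    fix v
    show "AE \<omega> in M. prob {\<omega>\<in>space M. X \<omega> = v} = 0 \<longrightarrow> X \<omega> \<noteq> v"
    proof (cases "prob {\<omega>\<in>space M. X \<omega> = v} = 0")
      case True
      then have "{\<omega>\<in>space M. X \<omega> = v} \<in> null_sets M"
        using simple_function_fibre[OF X] by (auto simp: emeasure_eq_measure)
      then show ?thesis by (auto dest!: AE_not_in elim!: AE_mp)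
    qed auto
  qed
  then show ?thesis
  proof (rule AE_mp, intro AE_I2 impI)
    fix \<omega> assume "\<omega> \<in> space M" "\<forall>v\<in>X ` space M. prob {\<omega>\<in>space M. X \<omega> = v} = 0 \<longrightarrow> X \<omega> \<noteq> v"
    then have "fibre_prob M X \<omega> \<noteq> 0" unfolding fibre_prob_def by auto
    then show "fibre_prob M X \<omega> > 0"
      using measure_nonneg[of M] by (auto simp: fibre_prob_def less_le)
  qed
qed

lemma map_entropy_mono:
  assumes X: "simple_function M X" and Y: "simple_function M Y"
    and det: "\<And>\<omega> \<omega>'. \<omega> \<in> space M \<Longrightarrow> \<omega>' \<in> space M \<Longrightarrow> Y \<omega> = Y \<omega>' \<Longrightarrow> X \<omega> = X \<omega>'"
  shows "map_entropy M X \<le> map_entropy M Y"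
  unfolding map_entropy_integral[OF X] map_entropy_integral[OF Y]
proof (rule integral_mono_AE)
  show "AE \<omega> in M. - ln (fibre_prob M X \<omega>) \<le> - ln (fibre_prob M Y \<omega>)"
    using AE_fibre_prob_pos[OF Y] AE_space
  proof (eventually_elim)
    case (elim \<omega>)
    have "fibre_prob M Y \<omega> \<le> fibre_prob M X \<omega>"
      unfolding fibre_prob_def using elim det
      by (intro finite_measure_mono simple_function_fibre[OF X]) blast
    then show ?case using elim by simp
  qed
qed (use integrable_ln_fibre_prob X Y in auto)

lemma map_entropy_cong:
  assumes X: "simple_function M X" and Y: "simple_function M Y"
    and "\<And>\<omega> \<omega>'. \<omega> \<in> space M \<Longrightarrow> \<omega>' \<in> space M \<Longrightarrow> Y \<omega> = Y \<omega>' \<longleftrightarrow> X \<omega> = X \<omega>'"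
  shows "map_entropy M X = map_entropy M Y"
  using assms by (intro antisym map_entropy_mono) auto

lemma map_entropy_nonneg:
  assumes X: "simple_function M X" shows "map_entropy M X \<ge> 0"
  unfolding map_entropy_integral[OF X]
proof (intro integral_nonneg_AE)
  show "AE \<omega> in M. 0 \<le> - ln (fibre_prob M X \<omega>)"
    using AE_fibre_prob_pos[OF X] by eventually_elim (simp add: fibre_prob_def)
qed

lemma map_entropy_const: "map_entropy M (\<lambda>_. c) = 0"
proof -
  obtain \<omega> where "\<omega> \<in> space M" using not_empty by blast
  then have "(\<lambda>_. c) ` space M = {c}" by auto
  then show ?thesis by (simp add: map_entropy_def prob_space)
qed

text \<open>
  Strong subadditivity. Under the sign of the integral, \<open>ln x \<le> x - 1\<close> is applied to
  \<open>x = p(X,Z) p(Y,Z) / (p(X,Y,Z) p(Z))\<close>; the mean of \<open>x\<close> is at most \<open>1\<close> because summing out \<open>X\<close> and \<open>Y\<close>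
  separately turns each factor in the numerator into \<open>p(Z)\<close>. All rules for conditional entropy below are
  instances.
\<close>

lemma map_entropy_submodular:
  assumes X: "simple_function M X" and Y: "simple_function M Y" and Z: "simple_function M Z"
  shows "map_entropy M (\<lambda>\<omega>. (X \<omega>, Y \<omega>, Z \<omega>)) + map_entropy M Z
    \<le> map_entropy M (\<lambda>\<omega>. (X \<omega>, Z \<omega>)) + map_entropy M (\<lambda>\<omega>. (Y \<omega>, Z \<omega>))"
proof -
  define W where "W = (\<lambda>\<omega>. (X \<omega>, Y \<omega>, Z \<omega>))"
  define XZ where "XZ = (\<lambda>\<omega>. (X \<omega>, Z \<omega>))"
  define YZ where "YZ = (\<lambda>\<omega>. (Y \<omega>, Z \<omega>))"
  have sf: "simple_function M W" "simple_function M XZ" "simple_function M YZ"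
    unfolding W_def XZ_def YZ_def using X Y Z by (auto intro!: simple_function_Pair)
  note sfs = sf Z
  let ?A = "X ` space M" and ?B = "Y ` space M" and ?C = "Z ` space M"
  have fin: "finite ?A" "finite ?B" "finite ?C" using X Y Z by (auto dest: simple_functionD)
  define w where "w x y z = prob {\<omega>\<in>space M. W \<omega> = (x, y, z)}" for x y z
  define p where "p x z = prob {\<omega>\<in>space M. XZ \<omega> = (x, z)}" for x z
  define q where "q y z = prob {\<omega>\<in>space M. YZ \<omega> = (y, z)}" for y z
  define r where "r z = prob {\<omega>\<in>space M. Z \<omega> = z}" for z
  \<comment> \<open>The ratio \<open>x\<close> to which \<open>ln x \<le> x - 1\<close> is applied, as a function of the three values.\<close>
  define g where "g = (\<lambda>(x, y, z). if w x y z > 0 then p x z * q y z / (w x y z * r z) else 0)"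
  have marg: "(\<Sum>v\<in>V ` space M. prob {\<omega>\<in>space M. V \<omega> = v \<and> Z \<omega> = z}) = r z"
    if V: "simple_function M V" for V :: "'a \<Rightarrow> 'e" and z
  proof -
    have fV: "finite (V ` space M)" using V by (rule simple_functionD)
    have ev: "{\<omega>\<in>space M. V \<omega> = v \<and> Z \<omega> = z} \<in> events" for v
    proof -
      have "{\<omega>\<in>space M. V \<omega> = v \<and> Z \<omega> = z} = {\<omega>\<in>space M. V \<omega> = v} \<inter> {\<omega>\<in>space M. Z \<omega> = z}" by auto
      then show ?thesis using simple_function_fibre[OF V] simple_function_fibre[OF Z] by auto
    qed
    have "r z = prob (\<Union>v\<in>V ` space M. {\<omega>\<in>space M. V \<omega> = v \<and> Z \<omega> = z})"
      unfolding r_def by (rule arg_cong[where f=prob]) auto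
    also have "\<dots> = (\<Sum>v\<in>V ` space M. prob {\<omega>\<in>space M. V \<omega> = v \<and> Z \<omega> = z})"
      using fV ev by (intro finite_measure_finite_Union) (auto simp: disjoint_family_on_def)
    finally show ?thesis by simp
  qed
  have r_nn: "r z \<ge> 0" for z by (simp add: r_def)
  have gW: "(\<integral>\<omega>. g (W \<omega>) \<partial>M) \<le> 1"
  proof -
    have "(\<integral>\<omega>. g (W \<omega>) \<partial>M) = (\<Sum>v\<in>W ` space M. prob {\<omega>\<in>space M. W \<omega> = v} * g v)"
      by (rule integral_simple_function_of[OF sf(1)])
    also have "\<dots> \<le> (\<Sum>v\<in>W ` space M. (case v of (x, y, z) \<Rightarrow> p x z * q y z / r z))"
    proof (rule sum_mono)
      fix v assume "v \<in> W ` space M"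
      obtain x y z where v: "v = (x, y, z)" by (cases v)
      have "w x y z * g (x, y, z) \<le> p x z * q y z / r z"
        by (auto simp: g_def p_def q_def r_def intro!: divide_nonneg_nonneg)
      then show "prob {\<omega>\<in>space M. W \<omega> = v} * g v \<le> (case v of (x, y, z) \<Rightarrow> p x z * q y z / r z)"
        by (simp add: w_def v)
    qed
    also have "\<dots> \<le> (\<Sum>v\<in>?A \<times> ?B \<times> ?C. (case v of (x, y, z) \<Rightarrow> p x z * q y z / r z))"
      using fin by (intro sum_mono2) (auto simp: W_def p_def q_def r_def intro!: divide_nonneg_nonneg)
    also have "\<dots> = (\<Sum>x\<in>?A. \<Sum>y\<in>?B. \<Sum>z\<in>?C. p x z * q y z / r z)"
      by (simp add: sum.cartesian_product)
    also have "\<dots> = (\<Sum>x\<in>?A. \<Sum>z\<in>?C. \<Sum>y\<in>?B. p x z * q y z / r z)"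
      by (intro sum.cong refl, rule sum.swap)
    also have "\<dots> = (\<Sum>z\<in>?C. \<Sum>x\<in>?A. \<Sum>y\<in>?B. p x z * q y z / r z)"
      by (rule sum.swap)
    also have "\<dots> = (\<Sum>z\<in>?C. (\<Sum>x\<in>?A. p x z) * (\<Sum>y\<in>?B. q y z) / r z)"
      by (simp add: sum_product sum_divide_distrib)
    also have "\<dots> = (\<Sum>z\<in>?C. r z * r z / r z)"
      using marg[OF X] marg[OF Y] by (simp add: p_def q_def XZ_def YZ_def)
    also have "\<dots> = (\<Sum>z\<in>?C. r z)" by (intro sum.cong) auto
    also have "\<dots> = 1"
      using integral_simple_function_of[OF Z, of "\<lambda>_. 1"] by (simp add: r_def prob_space)
    finally show ?thesis .
  qed
  have sg: "simple_function M (\<lambda>\<omega>. g (W \<omega>))"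
    using simple_function_compose[OF sf(1), of g] by (simp add: comp_def)
  have "(\<integral>\<omega>. ln (fibre_prob M XZ \<omega>) + ln (fibre_prob M YZ \<omega>)
          - ln (fibre_prob M W \<omega>) - ln (fibre_prob M Z \<omega>) \<partial>M) \<le> (\<integral>\<omega>. g (W \<omega>) - 1 \<partial>M)"
  proof (rule integral_mono_AE)
    show "AE \<omega> in M. ln (fibre_prob M XZ \<omega>) + ln (fibre_prob M YZ \<omega>)
          - ln (fibre_prob M W \<omega>) - ln (fibre_prob M Z \<omega>) \<le> g (W \<omega>) - 1"
      using AE_fibre_prob_pos[OF sf(1)] AE_fibre_prob_pos[OF sf(2)] AE_fibre_prob_pos[OF sf(3)]
        AE_fibre_prob_pos[OF Z]
    proof eventually_elim
      case (elim \<omega>)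
      have e: "fibre_prob M W \<omega> = w (X \<omega>) (Y \<omega>) (Z \<omega>)" "fibre_prob M XZ \<omega> = p (X \<omega>) (Z \<omega>)"
        "fibre_prob M YZ \<omega> = q (Y \<omega>) (Z \<omega>)" "fibre_prob M Z \<omega> = r (Z \<omega>)"
        by (simp_all add: fibre_prob_def w_def p_def q_def r_def W_def XZ_def YZ_def)
      have gW: "g (W \<omega>) = fibre_prob M XZ \<omega> * fibre_prob M YZ \<omega> / (fibre_prob M W \<omega> * fibre_prob M Z \<omega>)"
        using elim unfolding e by (simp add: g_def W_def)
      have "ln (fibre_prob M XZ \<omega>) + ln (fibre_prob M YZ \<omega>)
          - ln (fibre_prob M W \<omega>) - ln (fibre_prob M Z \<omega>) = ln (g (W \<omega>))"
        unfolding gW using elim by (simp add: ln_mult ln_div)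
      also have "\<dots> \<le> g (W \<omega>) - 1"
        using elim unfolding gW by (intro ln_le_minus_one) simp
      finally show ?case .
    qed
  next
    show "integrable M (\<lambda>\<omega>. ln (fibre_prob M XZ \<omega>) + ln (fibre_prob M YZ \<omega>)
          - ln (fibre_prob M W \<omega>) - ln (fibre_prob M Z \<omega>))"
      by (intro Bochner_Integration.integrable_add Bochner_Integration.integrable_diff
          integrable_ln_fibre_prob sfs)
    show "integrable M (\<lambda>\<omega>. g (W \<omega>) - 1)"
      using simple_integrable[OF sg] by simp
  qed
  also have "\<dots> \<le> 0"
    using gW simple_integrable[OF sg] by (simp add: prob_space)
  finally have "(\<integral>\<omega>. ln (fibre_prob M XZ \<omega>) \<partial>M) + (\<integral>\<omega>. ln (fibre_prob M YZ \<omega>) \<partial>M)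
      - (\<integral>\<omega>. ln (fibre_prob M W \<omega>) \<partial>M) - (\<integral>\<omega>. ln (fibre_prob M Z \<omega>) \<partial>M) \<le> 0"
    using integrable_ln_fibre_prob[OF sf(1)] integrable_ln_fibre_prob[OF sf(2)]
      integrable_ln_fibre_prob[OF sf(3)] integrable_ln_fibre_prob[OF Z] by simp
  then show ?thesis
    using sfs unfolding W_def[symmetric] XZ_def[symmetric] YZ_def[symmetric]
    by (simp add: map_entropy_integral)
qed

lemma map_entropy_subadditive:
  assumes X: "simple_function M X" and Y: "simple_function M Y"
  shows "map_entropy M (\<lambda>\<omega>. (X \<omega>, Y \<omega>)) \<le> map_entropy M X + map_entropy M Y"
proof -
  have c: "simple_function M (\<lambda>_. ())" by simp
  have "map_entropy M (\<lambda>\<omega>. (X \<omega>, Y \<omega>, ())) + map_entropy M (\<lambda>_. ())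
      \<le> map_entropy M (\<lambda>\<omega>. (X \<omega>, ())) + map_entropy M (\<lambda>\<omega>. (Y \<omega>, ()))"
    by (rule map_entropy_submodular[OF X Y c])
  moreover have "map_entropy M (\<lambda>\<omega>. (X \<omega>, Y \<omega>, ())) = map_entropy M (\<lambda>\<omega>. (X \<omega>, Y \<omega>))"
    "map_entropy M (\<lambda>\<omega>. (X \<omega>, ())) = map_entropy M X"
    "map_entropy M (\<lambda>\<omega>. (Y \<omega>, ())) = map_entropy M Y"
    using X Y by (auto intro!: map_entropy_cong simple_function_Pair)
  ultimately show ?thesis by (simp add: map_entropy_const)
qed

lemma conditional_entropy_antimono:
  assumes X: "simple_function M X" and Y: "simple_function M Y" and Z: "simple_function M Z"
    and det: "\<And>\<omega> \<omega>'. \<omega> \<in> space M \<Longrightarrow> \<omega>' \<in> space M \<Longrightarrow> Y \<omega> = Y \<omega>' \<Longrightarrow> Z \<omega> = Z \<omega>'"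
  shows "cond_entropy M X Y
    \<le> cond_entropy M X Z"
proof -
  have "map_entropy M (\<lambda>\<omega>. (X \<omega>, Y \<omega>, Z \<omega>)) = map_entropy M (\<lambda>\<omega>. (X \<omega>, Y \<omega>))"
    "map_entropy M (\<lambda>\<omega>. (Y \<omega>, Z \<omega>)) = map_entropy M Y"
    using det by (auto intro!: map_entropy_cong simple_function_Pair X Y Z)
  then show ?thesis using map_entropy_submodular[OF X Y Z] by simp
qed

lemma conditional_entropy_subadditive:
  assumes X: "simple_function M X" and Y: "simple_function M Y" and Z: "simple_function M Z"
  shows "cond_entropy M (\<lambda>\<omega>. (X \<omega>, Y \<omega>)) Z \<le> cond_entropy M X Z + cond_entropy M Y Z"
proof -
  have "map_entropy M (\<lambda>\<omega>. (X \<omega>, Y \<omega>, Z \<omega>)) = map_entropy M (\<lambda>\<omega>. ((X \<omega>, Y \<omega>), Z \<omega>))"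
    by (auto intro!: map_entropy_cong simple_function_Pair X Y Z)
  then show ?thesis using map_entropy_submodular[OF X Y Z] by simp
qed

lemma essential_range_nonempty:
  assumes X: "simple_function M X"
    and sup: "\<And>v. v \<in> X ` space M \<Longrightarrow> prob {\<omega>\<in>space M. X \<omega> = v} > 0 \<Longrightarrow> v \<in> V"
  shows "V \<noteq> {}"
proof
  assume e: "V = {}"
  have "AE \<omega> in M. False"
    using AE_fibre_prob_pos[OF X] AE_space
    by eventually_elim (use sup e in \<open>auto simp: fibre_prob_def\<close>)
  then show False by simp
qed

text \<open>
  The Gibbs inequality: apply \<open>ln x \<le> x - 1\<close> to \<open>x = exp a / (Z p)\<close>, where \<open>Z\<close> is the partition sum. That the
  sum extends only over a set \<open>V\<close> of values that contains those of positive probability is what lets the hole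
  enter the estimate later.
\<close>

lemma map_entropy_gibbs:
  fixes a :: "'b \<Rightarrow> real"
  assumes X: "simple_function M X" and V: "finite V"
    and sup: "\<And>v. v \<in> X ` space M \<Longrightarrow> prob {\<omega>\<in>space M. X \<omega> = v} > 0 \<Longrightarrow> v \<in> V"
  shows "map_entropy M X + (\<integral>\<omega>. a (X \<omega>) \<partial>M) \<le> ln (\<Sum>v\<in>V. exp (a v))"
proof -
  define Z where "Z = (\<Sum>v\<in>V. exp (a v))"
  define g where "g v = (if prob {\<omega>\<in>space M. X \<omega> = v} > 0
      then exp (a v) / (Z * prob {\<omega>\<in>space M. X \<omega> = v}) else 0)" for v
  have fin: "finite (X ` space M)" using X by (rule simple_functionD)
  have "V \<noteq> {}" by (rule essential_range_nonempty[OF X sup])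
  then have Z: "Z > 0" unfolding Z_def using V by (intro sum_pos) auto
  have sf: "simple_function M (\<lambda>\<omega>. h (X \<omega>))" for h :: "'b \<Rightarrow> real"
    using simple_function_compose[OF X, of h] by (simp add: comp_def)
  have "(\<integral>\<omega>. - ln (fibre_prob M X \<omega>) + a (X \<omega>) \<partial>M) \<le> (\<integral>\<omega>. g (X \<omega>) - 1 + ln Z \<partial>M)"
  proof (rule integral_mono_AE)
    show "AE \<omega> in M. - ln (fibre_prob M X \<omega>) + a (X \<omega>) \<le> g (X \<omega>) - 1 + ln Z"
      using AE_fibre_prob_pos[OF X]
    proof eventually_elim
      case (elim \<omega>)
      have gx: "g (X \<omega>) = exp (a (X \<omega>)) / (Z * fibre_prob M X \<omega>)"
        using elim by (simp add: g_def fibre_prob_def)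
      have "- ln (fibre_prob M X \<omega>) + a (X \<omega>) = ln (g (X \<omega>)) + ln Z"
        unfolding gx using elim Z by (simp add: ln_div ln_mult)
      also have "ln (g (X \<omega>)) \<le> g (X \<omega>) - 1"
        unfolding gx using elim Z by (intro ln_le_minus_one) simp
      finally show ?case by simp
    qed
  qed (use integrable_ln_fibre_prob[OF X] simple_integrable[OF sf] in auto)
  also have "\<dots> = (\<integral>\<omega>. g (X \<omega>) \<partial>M) - 1 + ln Z"
    using simple_integrable[OF sf] by (simp add: prob_space)
  also have "(\<integral>\<omega>. g (X \<omega>) \<partial>M) \<le> 1"
  proof -
    have "(\<integral>\<omega>. g (X \<omega>) \<partial>M) = (\<Sum>v\<in>X ` space M. prob {\<omega>\<in>space M. X \<omega> = v} * g v)"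
      by (rule integral_simple_function_of[OF X])
    also have "\<dots> = (\<Sum>v\<in>X ` space M \<inter> V. prob {\<omega>\<in>space M. X \<omega> = v} * g v)"
      using fin sup by (intro sum.mono_neutral_right) (auto simp: g_def)
    also have "\<dots> \<le> (\<Sum>v\<in>X ` space M \<inter> V. exp (a v) / Z)"
      using Z by (intro sum_mono) (auto simp: g_def)
    also have "\<dots> \<le> (\<Sum>v\<in>V. exp (a v) / Z)"
      using Z V by (intro sum_mono2) auto
    also have "\<dots> = 1" using Z by (simp add: Z_def sum_divide_distrib[symmetric])
    finally show ?thesis .
  qed
  finally have "(\<integral>\<omega>. - ln (fibre_prob M X \<omega>) + a (X \<omega>) \<partial>M) \<le> ln Z" by simp
  then show ?thesis
    using integrable_ln_fibre_prob[OF X] simple_integrable[OF sf]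
    by (simp add: map_entropy_integral[OF X] Z_def)
qed

corollary map_entropy_le_ln_card:
  assumes X: "simple_function M X" and V: "finite V"
    and sup: "\<And>v. v \<in> X ` space M \<Longrightarrow> prob {\<omega>\<in>space M. X \<omega> = v} > 0 \<Longrightarrow> v \<in> V"
  shows "map_entropy M X \<le> ln (card V)"
  using map_entropy_gibbs[OF X V sup, of "\<lambda>_. 0"] by simp

end

section \<open>Itineraries under a measure-preserving map\<close>

text \<open>
  Fekete's lemma. It is needed because the entropy of a partition is defined by a limit operator, whose value
  means nothing before convergence is known.
\<close>

lemma subadditive_quotient_convergent:
  fixes a :: "nat \<Rightarrow> real"
  assumes nonneg: "\<And>n. a n \<ge> 0" and sub: "\<And>m n. a (m + n) \<le> a m + a n"
  shows "convergent (\<lambda>n. a n / real n)"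
proof -
  define L where "L = (INF n\<in>{1..}. a n / real n)"
  have bdd: "bdd_below ((\<lambda>n. a n / real n) ` {1..})"
    using nonneg by (intro bdd_belowI[of _ 0]) auto
  have lower: "L \<le> a n / real n" if "n \<ge> 1" for n
    unfolding L_def using bdd that by (intro cINF_lower) auto
  have mult: "a (q * N + r) \<le> real q * a N + a r" for q N r
  proof (induction q)
    case (Suc q)
    have "a (Suc q * N + r) \<le> a N + a (q * N + r)"
      using sub[of N "q * N + r"] by (simp add: add.assoc)
    with Suc show ?case by (simp add: algebra_simps)
  qed simp
  have "(\<lambda>n. a n / real n) \<longlonglongrightarrow> L"
  proof (rule LIMSEQ_I)
    fix \<epsilon> :: real assume \<epsilon>: "\<epsilon> > 0"
    have "\<exists>N\<in>{1..}. a N / real N < L + \<epsilon> / 2"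
      using \<epsilon> bdd cINF_less_iff[of "{1..}" "\<lambda>n. a n / real n" "L + \<epsilon> / 2"] by (auto simp: L_def)
    then obtain N where N: "N \<ge> 1" "a N / real N < L + \<epsilon> / 2" by auto
    \<comment> \<open>A bound for all remainder terms \<open>a (n mod N)\<close>.\<close>
    define C where "C = (\<Sum>r<N. a r)"
    have C: "a r \<le> C" if "r < N" for r
      unfolding C_def using that nonneg by (intro member_le_sum) auto
    obtain n0 :: nat where n0: "real n0 > C / (\<epsilon> / 2)" using reals_Archimedean2 by blast
    show "\<exists>no. \<forall>n\<ge>no. norm (a n / real n - L) < \<epsilon>"
    proof (intro exI allI impI)
      fix n assume n: "n \<ge> Suc n0"
      have "a n \<le> real (n div N) * a N + a (n mod N)"
        using mult[of "n div N" N "n mod N"] by simp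
      also have "\<dots> \<le> real (n div N) * a N + C" using C N by simp
      also have "real (n div N) * a N = real (n div N) * real N * (a N / real N)" using N by simp
      also have "\<dots> \<le> real n * (a N / real N)"
      proof (rule mult_right_mono)
        have "(n div N) * N \<le> n" by simp
        then show "real (n div N) * real N \<le> real n" by (metis of_nat_le_iff of_nat_mult)
      qed (use nonneg in auto)
      also have "\<dots> \<le> real n * (L + \<epsilon> / 2)" using N by (intro mult_left_mono) auto
      finally have "a n \<le> real n * (L + \<epsilon> / 2) + C" by simp
      moreover have "C < real n * (\<epsilon> / 2)"
      proof -
        have "C < real n0 * (\<epsilon> / 2)" using n0 \<epsilon> by (simp add: field_simps)
        also have "\<dots> \<le> real n * (\<epsilon> / 2)" using n \<epsilon> by (intro mult_right_mono) auto
        finally show ?thesis .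
      qed
      ultimately have "a n < real n * (L + \<epsilon>)" by (simp add: algebra_simps)
      then have "a n / real n < L + \<epsilon>" using n by (simp add: field_simps)
      then show "norm (a n / real n - L) < \<epsilon>" using lower[of n] n by simp
    qed
  qed
  then show ?thesis by (auto simp: convergent_def)
qed

definition itinerary :: "('a \<Rightarrow> 'a) \<Rightarrow> ('a \<Rightarrow> 'b) \<Rightarrow> nat \<Rightarrow> 'a \<Rightarrow> 'b list" where
  "itinerary T X n \<omega> = map (\<lambda>k. X ((T ^^ k) \<omega>)) [0..<n]"

lemma itinerary_0 [simp]: "itinerary T X 0 \<omega> = []"
  by (simp add: itinerary_def)

lemma itinerary_Suc: "itinerary T X (Suc n) \<omega> = itinerary T X n \<omega> @ [X ((T ^^ n) \<omega>)]"
  by (simp add: itinerary_def)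

lemma length_itinerary [simp]: "length (itinerary T X n \<omega>) = n"
  by (simp add: itinerary_def)

lemma itinerary_add: "itinerary T X (m + n) \<omega> = itinerary T X m \<omega> @ itinerary T X n ((T ^^ m) \<omega>)"
proof (induction n)
  case (Suc n)
  have "(T ^^ n) ((T ^^ m) \<omega>) = (T ^^ (m + n)) \<omega>"
    by (simp add: add.commute[of m n] funpow_add)
  then show ?case using Suc by (simp add: itinerary_Suc)
qed simp

lemma itinerary_Suc_left: "itinerary T X (Suc n) \<omega> = X \<omega> # itinerary T X n (T \<omega>)"
  using itinerary_add[of T X 1 n \<omega>] by (simp add: itinerary_def)

lemma itinerary_eq_iff:
  "itinerary T X n \<omega> = itinerary T Y n \<omega>' \<longleftrightarrow> (\<forall>k<n. X ((T ^^ k) \<omega>) = Y ((T ^^ k) \<omega>'))"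
  by (auto simp: itinerary_def)

lemma itinerary_eq_mono:
  assumes "itinerary T X n \<omega> = itinerary T X n \<omega>'" "m \<le> n"
  shows "itinerary T X m \<omega> = itinerary T X m \<omega>'"
  using assms by (auto simp: itinerary_eq_iff)

locale invariant_system = prob_space M for M :: "'a measure" +
  fixes T :: "'a \<Rightarrow> 'a"
  assumes T [measurable]: "T \<in> measurable M M"
    and invariant: "\<And>A. A \<in> sets M \<Longrightarrow> emeasure M (T -` A \<inter> space M) = emeasure M A"
begin

lemma T_funpow [measurable]: "T ^^ n \<in> measurable M M"
  by (induction n) auto

lemma funpow_space: "\<omega> \<in> space M \<Longrightarrow> (T ^^ n) \<omega> \<in> space M"
  using T_funpow[of n] by (auto simp: measurable_def)

lemma distr_T: "distr M M T = M"
  by (rule measure_eqI) (auto simp: emeasure_distr invariant)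

lemma distr_funpow: "distr M M (T ^^ n) = M"
proof (induction n)
  case 0
  show ?case by (simp add: distr_id[unfolded id_def] id_def)
next
  case (Suc n)
  have "distr M M (T ^^ Suc n) = distr (distr M M (T ^^ n)) M T"
    by (subst distr_distr) (auto simp: comp_def)
  then show ?case unfolding Suc distr_T .
qed

lemma prob_vimage_funpow:
  assumes "A \<in> events" shows "prob {\<omega>\<in>space M. (T ^^ n) \<omega> \<in> A} = prob A"
proof -
  have "prob A = measure (distr M M (T ^^ n)) A" by (simp add: distr_funpow)
  also have "\<dots> = prob ((T ^^ n) -` A \<inter> space M)" using assms by (intro measure_distr) auto
  also have "(T ^^ n) -` A \<inter> space M = {\<omega>\<in>space M. (T ^^ n) \<omega> \<in> A}" by auto
  finally show ?thesis by simp
qed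

lemma integral_funpow:
  fixes g :: "'a \<Rightarrow> real"
  assumes [measurable]: "g \<in> borel_measurable M"
  shows "(\<integral>\<omega>. g ((T ^^ n) \<omega>) \<partial>M) = (\<integral>\<omega>. g \<omega> \<partial>M)"
  using integral_distr[of "T ^^ n" M M g] by (simp add: distr_funpow)

lemma simple_function_funpow:
  assumes "simple_function M X" shows "simple_function M (\<lambda>\<omega>. X ((T ^^ n) \<omega>))"
  using simple_function_comp[OF T_funpow assms] .

lemma simple_function_itinerary:
  assumes X: "simple_function M X" shows "simple_function M (itinerary T X n)"
proof (induction n)
  case 0
  have "itinerary T X 0 = (\<lambda>_. [])" by auto
  then show ?case by simp
next
  case (Suc n)
  have "simple_function M (\<lambda>\<omega>. (itinerary T X n \<omega>, X ((T ^^ n) \<omega>)))"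
    using Suc simple_function_funpow[OF X] by (rule simple_function_Pair)
  from simple_function_compose[OF this, of "\<lambda>(xs, x). xs @ [x]"] show ?case
    by (simp add: comp_def itinerary_Suc[abs_def])
qed

lemma map_entropy_funpow:
  assumes X: "simple_function M X"
  shows "map_entropy M (\<lambda>\<omega>. X ((T ^^ n) \<omega>)) = map_entropy M X"
proof -
  have "(\<integral>\<omega>. - ln (fibre_prob M (\<lambda>\<omega>. X ((T ^^ n) \<omega>)) \<omega>) \<partial>M)
      = (\<integral>\<omega>. - ln (fibre_prob M X ((T ^^ n) \<omega>)) \<partial>M)"
  proof (intro Bochner_Integration.integral_cong refl)
    fix \<omega> assume "\<omega> \<in> space M"
    have "fibre_prob M (\<lambda>\<omega>. X ((T ^^ n) \<omega>)) \<omega>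
        = prob {\<omega>'\<in>space M. (T ^^ n) \<omega>' \<in> {\<omega>''\<in>space M. X \<omega>'' = X ((T ^^ n) \<omega>)}}"
      unfolding fibre_prob_def by (rule arg_cong[where f=prob]) (auto simp: funpow_space)
    also have "\<dots> = fibre_prob M X ((T ^^ n) \<omega>)"
      unfolding fibre_prob_def by (rule prob_vimage_funpow[OF simple_function_fibre[OF X]])
    finally show "- ln (fibre_prob M (\<lambda>\<omega>. X ((T ^^ n) \<omega>)) \<omega>) = - ln (fibre_prob M X ((T ^^ n) \<omega>))"
      by simp
  qed
  also have "\<dots> = (\<integral>\<omega>. - ln (fibre_prob M X \<omega>) \<partial>M)"
    by (intro integral_funpow)
      (use borel_measurable_simple_function[OF simple_function_fibre_prob[OF X]] in measurable)
  finally show ?thesis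
    by (simp add: map_entropy_integral X simple_function_funpow del: integral_minus)
qed

lemma itinerary_entropy_subadditive:
  assumes X: "simple_function M X"
  shows "map_entropy M (itinerary T X (m + n))
    \<le> map_entropy M (itinerary T X m) + map_entropy M (itinerary T X n)"
proof -
  note sf = simple_function_itinerary[OF X]
  have "map_entropy M (itinerary T X (m + n))
      \<le> map_entropy M (\<lambda>\<omega>. (itinerary T X m \<omega>, itinerary T X n ((T ^^ m) \<omega>)))"
    by (intro map_entropy_mono simple_function_Pair sf simple_function_funpow)
      (auto simp: itinerary_add)
  also have "\<dots> \<le> map_entropy M (itinerary T X m) + map_entropy M (\<lambda>\<omega>. itinerary T X n ((T ^^ m) \<omega>))"
    by (intro map_entropy_subadditive sf simple_function_funpow)
  finally show ?thesis by (simp add: map_entropy_funpow[OF sf])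
qed

lemma itinerary_entropy_convergent:
  assumes X: "simple_function M X"
  shows "convergent (\<lambda>n. map_entropy M (itinerary T X n) / real n)"
  by (intro subadditive_quotient_convergent map_entropy_nonneg itinerary_entropy_subadditive
      simple_function_itinerary X)

text \<open>
  Passing from \<open>Y\<close> to \<open>X\<close> costs at most the conditional entropy of \<open>X\<close> given \<open>Y\<close> at each step: the symbol of \<open>X\<close>
  at time \<open>k\<close> is conditioned on the whole itinerary of \<open>Y\<close>, hence on the symbol of \<open>Y\<close> at time \<open>k\<close>, and the
  measure is invariant.
\<close>

lemma itinerary_entropy_le:
  assumes X: "simple_function M X" and Y: "simple_function M Y"
  shows "map_entropy M (itinerary T X n)
    \<le> map_entropy M (itinerary T Y n)
      + real n * cond_entropy M X Y"
proof -
  note sX = simple_function_itinerary[OF X] and sY = simple_function_itinerary[OF Y]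
  note fX = simple_function_funpow[OF X] and fY = simple_function_funpow[OF Y]
  let ?H = "map_entropy M"
  have "?H (\<lambda>\<omega>. (itinerary T X n \<omega>, itinerary T Y n \<omega>)) - ?H (itinerary T Y n)
    \<le> real n * (?H (\<lambda>\<omega>. (X \<omega>, Y \<omega>)) - ?H Y)"
  proof (induction n)
    case 0
    show ?case by (auto intro!: eq_refl map_entropy_cong simple_function_Pair sX sY simp: itinerary_0)
  next
    case (Suc n)
    let ?Z = "itinerary T Y (Suc n)"
    have 1: "?H (\<lambda>\<omega>. (itinerary T X (Suc n) \<omega>, ?Z \<omega>))
        = ?H (\<lambda>\<omega>. ((itinerary T X n \<omega>, X ((T ^^ n) \<omega>)), ?Z \<omega>))"
      by (intro map_entropy_cong simple_function_Pair sX sY fX) (auto simp: itinerary_Suc)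
    have 2: "?H (\<lambda>\<omega>. ((itinerary T X n \<omega>, X ((T ^^ n) \<omega>)), ?Z \<omega>)) - ?H ?Z
        \<le> (?H (\<lambda>\<omega>. (itinerary T X n \<omega>, ?Z \<omega>)) - ?H ?Z)
        + (?H (\<lambda>\<omega>. (X ((T ^^ n) \<omega>), ?Z \<omega>)) - ?H ?Z)"
      by (rule conditional_entropy_subadditive[OF sX fX sY])
    have 3: "?H (\<lambda>\<omega>. (itinerary T X n \<omega>, ?Z \<omega>)) - ?H ?Z
        \<le> ?H (\<lambda>\<omega>. (itinerary T X n \<omega>, itinerary T Y n \<omega>)) - ?H (itinerary T Y n)"
      by (rule conditional_entropy_antimono[OF sX sY sY]) (auto simp: itinerary_Suc)
    have 4: "?H (\<lambda>\<omega>. (X ((T ^^ n) \<omega>), ?Z \<omega>)) - ?H ?Z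
        \<le> ?H (\<lambda>\<omega>. (X ((T ^^ n) \<omega>), Y ((T ^^ n) \<omega>))) - ?H (\<lambda>\<omega>. Y ((T ^^ n) \<omega>))"
      by (rule conditional_entropy_antimono[OF fX sY fY]) (auto simp: itinerary_Suc)
    have 5: "?H (\<lambda>\<omega>. (X ((T ^^ n) \<omega>), Y ((T ^^ n) \<omega>))) - ?H (\<lambda>\<omega>. Y ((T ^^ n) \<omega>))
        = ?H (\<lambda>\<omega>. (X \<omega>, Y \<omega>)) - ?H Y"
      using map_entropy_funpow[OF simple_function_Pair[OF X Y], of n] map_entropy_funpow[OF Y, of n]
      by simp
    have "real (Suc n) * (?H (\<lambda>\<omega>. (X \<omega>, Y \<omega>)) - ?H Y)
        = real n * (?H (\<lambda>\<omega>. (X \<omega>, Y \<omega>)) - ?H Y) + (?H (\<lambda>\<omega>. (X \<omega>, Y \<omega>)) - ?H Y)"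
      by (simp add: algebra_simps)
    with 1 2 3 4 5 Suc show ?case by linarith
  qed
  moreover have "?H (itinerary T X n) \<le> ?H (\<lambda>\<omega>. (itinerary T X n \<omega>, itinerary T Y n \<omega>))"
    by (intro map_entropy_mono simple_function_Pair sX sY) auto
  ultimately show ?thesis by simp
qed

end

section \<open>Entropy of a partition as entropy of itineraries\<close>

definition cell :: "'a set set \<Rightarrow> 'a \<Rightarrow> 'a set" where
  "cell \<xi> \<omega> = (THE A. A \<in> \<xi> \<and> \<omega> \<in> A)"

lemma cell_eqI:
  assumes "partition_on S \<xi>" "A \<in> \<xi>" "\<omega> \<in> A" shows "cell \<xi> \<omega> = A"
  unfolding cell_def using assms
  by (intro the_equality) (auto simp: partition_on_def disjoint_def)

lemma cell_mem:
  assumes "partition_on S \<xi>" "\<omega> \<in> S" shows "cell \<xi> \<omega> \<in> \<xi>" "\<omega> \<in> cell \<xi> \<omega>"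
proof -
  obtain A where A: "A \<in> \<xi>" "\<omega> \<in> A" using assms by (auto simp: partition_on_def)
  then show "cell \<xi> \<omega> \<in> \<xi>" "\<omega> \<in> cell \<xi> \<omega>" using cell_eqI[OF assms(1) A] by simp_all
qed

lemma simple_function_cell:
  assumes "finite_measurable_partition M \<xi>" shows "simple_function M (cell \<xi>)"
proof -
  have p: "partition_on (space M) \<xi>" and fin: "finite \<xi>" and s: "\<xi> \<subseteq> sets M"
    using assms by (auto simp: finite_measurable_partition_def)
  have sub: "cell \<xi> ` space M \<subseteq> \<xi>" using cell_mem[OF p] by auto
  show ?thesis
    unfolding simple_function_def
  proof (intro conjI ballI)
    show "finite (cell \<xi> ` space M)" using sub fin by (rule finite_subset)
    fix A assume "A \<in> cell \<xi> ` space M"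
    then have A: "A \<in> \<xi>" using sub by auto
    have "cell \<xi> -` {A} \<inter> space M = A"
      using A p cell_eqI[OF p A] cell_mem[OF p] by (auto simp: partition_on_def)
    then show "cell \<xi> -` {A} \<inter> space M \<in> sets M" using A s by auto
  qed
qed

lemma partition_entropy_fibres:
  assumes "\<eta> = (\<lambda>\<omega>. {\<omega>'\<in>space M. X \<omega>' = X \<omega>}) ` space M"
  shows "partition_entropy M \<eta> = map_entropy M X"
proof -
  let ?h = "\<lambda>v. X -` {v} \<inter> space M"
  have "\<eta> = ?h ` X ` space M" unfolding assms image_image
    by (intro image_cong refl) auto
  moreover have "inj_on ?h (X ` space M)" by (auto simp: inj_on_def)
  ultimately show ?thesis by (simp add: partition_entropy_def map_entropy_def sum.reindex)
qed

text \<open>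
  The preimages \<open>T\<^sup>-\<^sup>k \<xi>\<close> may contain the empty set and may coincide for different \<open>k\<close>, so they are not
  literally partitions indexed by \<open>k\<close>; describing the cells of the refinement as classes of equal itineraries
  is insensitive to both.
\<close>

lemma common_refinement_pull_back:
  assumes p: "partition_on S \<xi>" and n: "n \<ge> 1" and T: "\<And>k \<omega>. \<omega> \<in> S \<Longrightarrow> (T ^^ k) \<omega> \<in> S"
  shows "common_refinement ((\<lambda>k. pull_back S T k \<xi>) ` {..<n}) =
    (\<lambda>\<omega>. {\<omega>'\<in>S. itinerary T (cell \<xi>) n \<omega>' = itinerary T (cell \<xi>) n \<omega>}) ` S"
    (is "common_refinement ?P = ?R ` S")
proof -
  have U: "\<Union> (pull_back S T k \<xi>) = S" for k
  proof
    show "S \<subseteq> \<Union> (pull_back S T k \<xi>)"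
      using cell_mem[OF p T] unfolding pull_back_def by blast
  qed (auto simp: pull_back_def)
  have cr: "A = ?R \<omega>" "\<omega> \<in> S" if A: "A \<in> common_refinement ?P" and \<omega>: "\<omega> \<in> A" for A \<omega>
  proof -
    obtain g where g: "\<And>P. P \<in> ?P \<Longrightarrow> g P \<in> P" and Ag: "A = \<Inter> (g ` ?P)"
      using A by (auto simp: common_refinement)
    have gk: "g (pull_back S T k \<xi>) = (T ^^ k) -` cell \<xi> ((T ^^ k) \<omega>) \<inter> S" if k: "k < n" for k
    proof -
      have "g (pull_back S T k \<xi>) \<in> pull_back S T k \<xi>" using g k by auto
      then obtain B where B: "B \<in> \<xi>" "g (pull_back S T k \<xi>) = (T ^^ k) -` B \<inter> S"
        by (auto simp: pull_back_def)
      have "\<omega> \<in> g (pull_back S T k \<xi>)" using \<omega> Ag k by auto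
      then have "cell \<xi> ((T ^^ k) \<omega>) = B" using B by (intro cell_eqI[OF p]) auto
      then show ?thesis using B by simp
    qed
    have "A = (\<Inter>k<n. (T ^^ k) -` cell \<xi> ((T ^^ k) \<omega>) \<inter> S)" using Ag gk by auto
    also have "\<dots> = ?R \<omega>"
    proof (intro equalityI subsetI)
      fix \<omega>' assume *: "\<omega>' \<in> (\<Inter>k<n. (T ^^ k) -` cell \<xi> ((T ^^ k) \<omega>) \<inter> S)"
      have S: "\<omega>' \<in> S" using INT_D[OF *, of 0] n by auto
      have "\<omega> \<in> S" using \<omega> Ag gk[of 0] n by auto
      then have "cell \<xi> ((T ^^ k) \<omega>') = cell \<xi> ((T ^^ k) \<omega>)" if "k < n" for k
        using INT_D[OF *, of k] that cell_mem[OF p T[of \<omega> k]] \<open>\<omega> \<in> S\<close> by (intro cell_eqI[OF p]) auto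
      then show "\<omega>' \<in> ?R \<omega>" using S by (auto simp: itinerary_eq_iff)
    next
      fix \<omega>' assume "\<omega>' \<in> ?R \<omega>"
      then show "\<omega>' \<in> (\<Inter>k<n. (T ^^ k) -` cell \<xi> ((T ^^ k) \<omega>) \<inter> S)"
        using cell_mem(2)[OF p T, of \<omega>'] by (auto simp: itinerary_eq_iff)
    qed
    finally show "A = ?R \<omega>" .
    show "\<omega> \<in> S" using \<omega> Ag gk[of 0] n by auto
  qed
  show ?thesis
  proof (intro equalityI subsetI)
    fix A assume A: "A \<in> common_refinement ?P"
    then have "A \<noteq> {}" by (auto simp: common_refinement)
    then obtain \<omega> where "\<omega> \<in> A" by auto
    then show "A \<in> ?R ` S" using cr[OF A] by auto
  next
    fix A assume "A \<in> ?R ` S"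
    then obtain \<omega> where \<omega>: "\<omega> \<in> S" "A = ?R \<omega>" by auto
    have "\<omega> \<in> \<Union> (common_refinement ?P)"
      using \<omega> U unfolding Union_common_refinement by auto
    then obtain B where "B \<in> common_refinement ?P" "\<omega> \<in> B" by auto
    then show "A \<in> common_refinement ?P" using cr \<omega> by auto
  qed
qed

context invariant_system begin

lemma entropy_of_partition_LIMSEQ:
  assumes \<xi>: "finite_measurable_partition M \<xi>"
  shows "(\<lambda>n. map_entropy M (itinerary T (cell \<xi>) n) / real n) \<longlonglongrightarrow> entropy_of_partition M T \<xi>"
proof -
  have p: "partition_on (space M) \<xi>" using \<xi> by (auto simp: finite_measurable_partition_def)
  have eq: "partition_entropy M (common_refinement ((\<lambda>k. pull_back (space M) T k \<xi>) ` {..<n})) / real n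
    = map_entropy M (itinerary T (cell \<xi>) n) / real n" for n
  proof (cases "n = 0")
    case False
    then have "common_refinement ((\<lambda>k. pull_back (space M) T k \<xi>) ` {..<n}) =
        (\<lambda>\<omega>. {\<omega>'\<in>space M. itinerary T (cell \<xi>) n \<omega>' = itinerary T (cell \<xi>) n \<omega>}) ` space M"
      by (intro common_refinement_pull_back[OF p]) (auto simp: funpow_space)
    then show ?thesis by (simp add: partition_entropy_fibres)
  qed simp
  show ?thesis
    unfolding entropy_of_partition_def eq
    using itinerary_entropy_convergent[OF simple_function_cell[OF \<xi>]]
    by (simp add: convergent_LIMSEQ_iff)
qed

end

section \<open>Expansion and distortion of the intermittent map\<close>

definition right_half :: "real \<Rightarrow> bool" where "right_half x \<longleftrightarrow> 1/2 \<le> x"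

locale intermittent_map =
  fixes \<gamma> :: real
  assumes \<gamma>: "0 < \<gamma>" "\<gamma> < 1"
begin

abbreviation f :: "real \<Rightarrow> real" where "f \<equiv> intermittent \<gamma>"

abbreviation code :: "nat \<Rightarrow> real \<Rightarrow> bool list" where "code \<equiv> itinerary f right_half"

lemma powr_prod: "x \<ge> 0 \<Longrightarrow> 2 powr \<gamma> * x powr \<gamma> = (2 * x) powr \<gamma>"
  by (simp add: powr_mult)

lemma f_left: "0 \<le> x \<Longrightarrow> x < 1/2 \<Longrightarrow> f x = x * (1 + (2 * x) powr \<gamma>)"
  by (simp add: intermittent_def powr_prod)

lemma f_right: "1/2 \<le> x \<Longrightarrow> f x = 2 * x - 1"
  by (simp add: intermittent_def)

lemma powr_le_1: "0 \<le> x \<Longrightarrow> x \<le> 1 \<Longrightarrow> x powr \<gamma> \<le> 1"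
  using \<gamma> powr_mono2[of \<gamma> x 1] by simp

lemma f_left_ge: "0 \<le> x \<Longrightarrow> x < 1/2 \<Longrightarrow> x \<le> f x"
  by (simp add: f_left distrib_left)

lemma f_left_le: assumes "0 \<le> x" "x < 1/2" shows "f x \<le> 2 * x"
proof -
  have "x * (1 + (2 * x) powr \<gamma>) \<le> x * (1 + 1)"
    using assms powr_le_1[of "2 * x"] by (intro mult_left_mono add_left_mono) auto
  then show ?thesis using assms by (simp add: f_left)
qed

lemma f_mem: "x \<in> {0..1} \<Longrightarrow> f x \<in> {0..1}"
  using f_left_ge[of x] f_left_le[of x] f_right[of x] by (cases "x < 1/2") auto

lemma funpow_mem: "x \<in> {0..1} \<Longrightarrow> (f ^^ n) x \<in> {0..1}"
  by (induction n) (use f_mem in auto)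

lemma f_0 [simp]: "f 0 = 0" and f_half [simp]: "f (1/2) = 0" and f_1 [simp]: "f 1 = 1"
  by (simp_all add: intermittent_def)

lemma funpow_0 [simp]: "(f ^^ n) 0 = 0" and funpow_1 [simp]: "(f ^^ n) 1 = 1"
  by (induction n) auto

lemma f_measurable_borel [measurable]: "f \<in> borel_measurable borel"
  unfolding intermittent_def[abs_def] by measurable

lemma f_measurable [measurable]: "f \<in> measurable unit_borel unit_borel"
  by (rule measurable_restrict_space3) (use f_mem in auto)

lemma funpow_measurable_borel [measurable]: "f ^^ n \<in> borel_measurable borel"
  by (induction n) auto

definition growth :: "real \<Rightarrow> real" where "growth L = L * (2 * L) powr \<gamma>"

text \<open>
  For \<open>x \<le> y\<close> in the left branch, \<open>y (2 y)\<^sup>\<gamma> - x (2 x)\<^sup>\<gamma> \<ge> (y - x) (2 y)\<^sup>\<gamma> \<ge> (y - x) (2 (y - x))\<^sup>\<gamma>\<close>. The gain depends only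
  on the length of the interval and not on its distance from the neutral fixed point, which is why the
  expansion can be iterated.
\<close>

lemma f_expand:
  assumes "0 \<le> x" "x \<le> y" "y \<le> 1" "right_half x = right_half y"
  shows "f y - f x \<ge> (y - x) + growth (y - x)"
proof (cases "right_half y")
  case True
  have "(y - x) * (2 * (y - x)) powr \<gamma> \<le> (y - x) * 1"
    using assms True by (intro mult_left_mono powr_le_1) (auto simp: right_half_def)
  then show ?thesis using assms True by (simp add: f_right growth_def right_half_def)
next
  case False
  have 1: "x * (2 * x) powr \<gamma> \<le> x * (2 * y) powr \<gamma>"
    using assms \<gamma> by (intro mult_left_mono powr_mono2) auto
  have 2: "(y - x) * (2 * (y - x)) powr \<gamma> \<le> (y - x) * (2 * y) powr \<gamma>"
    using assms \<gamma> by (intro mult_left_mono powr_mono2) auto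
  have "f y - f x = (y - x) + (y * (2 * y) powr \<gamma> - x * (2 * x) powr \<gamma>)"
    using assms False by (simp add: f_left right_half_def algebra_simps)
  also have "\<dots> \<ge> (y - x) + (y * (2 * y) powr \<gamma> - x * (2 * y) powr \<gamma>)"
    using 1 by simp
  also have "y * (2 * y) powr \<gamma> - x * (2 * y) powr \<gamma> = (y - x) * (2 * y) powr \<gamma>"
    by (simp add: algebra_simps)
  finally show ?thesis using 2 by (simp add: growth_def)
qed

lemma growth_mono: "0 \<le> a \<Longrightarrow> a \<le> b \<Longrightarrow> growth a \<le> growth b"
  unfolding growth_def using \<gamma> by (intro mult_mono powr_mono2) auto

lemma growth_nonneg: "0 \<le> a \<Longrightarrow> growth a \<ge> 0"
  by (simp add: growth_def)

lemma growth_pos: "0 < a \<Longrightarrow> growth a > 0"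
  by (simp add: growth_def)

lemma f_strict_mono:
  assumes "0 \<le> x" "x < y" "y \<le> 1" "right_half x = right_half y" shows "f x < f y"
  using f_expand[of x y] growth_nonneg[of "y - x"] assms by simp

lemma f_inj: "x \<in> {0..1} \<Longrightarrow> y \<in> {0..1} \<Longrightarrow> right_half x = right_half y \<Longrightarrow> f x = f y \<Longrightarrow> x = y"
  using f_strict_mono[of x y] f_strict_mono[of y x] by (cases x y rule: linorder_cases) auto

lemma code_Suc: "code (Suc n) x = right_half x # code n (f x)"
  by (rule itinerary_Suc_left)

lemma code_expand:
  assumes "0 \<le> x" "x \<le> y" "y \<le> 1" "code n x = code n y"
  shows "real n * growth (y - x) + (y - x) \<le> 1"
proof -
  have "real n * growth (y - x) + (y - x) \<le> (f ^^ n) y - (f ^^ n) x \<and> (f ^^ n) x \<le> (f ^^ n) y"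
    using assms(4)
  proof (induction n)
    case (Suc n)
    from Suc.prems have c: "code n x = code n y" and r: "right_half ((f ^^ n) x) = right_half ((f ^^ n) y)"
      by (auto simp: itinerary_Suc)
    note IH = Suc.IH[OF c]
    have m: "(f ^^ n) x \<in> {0..1}" "(f ^^ n) y \<in> {0..1}" by (rule funpow_mem, use assms in simp)+
    have e: "(f ^^ Suc n) y - (f ^^ Suc n) x \<ge> ((f ^^ n) y - (f ^^ n) x) + growth ((f ^^ n) y - (f ^^ n) x)"
      using f_expand[of "(f ^^ n) x" "(f ^^ n) y"] m r IH by simp
    have "growth (y - x) \<le> growth ((f ^^ n) y - (f ^^ n) x)"
    proof (rule growth_mono)
      have "0 \<le> real n * growth (y - x)" using assms by (intro mult_nonneg_nonneg growth_nonneg) auto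
      then show "y - x \<le> (f ^^ n) y - (f ^^ n) x" using IH by linarith
    qed (use assms in simp)
    then show ?case using e IH growth_nonneg[of "(f ^^ n) y - (f ^^ n) x"] by (simp add: algebra_simps)
  qed (use assms in auto)
  moreover have "(f ^^ n) x \<in> {0..1}" "(f ^^ n) y \<in> {0..1}" by (rule funpow_mem, use assms in simp)+
  ultimately show ?thesis by auto
qed

text \<open>
  Along a common code of length \<open>n\<close> the distance increases by at least \<open>growth (y - x)\<close> in each step and stays
  at most \<open>1\<close>; so \<open>n growth (y - x) \<le> 1\<close>.
\<close>

lemma code_diameter:
  assumes "\<delta> > 0"
  obtains N where "\<And>n x y. n \<ge> N \<Longrightarrow> x \<in> {0..1} \<Longrightarrow> y \<in> {0..1} \<Longrightarrow> code n x = code n y \<Longrightarrow> \<bar>x - y\<bar> < \<delta>"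
proof -
  obtain N :: nat where N: "real N * growth \<delta> > 1"
    using reals_Archimedean3[OF growth_pos[OF assms]] by (metis less_le_trans zero_less_one)
  have ord: "y - x < \<delta>" if "n \<ge> N" "0 \<le> x" "x \<le> y" "y \<le> 1" "code n x = code n y" for n x y
  proof (rule ccontr)
    assume "\<not> y - x < \<delta>"
    then have "growth \<delta> \<le> growth (y - x)" using assms by (intro growth_mono) auto
    then have "real N * growth \<delta> \<le> real n * growth (y - x)"
      using that growth_pos[OF assms] by (intro mult_mono) auto
    then show False using code_expand[of x y n] that N by linarith
  qed
  show ?thesis
  proof (rule that)
    fix n x y assume *: "n \<ge> N" "x \<in> {0..1}" "y \<in> {0..1}" "code n x = code n y"
    show "\<bar>x - y\<bar> < \<delta>"
    proof (cases "x \<le> y")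
      case True
      then show ?thesis using ord[OF *(1) _ True _ *(4)] *(2,3) by simp
    next
      case False
      then show ?thesis using ord[OF *(1) _ _ _ *(4)[symmetric]] *(2,3) by simp
    qed
  qed
qed

lemma reaches_right:
  assumes "0 < x" "x \<le> 1"
  shows "\<exists>n. right_half ((f ^^ n) x)"
proof (rule ccontr)
  assume "\<nexists>n. right_half ((f ^^ n) x)"
  then have "code n 0 = code n x" for n by (simp add: itinerary_eq_iff right_half_def[of 0])
  moreover obtain N where "\<And>n u v. n \<ge> N \<Longrightarrow> u \<in> {0..1} \<Longrightarrow> v \<in> {0..1} \<Longrightarrow> code n u = code n v \<Longrightarrow> \<bar>u - v\<bar> < x"
    using code_diameter[OF assms(1)] by blast
  from this[of N 0 x] have "code N 0 = code N x \<Longrightarrow> \<bar>0 - x\<bar> < x" using assms by simp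
  ultimately show False by simp
qed

text \<open>
  The function \<open>- \<phi>\<close>, that is \<open>log f'\<close> with one-sided derivatives at the ends of the branches.
\<close>

definition log_deriv :: "real \<Rightarrow> real" where
  "log_deriv x = (if x < 1/2 then ln (1 + (1 + \<gamma>) * (2 * x) powr \<gamma>) else ln 2)"

abbreviation birkhoff :: "nat \<Rightarrow> real \<Rightarrow> real" where
  "birkhoff n x \<equiv> \<Sum>k<n. log_deriv ((f ^^ k) x)"

lemma D_intermittent_right: assumes "1/2 \<le> x" "x \<le> 1" shows "D_intermittent \<gamma> x = 2"
proof -
  have "((\<lambda>x. 2 * x - 1) has_vector_derivative 2) (at x within {1/2..1})"
    by (auto intro!: derivative_eq_intros)
  then have "(f has_vector_derivative 2) (at x within {1/2..1})"
    by (rule has_vector_derivative_transform[rotated 2]) (use assms f_right in auto)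
  then have "vector_derivative f (at x within {1/2..1}) = 2"
    using assms vector_derivative_within_cbox[of "1/2" 1 x f 2] by (simp add: box_real)
  then show ?thesis using assms by (simp add: D_intermittent_def)
qed

text \<open>
  At \<open>0\<close> the power \<open>(2 x)\<^sup>\<gamma>\<close> is not differentiable, so the derivative there is computed from the difference
  quotient \<open>1 + (2 y)\<^sup>\<gamma>\<close>.
\<close>

lemma has_real_derivative_left_branch:
  assumes "0 \<le> x" "x < 1/2"
  shows "((\<lambda>x. x * (1 + (2 * x) powr \<gamma>)) has_real_derivative 1 + (1 + \<gamma>) * (2 * x) powr \<gamma>) (at x within {0..<1/2})"
proof (cases "x = 0")
  case False
  then have "x > 0" using assms by simp
  then have p: "x * (\<gamma> * (2 * x) powr (\<gamma> - 1) * 2) = \<gamma> * (2 * x) powr \<gamma>"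
    by (simp add: powr_diff)
  have "((\<lambda>x. x * (1 + (2 * x) powr \<gamma>)) has_real_derivative
      (1 + (2 * x) powr \<gamma>) + x * (\<gamma> * (2 * x) powr (\<gamma> - 1) * 2)) (at x)"
    using \<open>x > 0\<close> by (auto intro!: derivative_eq_intros simp: algebra_simps)
  then have "((\<lambda>x. x * (1 + (2 * x) powr \<gamma>)) has_real_derivative
      (1 + (2 * x) powr \<gamma>) + x * (\<gamma> * (2 * x) powr (\<gamma> - 1) * 2)) (at x within {0..<1/2})"
    by (rule has_field_derivative_at_within)
  then show ?thesis unfolding p by (simp add: algebra_simps)
next
  case True
  have *: "((\<lambda>y. 1 + (2 * y) powr \<gamma>) \<longlongrightarrow> 1 + 0) (at 0 within {0..<1/2})"
  proof (intro tendsto_add tendsto_const)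
    have "continuous_on {0..} (\<lambda>y::real. (2 * y) powr \<gamma>)"
      using \<gamma> by (intro continuous_on_powr' continuous_intros) auto
    then have "((\<lambda>y. (2 * y) powr \<gamma>) \<longlongrightarrow> (2 * 0) powr \<gamma>) (at 0 within {0..})"
      unfolding continuous_on_def by (rule bspec) simp
    then show "((\<lambda>y. (2 * y) powr \<gamma>) \<longlongrightarrow> 0) (at 0 within {0..<1/2})"
      by (auto intro: tendsto_within_subset)
  qed
  have "((\<lambda>y. (y * (1 + (2 * y) powr \<gamma>) - 0) / (y - 0)) \<longlongrightarrow> 1 + 0) (at 0 within {0..<1/2})"
    by (rule Lim_transform_within[OF *, where d=1]) (auto simp: field_simps)
  then show ?thesis
    unfolding True has_field_derivative_iff by simp
qed

lemma D_intermittent_left: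
  assumes "0 \<le> x" "x < 1/2" shows "D_intermittent \<gamma> x = 1 + (1 + \<gamma>) * (2 * x) powr \<gamma>"
proof -
  have ne: "at x within {0..<1/2::real} \<noteq> bot"
  proof -
    have "x islimpt {0..<1/2}"
    proof -
      have "x islimpt {x<..<1/2}" using assms by (simp add: islimpt_greaterThanLessThan1)
      then show ?thesis by (rule islimpt_subset) (use assms in auto)
    qed
    then show ?thesis by (simp add: trivial_limit_within)
  qed
  have "((\<lambda>x. x * (1 + (2 * x) powr \<gamma>)) has_vector_derivative 1 + (1 + \<gamma>) * (2 * x) powr \<gamma>) (at x within {0..<1/2})"
    using has_real_derivative_left_branch[OF assms] by (simp add: has_real_derivative_iff_has_vector_derivative)
  then have "(f has_vector_derivative 1 + (1 + \<gamma>) * (2 * x) powr \<gamma>) (at x within {0..<1/2})"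
    by (rule has_vector_derivative_transform[rotated 2]) (use assms f_left in auto)
  then have "vector_derivative f (at x within {0..<1/2}) = 1 + (1 + \<gamma>) * (2 * x) powr \<gamma>"
    by (rule vector_derivative_within[OF ne])
  then show ?thesis using assms by (simp add: D_intermittent_def)
qed

lemma geom_potential_eq: "x \<in> {0..1} \<Longrightarrow> geom_potential \<gamma> x = ereal (- log_deriv x)"
  using D_intermittent_left[of x] D_intermittent_right[of x] \<gamma>
  by (cases "x < 1/2") (auto simp: geom_potential_def log_deriv_def)

lemma log_deriv_nonneg: "x \<in> {0..1} \<Longrightarrow> log_deriv x \<ge> 0"
  using \<gamma> by (auto simp: log_deriv_def)

lemma log_deriv_le: "x \<in> {0..1} \<Longrightarrow> log_deriv x \<le> ln 3"
proof (cases "x < 1/2")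
  case True
  assume x: "x \<in> {0..1}"
  have "(1 + \<gamma>) * (2 * x) powr \<gamma> \<le> 2 * 1"
    using x True \<gamma> by (intro mult_mono powr_le_1) auto
  then have "1 + (1 + \<gamma>) * (2 * x) powr \<gamma> \<le> 3" by simp
  moreover have "0 < 1 + (1 + \<gamma>) * (2 * x) powr \<gamma>"
    using \<gamma> x by (intro add_pos_nonneg mult_nonneg_nonneg) auto
  ultimately show ?thesis using True by (simp add: log_deriv_def)
qed (simp add: log_deriv_def)

lemma log_deriv_0 [simp]: "log_deriv 0 = 0"
  by (simp add: log_deriv_def)

lemma log_deriv_measurable [measurable]: "log_deriv \<in> borel_measurable borel"
  unfolding log_deriv_def[abs_def] by measurable

lemma log_deriv_uniformly_continuous:
  assumes "\<epsilon> > 0"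
  obtains \<delta> where "\<delta> > 0"
    "\<And>x y. x \<in> {0..1} \<Longrightarrow> y \<in> {0..1} \<Longrightarrow> right_half x = right_half y \<Longrightarrow> \<bar>x - y\<bar> < \<delta>
      \<Longrightarrow> \<bar>log_deriv x - log_deriv y\<bar> < \<epsilon>"
proof -
  let ?g = "\<lambda>x::real. ln (1 + (1 + \<gamma>) * (2 * x) powr \<gamma>)"
  have pos: "1 + (1 + \<gamma>) * (2 * x) powr \<gamma> > 0" if "x \<in> {0..1}" for x
    using that \<gamma> by (intro add_pos_nonneg mult_nonneg_nonneg) auto
  have "continuous_on {0..1} ?g"
    using \<gamma> pos by (intro continuous_intros continuous_on_powr') (auto simp: less_imp_neq[symmetric])
  then have "uniformly_continuous_on {0..1} ?g"
    by (intro compact_uniformly_continuous) auto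
  then obtain \<delta> where \<delta>: "\<delta> > 0"
    "\<And>x y. x \<in> {0..1} \<Longrightarrow> y \<in> {0..1} \<Longrightarrow> dist x y < \<delta> \<Longrightarrow> dist (?g x) (?g y) < \<epsilon>"
    unfolding uniformly_continuous_on_def using assms by metis
  show ?thesis
  proof (rule that[OF \<delta>(1)])
    fix x y :: real assume *: "x \<in> {0..1}" "y \<in> {0..1}" "right_half x = right_half y" "\<bar>x - y\<bar> < \<delta>"
    show "\<bar>log_deriv x - log_deriv y\<bar> < \<epsilon>"
      using \<delta>(2)[of x y] * assms by (cases "right_half x") (auto simp: log_deriv_def dist_real_def right_half_def)
  qed
qed

text \<open>
  The bound \<open>e j\<close> for the oscillation of \<open>log f'\<close> on a cylinder of length \<open>j\<close> is \<open>\<epsilon>\<close>, except for finitely many short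
  lengths, where the trivial bound \<open>ln 3\<close> is added. In a Birkhoff sum of length \<open>n\<close> each length \<open>1, ..., n\<close>
  occurs once, so the short cylinders contribute only a constant.
\<close>

lemma distortion:
  assumes "\<epsilon> > 0"
  obtains e :: "nat \<Rightarrow> real" and K where "K \<ge> 0"
    "\<And>j x y. j \<ge> 1 \<Longrightarrow> x \<in> {0..1} \<Longrightarrow> y \<in> {0..1} \<Longrightarrow> code j x = code j y \<Longrightarrow> log_deriv y \<le> log_deriv x + e j"
    "\<And>n. (\<Sum>k<n. e (n - k)) \<le> real n * \<epsilon> + K"
proof -
  obtain \<delta> where \<delta>: "\<delta> > 0"
    "\<And>x y. x \<in> {0..1} \<Longrightarrow> y \<in> {0..1} \<Longrightarrow> right_half x = right_half y \<Longrightarrow> \<bar>x - y\<bar> < \<delta>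
      \<Longrightarrow> \<bar>log_deriv x - log_deriv y\<bar> < \<epsilon>"
    using log_deriv_uniformly_continuous[OF assms] by blast
  obtain N where N: "\<And>n x y. n \<ge> N \<Longrightarrow> x \<in> {0..1} \<Longrightarrow> y \<in> {0..1} \<Longrightarrow> code n x = code n y \<Longrightarrow> \<bar>x - y\<bar> < \<delta>"
    using code_diameter[OF \<delta>(1)] by blast
  define e where "e j = \<epsilon> + (if j < N then ln 3 else 0)" for j
  show ?thesis
  proof (rule that[of "real N * ln 3" e])
    fix j :: nat and x y assume *: "j \<ge> 1" "x \<in> {0..1}" "y \<in> {0..1}" "code j x = code j y"
    show "log_deriv y \<le> log_deriv x + e j"
    proof (cases "j < N")
      case True
      then show ?thesis
        using log_deriv_nonneg[OF *(2)] log_deriv_le[OF *(3)] assms by (simp add: e_def)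
    next
      case False
      obtain i where j: "j = Suc i" using *(1) by (cases j) auto
      have "right_half x = right_half y" using *(4) unfolding j code_Suc by simp
      then have "\<bar>log_deriv x - log_deriv y\<bar> < \<epsilon>"
        using N[OF _ *(2,3,4)] False *(2,3) by (intro \<delta>(2)) auto
      then show ?thesis using False by (simp add: e_def)
    qed
  next
    fix n
    have "(\<Sum>k<n. e (n - k)) = real n * \<epsilon> + (\<Sum>k<n. if n - k < N then ln 3 else 0)"
      by (simp add: e_def sum.distrib)
    also have "(\<Sum>k<n. if n - k < N then ln 3 else 0) = (\<Sum>k\<in>{k\<in>{..<n}. n - k < N}. ln (3::real))"
      by (rule sum.inter_filter[symmetric]) simp
    also have "\<dots> = real (card {k\<in>{..<n}. n - k < N}) * ln 3" by simp
    also have "\<dots> \<le> real N * ln 3"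
    proof -
      have "card {k\<in>{..<n}. n - k < N} \<le> card {n - N..<n}"
        by (intro card_mono) auto
      then show ?thesis by (intro mult_right_mono) auto
    qed
    finally show "(\<Sum>k<n. e (n - k)) \<le> real n * \<epsilon> + real N * ln 3" by simp
  qed simp
qed

end

section \<open>Cylinders and the mass that a conformal measure gives them\<close>

context intermittent_map begin

text \<open>
  The open cylinder of a word. Open cylinders omit the preimages of \<open>0\<close> and \<open>1\<close>, and with them all
  ambiguity about endpoints of holes; every \<open>f\<^sup>n\<close> maps the cylinder of a word of length \<open>n\<close> exactly onto \<open>(0,1)\<close>.
\<close>

primrec cyl :: "bool list \<Rightarrow> real set" where
  "cyl [] = {0<..<1}"
| "cyl (b # w) = {x \<in> (if b then {1/2<..<1} else {0<..<1/2}). f x \<in> cyl w}"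

lemma cyl_subset: "cyl w \<subseteq> {0<..<1}"
  by (cases w) auto

lemma cyl_code: "x \<in> cyl w \<Longrightarrow> code (length w) x = w"
proof (induction w arbitrary: x)
  case (Cons b w)
  then have "right_half x = b" by (auto simp: right_half_def split: if_splits)
  with Cons show ?case by (simp add: code_Suc)
qed simp

lemma cyl_drop: "x \<in> cyl w \<Longrightarrow> i \<le> length w \<Longrightarrow> (f ^^ i) x \<in> cyl (drop i w)"
proof (induction i arbitrary: x w)
  case (Suc i)
  then obtain b v where w: "w = b # v" by (cases w) auto
  with Suc.prems have "(f ^^ i) (f x) \<in> cyl (drop i v)" by (intro Suc.IH) auto
  then show ?case by (simp add: w funpow_swap1)
qed simp

lemma cyl_take: "x \<in> cyl w \<Longrightarrow> x \<in> cyl (take i w)"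
proof (induction w arbitrary: x i)
  case (Cons b w)
  then have "x \<in> {0<..<1}" using cyl_subset[of "b # w"] by blast
  then show ?case using Cons by (cases i) auto
qed simp

lemma f_mono:
  assumes "0 \<le> x" "x \<le> y" "y \<le> 1" "right_half x = right_half y" shows "f x \<le> f y"
  using f_expand[OF assms] growth_nonneg[of "y - x"] assms(2) by simp

lemma cyl_interval: "x \<in> cyl w \<Longrightarrow> y \<in> cyl w \<Longrightarrow> x \<le> z \<Longrightarrow> z \<le> y \<Longrightarrow> z \<in> cyl w"
proof (induction w arbitrary: x y z)
  case (Cons b w)
  have xy: "x \<in> (if b then {1/2<..<1} else {0<..<1/2})" "y \<in> (if b then {1/2<..<1} else {0<..<1/2})"
    using Cons.prems(1,2) by simp_all
  have r: "right_half x = right_half z" "right_half z = right_half y"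
    "0 \<le> x" "y \<le> 1" "z \<in> (if b then {1/2<..<1} else {0<..<1/2})"
    using xy Cons.prems(3,4) by (cases b; simp add: right_half_def)+
  have "f x \<le> f z" by (rule f_mono) (use r(1,3,4) Cons.prems(3,4) in linarith)+
  moreover have "f z \<le> f y" by (rule f_mono) (use r(2,3,4) Cons.prems(3,4) in linarith)+
  moreover have "f x \<in> cyl w" "f y \<in> cyl w" using Cons.prems(1,2) by simp_all
  ultimately have "f z \<in> cyl w" by (intro Cons.IH[of "f x" "f y" "f z"])
  then show ?case using r by simp
qed auto

lemma drop_code: "k \<le> n \<Longrightarrow> drop k (code n x) = code (n - k) ((f ^^ k) x)"
  using itinerary_add[of f right_half k "n - k" x] by simp

lemma birkhoff_distortion:
  assumes "\<epsilon> > 0"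
  obtains K where "K \<ge> 0"
    "\<And>n x y. x \<in> {0..1} \<Longrightarrow> y \<in> {0..1} \<Longrightarrow> code n x = code n y \<Longrightarrow>
      birkhoff n y \<le> birkhoff n x + real n * \<epsilon> + K"
proof -
  obtain K e where e: "K \<ge> 0"
    "\<And>j x y. j \<ge> 1 \<Longrightarrow> x \<in> {0..1} \<Longrightarrow> y \<in> {0..1} \<Longrightarrow> code j x = code j y \<Longrightarrow> log_deriv y \<le> log_deriv x + e j"
    "\<And>n. (\<Sum>k<n. e (n - k)) \<le> real n * \<epsilon> + K"
    by (rule distortion[OF assms], rule that)
  show ?thesis
  proof (rule that[OF e(1)])
    fix n x y assume *: "x \<in> {0..1}" "y \<in> {0..1}" "code n x = code n y"
    have "birkhoff n y \<le> (\<Sum>k<n. log_deriv ((f ^^ k) x) + e (n - k))"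
    proof (rule sum_mono)
      fix k assume "k \<in> {..<n}"
      then have k: "k < n" by simp
      have "code (n - k) ((f ^^ k) x) = code (n - k) ((f ^^ k) y)"
        using arg_cong[OF *(3), of "drop k"] drop_code[of k n] k by simp
      then show "log_deriv ((f ^^ k) y) \<le> log_deriv ((f ^^ k) x) + e (n - k)"
        using k * by (intro e(2) funpow_mem) auto
    qed
    also have "\<dots> \<le> birkhoff n x + (real n * \<epsilon> + K)"
      using e(3) by (simp add: sum.distrib)
    finally show "birkhoff n y \<le> birkhoff n x + real n * \<epsilon> + K"
      by simp
  qed
qed

lemma continuous_on_left: "continuous_on {0..1/2} (\<lambda>x. x * (1 + (2 * x) powr \<gamma>))"
  using \<gamma> by (intro continuous_intros continuous_on_powr') auto

lemma continuous_on_f_left: "continuous_on {0<..<1/2} f"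
proof -
  have "continuous_on {0<..<1/2} (\<lambda>x. x * (1 + (2 * x) powr \<gamma>))"
    by (rule continuous_on_subset[OF continuous_on_left]) auto
  then show ?thesis by (rule continuous_on_eq) (simp add: f_left)
qed

lemma continuous_on_f_right: "continuous_on {1/2<..<1} f"
proof -
  have "continuous_on {1/2<..<1::real} (\<lambda>x. 2 * x - 1)" by (intro continuous_intros)
  then show ?thesis by (rule continuous_on_eq) (simp add: f_right)
qed

lemma open_cyl: "open (cyl w)"
proof (induction w)
  case (Cons b w)
  have "open ((if b then {1/2<..<1} else {0<..<1/2}) \<inter> f -` cyl w)"
    using Cons continuous_on_f_left continuous_on_f_right
    by (intro continuous_open_preimage) auto
  moreover have "(if b then {1/2<..<1} else {0<..<1/2}) \<inter> f -` cyl w = cyl (b # w)" by auto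
  ultimately show ?case by simp
qed simp

lemma cyl_sets: "cyl w \<in> sets unit_borel"
  using open_cyl[of w] cyl_subset[of w] by (auto simp: sets_restrict_space_iff)

lemma left_branch_onto:
  assumes "0 < y" "y < 1" shows "\<exists>x\<in>{0<..<1/2}. f x = y"
proof -
  have "\<exists>x\<ge>0. x \<le> 1/2 \<and> x * (1 + (2 * x) powr \<gamma>) = y"
    using assms continuous_on_left by (intro IVT') auto
  then obtain x where x: "0 \<le> x" "x \<le> 1/2" "x * (1 + (2 * x) powr \<gamma>) = y" by auto
  have "x \<noteq> 0" using x(3) assms by auto
  moreover have "x \<noteq> 1/2"
  proof
    assume "x = 1/2"
    with x(3) have "y = 1" by simp
    with assms show False by simp
  qed
  ultimately have "x < 1/2" "0 < x" using x by auto
  then show ?thesis using x by (intro bexI[of _ x]) (auto simp: f_left)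
qed

lemma cyl_image: "f ` cyl (b # w) = cyl w"
proof (intro equalityI subsetI)
  fix y assume y: "y \<in> cyl w"
  then have "0 < y" "y < 1" using cyl_subset[of w] by auto
  show "y \<in> f ` cyl (b # w)"
  proof (cases b)
    case True
    have "f ((y + 1) / 2) = 2 * ((y + 1) / 2) - 1" by (rule f_right) (use \<open>0 < y\<close> in simp)
    then have "f ((y + 1) / 2) = y" by (simp add: field_simps)
    then show ?thesis using True y \<open>0 < y\<close> \<open>y < 1\<close> by (intro image_eqI[of _ _ "(y + 1) / 2"]) auto
  next
    case False
    then show ?thesis using left_branch_onto[OF \<open>0 < y\<close> \<open>y < 1\<close>] y by auto
  qed
qed auto

text \<open>
  A point lies in the open cylinder of its code unless its orbit meets an endpoint of \<open>[0,1]\<close>; this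
  covers the break point \<open>1/2\<close>, whose image is \<open>0\<close>.
\<close>

lemma code_in_cyl:
  assumes "x \<in> {0..1}" "\<And>k. k \<le> n \<Longrightarrow> (f ^^ k) x \<notin> {0, 1}"
  shows "x \<in> cyl (code n x)"
  using assms
proof (induction n arbitrary: x)
  case 0
  from 0(1) 0(2)[of 0] show ?case by (auto simp: le_less)
next
  case (Suc n)
  have "f x \<in> cyl (code n (f x))"
  proof (rule Suc.IH)
    show "f x \<in> {0..1}" using Suc.prems(1) by (rule f_mem)
    show "(f ^^ k) (f x) \<notin> {0, 1}" if "k \<le> n" for k
      using Suc.prems(2)[of "Suc k"] that by (simp add: funpow_swap1)
  qed
  moreover have "x \<noteq> 0" "x \<noteq> 1" "f x \<noteq> 0"
    using Suc.prems(2)[of 0] Suc.prems(2)[of 1] by auto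
  moreover from this have "x \<noteq> 1/2" using f_half by metis
  ultimately show ?case using Suc.prems(1) unfolding code_Suc by (auto simp: right_half_def)
qed

lemma cyl_zero: "{0<..<(1/2) ^ n} \<subseteq> cyl (replicate n False)"
proof (induction n)
  case (Suc n)
  show ?case
  proof
    fix x :: real assume x: "x \<in> {0<..<(1/2) ^ Suc n}"
    have "(1/2::real) ^ n \<le> 1" by (rule power_le_one) auto
    then have x': "0 < x" "x < 1/2" using x by auto
    have "f x \<in> {0<..<(1/2) ^ n}" using f_left_ge[of x] f_left_le[of x] x x' by auto
    then have "f x \<in> cyl (replicate n False)" using Suc by blast
    with x' show "x \<in> cyl (replicate (Suc n) False)" by simp
  qed
qed simp

end

text \<open>
  A conformal measure for a pressure that is known to be finite.
\<close>

locale intermittent_conformal = intermittent_map +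
  fixes t p :: real and m :: "real measure"
  assumes t: "t \<in> {0..1}" and m: "geom_conformal_prob \<gamma> t m"
    and p: "closed_pressure \<gamma> t = ereal p"
begin

sublocale prob_space m
  using m by (simp add: geom_conformal_prob_def)

lemma sets_m: "sets m = sets unit_borel"
  using m by (simp add: geom_conformal_prob_def)

lemma space_m: "space m = {0..1}"
  using sets_eq_imp_space_eq[OF sets_m] by (simp add: space_restrict_space)

lemma exp_potential:
  assumes "x \<in> {0..1}"
  shows "exp_ereal (scale_potential t (geom_potential \<gamma>) x - closed_pressure \<gamma> t)
    = ennreal (exp (- t * log_deriv x - p))"
  using assms by (simp add: exp_ereal_def scale_potential_def geom_potential_eq p)

lemma conformal_eq:
  assumes "A \<in> sets m" "inj_on f A"
  shows "emeasure m A = (\<integral>\<^sup>+y. ennreal (exp (- t * log_deriv (inv_into A f y) - p)) * indicator (f ` A) y \<partial>m)"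
proof -
  have "A \<subseteq> {0..1}" using sets.sets_into_space[OF assms(1)] by (simp add: space_m)
  have "emeasure m A = (\<integral>\<^sup>+y. exp_ereal (scale_potential t (geom_potential \<gamma>) (inv_into A f y)
      - closed_pressure \<gamma> t) * indicator (f ` A) y \<partial>m)"
    using m assms by (simp add: geom_conformal_prob_def conformal_def)
  also have "\<dots> = (\<integral>\<^sup>+y. ennreal (exp (- t * log_deriv (inv_into A f y) - p)) * indicator (f ` A) y \<partial>m)"
  proof (rule nn_integral_cong)
    fix y
    show "exp_ereal (scale_potential t (geom_potential \<gamma>) (inv_into A f y)
      - closed_pressure \<gamma> t) * indicator (f ` A) y
      = ennreal (exp (- t * log_deriv (inv_into A f y) - p)) * indicator (f ` A) y"
    proof (cases "y \<in> f ` A")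
      case True
      then have "inv_into A f y \<in> {0..1}" using \<open>A \<subseteq> {0..1}\<close> inv_into_into[OF True] by blast
      then show ?thesis by (subst exp_potential) auto
    qed simp
  qed
  finally show ?thesis .
qed

lemma inj_on_branch:
  assumes "A \<subseteq> {0..1}" "\<And>x y. x \<in> A \<Longrightarrow> y \<in> A \<Longrightarrow> right_half x = right_half y"
  shows "inj_on f A"
proof (rule inj_onI)
  fix x y assume *: "x \<in> A" "y \<in> A" "f x = f y"
  show "x = y" by (rule f_inj[OF _ _ assms(2)[OF *(1,2)] *(3)]) (use * assms(1) in auto)
qed

lemma conformal_lower:
  assumes A: "A \<in> sets m" "f ` A \<in> sets m" "\<And>x y. x \<in> A \<Longrightarrow> y \<in> A \<Longrightarrow> right_half x = right_half y"
    and L: "\<And>x. x \<in> A \<Longrightarrow> log_deriv x \<le> L"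
  shows "measure m A \<ge> exp (- t * L - p) * measure m (f ` A)"
proof -
  have "A \<subseteq> {0..1}" using sets.sets_into_space[OF A(1)] by (simp add: space_m)
  have "ennreal (exp (- t * L - p) * measure m (f ` A)) = ennreal (exp (- t * L - p)) * emeasure m (f ` A)"
    by (simp add: emeasure_eq_measure ennreal_mult)
  also have "\<dots> = (\<integral>\<^sup>+y. ennreal (exp (- t * L - p)) * indicator (f ` A) y \<partial>m)"
    using A(2) by (simp add: nn_integral_cmult_indicator)
  also have "\<dots> \<le> (\<integral>\<^sup>+y. ennreal (exp (- t * log_deriv (inv_into A f y) - p)) * indicator (f ` A) y \<partial>m)"
  proof (rule nn_integral_mono)
    fix y
    show "ennreal (exp (- t * L - p)) * indicator (f ` A) y
      \<le> ennreal (exp (- t * log_deriv (inv_into A f y) - p)) * indicator (f ` A) y"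
    proof (cases "y \<in> f ` A")
      case True
      have "t * log_deriv (inv_into A f y) \<le> t * L"
        using L[OF inv_into_into[OF True]] t by (intro mult_left_mono) auto
      then show ?thesis using True by (auto intro!: ennreal_leI)
    qed simp
  qed
  also have "\<dots> = emeasure m A"
    by (rule conformal_eq[symmetric, OF A(1) inj_on_branch[OF \<open>A \<subseteq> {0..1}\<close> A(3)]])
  finally show ?thesis by (simp add: emeasure_eq_measure)
qed

lemma conformal_point:
  assumes "x \<in> {0..1}"
  shows "measure m {x} = exp (- t * log_deriv x - p) * measure m {f x}"
proof -
  have s: "{x} \<in> sets m" "{f x} \<in> sets m"
    using assms f_mem[OF assms] by (auto simp: sets_m sets_restrict_space_iff)
  have "emeasure m {x} = (\<integral>\<^sup>+y. ennreal (exp (- t * log_deriv (inv_into {x} f y) - p)) * indicator {f x} y \<partial>m)"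
    using conformal_eq[OF s(1)] by simp
  also have "\<dots> = (\<integral>\<^sup>+y. ennreal (exp (- t * log_deriv x - p)) * indicator {f x} y \<partial>m)"
  proof (rule nn_integral_cong)
    fix y
    have "inv_into {x} f (f x) = x" by (rule inv_into_f_f) auto
    then show "ennreal (exp (- t * log_deriv (inv_into {x} f y) - p)) * indicator {f x} y
      = ennreal (exp (- t * log_deriv x - p)) * indicator {f x} y"
      by (auto simp: indicator_def)
  qed
  also have "\<dots> = ennreal (exp (- t * log_deriv x - p)) * emeasure m {f x}"
    using s(2) by (simp add: nn_integral_cmult_indicator)
  also have "\<dots> = ennreal (exp (- t * log_deriv x - p) * measure m {f x})"
    by (simp add: emeasure_eq_measure ennreal_mult)
  finally show ?thesis by (simp add: emeasure_eq_measure)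
qed

text \<open>
  Iterated conformality: in each step the cylinder of a word is mapped onto the cylinder of its tail, and the
  mass changes by a factor of at least the minimum of \<open>exp (t \<phi> - p)\<close>.
\<close>

lemma measure_cyl_ge_sum:
  assumes "\<And>k x. k < length w \<Longrightarrow> x \<in> cyl (drop k w) \<Longrightarrow> log_deriv x \<le> L k"
  shows "measure m (cyl w) \<ge> exp (- t * (\<Sum>k<length w. L k) - real (length w) * p) * measure m {0<..<1}"
  using assms
proof (induction w arbitrary: L)
  case (Cons b w)
  have IH: "measure m (cyl w) \<ge> exp (- t * (\<Sum>k<length w. L (Suc k)) - real (length w) * p) * measure m {0<..<1}"
    using Cons.prems[of "Suc _"] by (intro Cons.IH) auto
  have "measure m (cyl (b # w)) \<ge> exp (- t * L 0 - p) * measure m (f ` cyl (b # w))"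
  proof (rule conformal_lower)
    show "log_deriv x \<le> L 0" if "x \<in> cyl (b # w)" for x using Cons.prems[of 0 x] that by simp
    show "right_half x = right_half y" if "x \<in> cyl (b # w)" "y \<in> cyl (b # w)" for x y
      using cyl_code[OF that(1)] cyl_code[OF that(2)] by (simp add: code_Suc)
  qed (simp_all only: cyl_image cyl_sets sets_m)
  also have "measure m (f ` cyl (b # w)) = measure m (cyl w)" by (simp only: cyl_image)
  finally have "measure m (cyl (b # w)) \<ge> exp (- t * L 0 - p) * measure m (cyl w)" .
  also have "exp (- t * L 0 - p) * measure m (cyl w) \<ge> exp (- t * L 0 - p) *
      (exp (- t * (\<Sum>k<length w. L (Suc k)) - real (length w) * p) * measure m {0<..<1})"
    using IH by (intro mult_left_mono) auto
  also have "exp (- t * L 0 - p) *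
      (exp (- t * (\<Sum>k<length w. L (Suc k)) - real (length w) * p) * measure m {0<..<1})
    = exp (- t * (\<Sum>k<length (b # w). L k) - real (length (b # w)) * p) * measure m {0<..<1}"
  proof -
    have "(\<Sum>k<length (b # w). L k) = L 0 + (\<Sum>k<length w. L (Suc k))"
      by (simp add: sum.lessThan_Suc_shift del: sum.lessThan_Suc)
    then have "- t * (\<Sum>k<length (b # w). L k) - real (length (b # w)) * p
      = (- t * L 0 - p) + (- t * (\<Sum>k<length w. L (Suc k)) - real (length w) * p)"
      by (simp add: algebra_simps)
    then show ?thesis by (simp only: exp_add mult.assoc)
  qed
  finally show ?case .
qed simp

lemma measure_cyl_ge:
  assumes "\<epsilon> > 0"
  obtains K where "K \<ge> 0"
    "\<And>n x. x \<in> {0..1} \<Longrightarrow> measure m (cyl (code n x)) \<ge>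
      exp (- t * birkhoff n x - real n * (p + \<epsilon>) - K) * measure m {0<..<1}"
proof -
  obtain K e where e: "K \<ge> 0"
    "\<And>j x y. j \<ge> 1 \<Longrightarrow> x \<in> {0..1} \<Longrightarrow> y \<in> {0..1} \<Longrightarrow> code j x = code j y \<Longrightarrow> log_deriv y \<le> log_deriv x + e j"
    "\<And>n. (\<Sum>k<n. e (n - k)) \<le> real n * \<epsilon> + K"
    by (rule distortion[OF assms], rule that)
  show ?thesis
  proof (rule that[OF e(1)])
    fix n :: nat and x :: real assume x: "x \<in> {0..1}"
    let ?L = "\<lambda>k. log_deriv ((f ^^ k) x) + e (n - k)"
    have "measure m (cyl (code n x)) \<ge> exp (- t * (\<Sum>k<length (code n x). ?L k)
        - real (length (code n x)) * p) * measure m {0<..<1}"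
    proof (rule measure_cyl_ge_sum)
      fix k y assume k: "k < length (code n x)" and y: "y \<in> cyl (drop k (code n x))"
      have "y \<in> {0..1}" using y cyl_subset[of "drop k (code n x)"] by auto
      moreover have "code (n - k) ((f ^^ k) x) = code (n - k) y"
        using cyl_code[OF y] drop_code[of k n x] k by simp
      ultimately show "log_deriv y \<le> ?L k" using k funpow_mem[OF x] by (intro e(2)) auto
    qed
    moreover have "exp (- t * birkhoff n x - real n * (p + \<epsilon>) - K)
       \<le> exp (- t * (\<Sum>k<n. ?L k) - real n * p)"
    proof -
      have "t * (\<Sum>k<n. e (n - k)) \<le> t * (real n * \<epsilon> + K)"
        using t e(3) by (intro mult_left_mono) auto
      also have "\<dots> \<le> 1 * (real n * \<epsilon> + K)"
        using t e(1) assms by (intro mult_right_mono) auto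
      finally have "t * (\<Sum>k<n. e (n - k)) \<le> real n * \<epsilon> + K" by simp
      then show ?thesis by (simp add: sum.distrib algebra_simps)
    qed
    ultimately show "measure m (cyl (code n x)) \<ge>
      exp (- t * birkhoff n x - real n * (p + \<epsilon>) - K) * measure m {0<..<1}"
      by (auto elim!: order_trans[rotated] intro!: mult_right_mono)
  qed
qed

text \<open>
  If \<open>(0,1)\<close> had no mass, then neither would \<open>1/2\<close>, nor its image \<open>0\<close>. All mass would sit at the fixed point \<open>1\<close>,
  where conformality multiplies the mass by \<open>exp (- t ln 2 - p)\<close>, a factor smaller than \<open>1\<close>.
\<close>

lemma interior_mass_pos:
  assumes p0: "p \<ge> 0" and tp: "t = 0 \<Longrightarrow> p > 0"
  shows "measure m {0<..<1} > 0"
proof (rule ccontr)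
  assume "\<not> measure m {0<..<1} > 0"
  then have z: "measure m {0<..<1} = 0" using measure_nonneg[of m "{0<..<1}"] by linarith
  have ev: "{0<..<1} \<in> events" "{0} \<in> events" "{1} \<in> events" "{1/2} \<in> events"
    by (auto simp: sets_m sets_restrict_space_iff)
  have "measure m {1/2} \<le> measure m {0<..<1}" using ev by (intro finite_measure_mono) auto
  then have "measure m {1/2} = 0" using z measure_nonneg[of m "{1/2}"] by linarith
  then have z0: "measure m {0} = 0" using conformal_point[of "1/2"] by simp
  have "measure m {1} = exp (- t * ln 2 - p) * measure m {1}"
    using conformal_point[of 1] by (simp add: log_deriv_def)
  moreover have "exp (- t * ln 2 - p) < 1"
  proof (cases "t = 0")
    case False
    then have "0 < t * ln 2" using t by (intro mult_pos_pos) auto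
    then show ?thesis using p0 by simp
  qed (use tp in simp)
  ultimately have z1: "measure m {1} = 0"
    by (metis mult_cancel_right1 less_irrefl)
  have "1 = measure m {0..1}" using prob_space by (simp add: space_m)
  also have "{0..1} = {0} \<union> {0<..<1} \<union> {1::real}" by auto
  also have "measure m \<dots> \<le> measure m ({0} \<union> {0<..<1}) + measure m {1}"
    by (intro measure_Un_le sets.Un ev)
  also have "\<dots> \<le> measure m {0} + measure m {0<..<1} + measure m {1}"
    by (intro add_right_mono measure_Un_le ev)
  finally show False using z z0 z1 by simp
qed

end

section \<open>Markov holes as unions of cylinders\<close>

lemma open_right_neighbourhood:
  fixes z :: real
  assumes "open U" "z \<in> U"
  obtains \<epsilon> where "\<epsilon> > 0" "{z<..<z + \<epsilon>} \<subseteq> U"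
proof -
  obtain \<epsilon> where "\<epsilon> > 0" "ball z \<epsilon> \<subseteq> U" using assms open_contains_ball by blast
  moreover have "{z<..<z + \<epsilon>} \<subseteq> ball z \<epsilon>" by (auto simp: dist_real_def)
  ultimately show ?thesis using that by blast
qed

lemma open_subset_half_open:
  assumes "open U" "U \<subseteq> A" "U \<subseteq> {0..<1}" shows "U \<subseteq> half_open A"
proof
  fix z assume z: "z \<in> U"
  obtain \<epsilon> where "\<epsilon> > 0" "{z<..<z + \<epsilon>} \<subseteq> U" by (rule open_right_neighbourhood[OF assms(1) z], rule that)
  then show "z \<in> half_open A" using z assms unfolding half_open_def by blast
qed

lemma open_disjoint_half_open:
  assumes "open U" "U \<inter> A = {}" shows "U \<inter> half_open A = {}"
proof (rule ccontr)
  assume "U \<inter> half_open A \<noteq> {}"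
  then obtain z \<epsilon> where z: "z \<in> U" "\<epsilon> > 0" "{z<..<z + \<epsilon>} \<subseteq> A" by (auto simp: half_open_def)
  obtain \<delta> where d: "\<delta> > 0" "{z<..<z + \<delta>} \<subseteq> U" by (rule open_right_neighbourhood[OF assms(1) z(1)], rule that)
  have "z + min \<epsilon> \<delta> / 2 \<in> A" "z + min \<epsilon> \<delta> / 2 \<in> U"
    using z d by (auto intro!: subsetD[OF z(3)] subsetD[OF d(2)] simp: min_def)
  then show False using assms(2) by blast
qed

context
  fixes \<I> :: "real set set" and H :: "real set"
  assumes fin: "finite \<I>" and I: "\<And>I. I \<in> \<I> \<Longrightarrow> is_interval I \<and> interior I \<noteq> {}" and H: "H = \<Union>\<I>"
begin

text \<open>
  A point of \<open>half_open H\<close> outside \<open>H\<close> is the left end of one of the intervals: by the pigeonhole principle one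
  of the finitely many intervals contains points arbitrarily close to it on the right.
\<close>

lemma finite_half_open_diff: "finite (half_open H - H)"
proof (rule finite_subset)
  show "half_open H - H \<subseteq> Inf ` \<I>"
  proof
    fix x assume x: "x \<in> half_open H - H"
    then obtain \<epsilon> where \<epsilon>: "\<epsilon> > 0" "{x<..<x + \<epsilon>} \<subseteq> H" by (auto simp: half_open_def)
    have "\<exists>I\<in>\<I>. \<forall>\<delta>>0. I \<inter> {x<..<x + \<delta>} \<noteq> {}"
    proof (rule ccontr)
      assume "\<not> (\<exists>I\<in>\<I>. \<forall>\<delta>>0. I \<inter> {x<..<x + \<delta>} \<noteq> {})"
      then obtain d where d: "\<And>I. I \<in> \<I> \<Longrightarrow> d I > 0 \<and> I \<inter> {x<..<x + d I} = {}" by metis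
      define r where "r = Min (insert \<epsilon> (d ` \<I>))"
      have r: "r > 0" "r \<le> \<epsilon>" "\<And>I. I \<in> \<I> \<Longrightarrow> r \<le> d I"
        unfolding r_def using fin d \<epsilon> by auto
      have "x + r / 2 \<in> H" using r \<epsilon> by (intro subsetD[OF \<epsilon>(2)]) auto
      then obtain I where "I \<in> \<I>" "x + r / 2 \<in> I" using H by auto
      moreover have "x + r / 2 \<in> {x<..<x + d I}" using r(1) r(3)[OF \<open>I \<in> \<I>\<close>] by auto
      ultimately show False using d by blast
    qed
    then obtain J where J: "J \<in> \<I>" "\<And>\<delta>. \<delta> > 0 \<Longrightarrow> J \<inter> {x<..<x + \<delta>} \<noteq> {}" by blast
    have above: "x \<le> y" if "y \<in> J" for y
    proof (rule ccontr)
      assume "\<not> x \<le> y"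
      obtain z where "z \<in> J" "x < z" using J(2)[of 1] by auto
      then have "x \<in> J" using mem_is_interval_1_I[of J y z x] I[OF J(1)] that \<open>\<not> x \<le> y\<close> by simp
      then show False using x J(1) H by blast
    qed
    have "Inf J = x"
    proof (rule cInf_eq)
      fix y assume y: "\<And>z. z \<in> J \<Longrightarrow> y \<le> z"
      show "y \<le> x"
      proof (rule ccontr)
        assume "\<not> y \<le> x"
        then obtain z where "z \<in> J" "z < y" using J(2)[of "y - x"] by auto
        then show False using y by force
      qed
    qed (rule above)
    then show "x \<in> Inf ` \<I>" using J(1) by blast
  qed
qed (use fin in simp)

lemma disjoint_if_half_open_disjoint:
  assumes U: "open U" "U \<subseteq> {0..<1}" "U \<inter> half_open H = {}" shows "U \<inter> H = {}"
proof (rule ccontr)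
  assume "U \<inter> H \<noteq> {}"
  then obtain x J where x: "x \<in> U" "x \<in> J" and J: "J \<in> \<I>" using H by auto
  have "closure (interior J) = closure J"
    using I[OF J] by (intro convex_closure_interior is_interval_convex) auto
  then have "x \<in> closure (interior J)" using x closure_subset by blast
  then have "U \<inter> interior J \<noteq> {}" using x U(1) open_Int_closure_eq_empty[OF U(1)] by blast
  moreover have "U \<inter> interior J \<subseteq> half_open H"
  proof (rule open_subset_half_open)
    show "U \<inter> interior J \<subseteq> H" using J H interior_subset[of J] by blast
  qed (use U in auto)
  ultimately show False using U(3) by blast
qed

text \<open>
  An interval that contains points inside and outside \<open>H\<close> contains an end of one of the intervals that make up
  \<open>H\<close>. As these ends are finite in number, one word length will serve for all cylinders.
\<close>

lemma interval_split_endpoint: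
  assumes U: "is_interval U" "x \<in> U" "x \<in> H" "y \<in> U" "y \<notin> H"
  shows "\<exists>e \<in> Inf ` \<I> \<union> Sup ` \<I>. e \<in> U"
proof -
  obtain J where J: "J \<in> \<I>" "x \<in> J" "y \<notin> J" using U H by auto
  show ?thesis
  proof (cases "x \<le> y")
    case True
    have up: "z \<le> y" if "z \<in> J" for z
      using mem_is_interval_1_I[of J x z y] I[OF J(1)] J(2,3) that True by (cases "z \<le> y") auto
    have "x \<le> Sup J" using J(2) up by (intro cSup_upper bdd_aboveI) auto
    moreover have "Sup J \<le> y" using J(2) up by (intro cSup_least) auto
    ultimately have "Sup J \<in> U" by (rule mem_is_interval_1_I[OF U(1,2,4)])
    then show ?thesis using J(1) by blast
  next
    case False
    have lo: "y \<le> z" if "z \<in> J" for z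
      using mem_is_interval_1_I[of J z x y] I[OF J(1)] J(2,3) that False by (cases "y \<le> z") auto
    have "Inf J \<le> x" using J(2) lo by (intro cInf_lower bdd_belowI) auto
    moreover have "y \<le> Inf J" using J(2) lo by (intro cInf_greatest) auto
    ultimately have "Inf J \<in> U" using mem_is_interval_1_I[OF U(1,4,2)] by blast
    then show ?thesis using J(1) by blast
  qed
qed

end

context intermittent_map begin

lemma J_int_iff:
  "x \<in> {0..1} \<Longrightarrow> x \<in> J_int \<gamma> n \<longleftrightarrow>
    (\<forall>i<n. \<not> right_half ((f ^^ i) x)) \<and> right_half ((f ^^ n) x) \<and> (f ^^ n) x < 1"
proof (induction n arbitrary: x)
  case 0
  then show ?case by (auto simp: right_half_def)
next
  case (Suc n)
  have "x \<in> J_int \<gamma> (Suc n) \<longleftrightarrow> \<not> right_half x \<and> f x \<in> J_int \<gamma> n"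
    using Suc.prems by (auto simp: right_half_def)
  also have "f x \<in> J_int \<gamma> n \<longleftrightarrow> (\<forall>i<n. \<not> right_half ((f ^^ Suc i) x)) \<and> right_half ((f ^^ Suc n) x) \<and> (f ^^ Suc n) x < 1"
    using Suc.IH[OF f_mem[OF Suc.prems]] by (simp add: funpow_swap1)
  finally show ?case by (auto simp: All_less_Suc2 simp del: funpow.simps)
qed

lemma code_right_half:
  assumes "code n x = code n y" "i < n" shows "right_half ((f ^^ i) x) \<longleftrightarrow> right_half ((f ^^ i) y)"
  using assms by (auto simp: itinerary_eq_iff)

lemma cyl_same_code: "x \<in> cyl w \<Longrightarrow> y \<in> cyl w \<Longrightarrow> code (length w) x = code (length w) y"
  by (simp add: cyl_code)

lemma cyl_funpow: "x \<in> cyl w \<Longrightarrow> i \<le> length w \<Longrightarrow> (f ^^ i) x \<in> {0<..<1}"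
  using cyl_drop[of x w i] cyl_subset[of "drop i w"] by blast

text \<open>
  The cell of \<open>P_part\<close> that contains a point is determined by finitely many symbols of the point: the first
  \<open>N\<close> ones, and those up to the first visit to \<open>[1/2,1)\<close>, whose time is at most \<open>j\<close>.
\<close>

lemma cyl_P_part:
  assumes x: "x \<in> cyl w" and y: "y \<in> cyl w" and N: "N \<le> length w"
    and j: "j < length w" "right_half ((f ^^ j) x)" and c: "c \<in> P_part \<gamma> N" "x \<in> c"
  shows "y \<in> c"
proof -
  note same = code_right_half[OF cyl_same_code[OF x y]]
  have I: "x \<in> {0..1}" "y \<in> {0..1}" using x y cyl_subset[of w] by auto
  let ?P = "insert (range (J_int \<gamma>))
         ((\<lambda>k. pull_back {0..1} f k {{0..<1/2}, {1/2..<1}}) ` {..<N})"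
  obtain g where g: "\<And>P. P \<in> ?P \<Longrightarrow> g P \<in> P" and cg: "c = \<Inter> (g ` ?P)"
    using c(1) unfolding P_part_def common_refinement by blast
  have xg: "x \<in> g P" if "P \<in> ?P" for P using c(2) that unfolding cg by blast
  have "y \<in> g P" if P: "P \<in> ?P" for P
  proof -
    consider "P = range (J_int \<gamma>)" | k where "k < N" "P = pull_back {0..1} f k {{0..<1/2}, {1/2..<1}}"
      using P by blast
    then show ?thesis
    proof cases
      case 1
      then obtain k where k: "g P = J_int \<gamma> k" using g[OF P] by blast
      then have xk: "\<forall>i<k. \<not> right_half ((f ^^ i) x)" "right_half ((f ^^ k) x)"
        using xg[OF P] J_int_iff[OF I(1)] by auto
      then have "k \<le> j" using j(2) by (meson not_le)
      then have "k < length w" using j(1) by simp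
      have "y \<in> J_int \<gamma> k"
        unfolding J_int_iff[OF I(2)]
      proof (intro conjI allI impI)
        show "\<not> right_half ((f ^^ i) y)" if "i < k" for i
          using xk(1) same[of i] that \<open>k < length w\<close> by simp
        show "right_half ((f ^^ k) y)" using xk(2) same[of k] \<open>k < length w\<close> by simp
        show "(f ^^ k) y < 1" using cyl_funpow[OF y, of k] \<open>k < length w\<close> by simp
      qed
      then show ?thesis by (simp add: k)
    next
      case (2 k)
      obtain A where A: "A = {0..<1/2} \<or> A = {1/2..<1}" "g P = (f ^^ k) -` A \<inter> {0..1}"
        using g[OF P] unfolding 2 pull_back_def by blast
      have "(f ^^ k) x \<in> A" using xg[OF P] A(2) by auto
      moreover have "right_half ((f ^^ k) x) \<longleftrightarrow> right_half ((f ^^ k) y)"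
        using 2 N by (intro same) auto
      moreover have "(f ^^ k) y \<in> {0<..<1}" using 2 N by (intro cyl_funpow[OF y]) auto
      ultimately have "(f ^^ k) y \<in> A" using A(1) by (auto simp: right_half_def)
      then show ?thesis using A(2) I(2) by simp
    qed
  qed
  then show ?thesis unfolding cg by blast
qed

text \<open>
  If the orbit of \<open>e\<close> meets \<open>0\<close> or \<open>1\<close>, then \<open>e\<close> is a cylinder endpoint and lies in no long open cylinder. Otherwise
  \<open>e\<close> visits the right half, a long cylinder around \<open>e\<close> lies inside one cell of \<open>P_part\<close>, and the hole is a union
  of cells up to endpoints.
\<close>

lemma cyl_point_dichotomy:
  assumes hole: "markov_hole \<gamma> N0 H"
  shows "\<exists>n. \<forall>w. n \<le> length w \<longrightarrow> e \<in> cyl w \<longrightarrow> cyl w \<subseteq> half_open H \<or> cyl w \<inter> H = {}"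
proof (cases "\<exists>k. (f ^^ k) e \<in> {0, 1}")
  case True
  then obtain k where k: "(f ^^ k) e \<in> {0, 1}" by blast
  have "e \<notin> cyl w" if "k \<le> length w" for w
    using cyl_funpow[of e w k] that k by auto
  then show ?thesis by blast
next
  case bad: False
  obtain \<I> where \<I>: "finite \<I>" "\<And>I. I \<in> \<I> \<Longrightarrow> is_interval I \<and> interior I \<noteq> {}" "H = \<Union>\<I>"
    using hole unfolding markov_hole_def by metis
  obtain \<U> where \<U>: "\<U> \<subseteq> P_part \<gamma> N0" "half_open H = half_open (\<Union>\<U>)"
    using hole unfolding markov_hole_def by metis
  show ?thesis
  proof (cases "e \<in> {0<..<1}")
    case False
    then show ?thesis using cyl_subset by blast
  next
    case True
    then obtain j where j: "right_half ((f ^^ j) e)" using reaches_right[of e] by auto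
    show ?thesis
    proof (intro exI allI impI)
      fix w :: "bool list" assume n: "max N0 (Suc j) \<le> length w" and e: "e \<in> cyl w"
      have sub: "cyl w \<subseteq> {0..<1}" using cyl_subset[of w] by auto
      show "cyl w \<subseteq> half_open H \<or> cyl w \<inter> H = {}"
      proof (cases "e \<in> \<Union>\<U>")
        case True
        then obtain c where c: "c \<in> \<U>" "e \<in> c" by blast
        have "cyl w \<subseteq> c" using cyl_P_part[OF e _ _ _ j, where N = N0 and c = c] c \<U>(1) n by auto
        then have "cyl w \<subseteq> half_open (\<Union>\<U>)"
          using c sub by (intro open_subset_half_open open_cyl) auto
        then show ?thesis using \<U>(2) by simp
      next
        case False
        have "cyl w \<inter> \<Union>\<U> = {}"
        proof (rule ccontr)
          assume "cyl w \<inter> \<Union>\<U> \<noteq> {}"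
          then obtain y c where y: "y \<in> cyl w" "y \<in> c" "c \<in> \<U>" by blast
          have "right_half ((f ^^ j) y)"
            using code_right_half[OF cyl_same_code[OF e y(1)], of j] j n by simp
          then have "e \<in> c" using cyl_P_part[OF y(1) e, where N = N0 and j = j and c = c] y \<U>(1) n by auto
          then show False using False y(3) by blast
        qed
        then have "cyl w \<inter> half_open H = {}"
          unfolding \<U>(2) by (intro open_disjoint_half_open open_cyl)
        then have "cyl w \<inter> H = {}"
          using disjoint_if_half_open_disjoint[OF \<I> open_cyl sub] by blast
        then show ?thesis ..
      qed
    qed
  qed
qed

text \<open>
  The first alternative is stated with \<open>half_open H\<close> because \<open>H\<close> itself may lack finitely many points of the
  cylinder.
\<close>

theorem cyl_hole_dichotomy:
  assumes hole: "markov_hole \<gamma> N0 H"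
  shows "\<exists>N. \<forall>w. N \<le> length w \<longrightarrow> cyl w \<subseteq> half_open H \<or> cyl w \<inter> H = {}"
proof -
  obtain \<I> where \<I>: "finite \<I>" "\<And>I. I \<in> \<I> \<Longrightarrow> is_interval I \<and> interior I \<noteq> {}" "H = \<Union>\<I>"
    using hole unfolding markov_hole_def by metis
  let ?E = "Inf ` \<I> \<union> Sup ` \<I>"
  obtain n where n: "\<And>e w. n e \<le> length w \<Longrightarrow> e \<in> cyl w \<Longrightarrow> cyl w \<subseteq> half_open H \<or> cyl w \<inter> H = {}"
    using cyl_point_dichotomy[OF hole] by metis
  show ?thesis
  proof (intro exI allI impI)
    fix w :: "bool list" assume w: "Max (insert 0 (n ` ?E)) \<le> length w"
    have sub: "cyl w \<subseteq> {0..<1}" using cyl_subset[of w] by auto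
    show "cyl w \<subseteq> half_open H \<or> cyl w \<inter> H = {}"
    proof (cases "\<exists>e\<in>?E. e \<in> cyl w")
      case True
      then obtain e where e: "e \<in> ?E" "e \<in> cyl w" by blast
      have "n e \<le> Max (insert 0 (n ` ?E))" using \<I>(1) e(1) by (intro Max_ge) auto
      then show ?thesis using n[OF _ e(2)] w by simp
    next
      case False
      have int: "is_interval (cyl w)"
        unfolding is_interval_1 using cyl_interval by blast
      have "cyl w \<subseteq> H \<or> cyl w \<inter> H = {}"
        using interval_split_endpoint[OF \<I> int] False by blast
      then show ?thesis using open_subset_half_open[OF open_cyl _ sub] by blast
    qed
  qed
qed

text \<open>
  If the hole contained the points just to the right of \<open>0\<close>, then all points just to the right of \<open>1/2\<close> would fall into
  it after one step, and the return map of the open system would be undefined there.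
\<close>

lemma zero_cyl_avoids_hole:
  assumes ns: "non_swallowing \<gamma> N0 H"
    and N: "cyl (replicate N False) \<subseteq> half_open H \<or> cyl (replicate N False) \<inter> H = {}"
  shows "cyl (replicate N False) \<inter> H = {}"
proof (rule ccontr)
  assume "cyl (replicate N False) \<inter> H \<noteq> {}"
  then have sub: "{0<..<(1/2) ^ N} \<subseteq> half_open H" using N cyl_zero[of N] by blast
  \<comment> \<open>The right branch doubles lengths, so \<open>(1/2, 1/2 + \<delta>)\<close> is mapped into \<open>(0, (1/2)\<^sup>N)\<close>, a part of the cylinder.\<close>
  define \<delta> :: real where "\<delta> = (1/2) ^ Suc N"
  let ?H = "half_open H"
  have False if x: "x \<in> {1/2<..<1/2 + \<delta>} \<inter> open_return_dom \<gamma> ?H" for x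
  proof -
    have fx: "f x = 2 * x - 1" using x by (intro f_right) auto
    then have fH: "f x \<in> ?H" using x by (intro subsetD[OF sub]) (auto simp: \<delta>_def)
    let ?S = "{n. 1 \<le> n \<and> (f ^^ n) x \<in> {1/2..1} \<union> ?H}"
    have "return_time \<gamma> ?H x = enat 1"
      unfolding return_time_def
    proof (rule antisym)
      show "Inf (enat ` ?S) \<le> enat 1" using fH by (intro Inf_lower) auto
      show "enat 1 \<le> Inf (enat ` ?S)" by (intro Inf_greatest) auto
    qed
    then have "open_return_map \<gamma> ?H x = f x" by (simp add: open_return_map_def)
    then show False using x fH by (auto simp: open_return_dom_def)
  qed
  then have "open_return_image \<gamma> ?H {1/2<..<1/2 + \<delta>} = {}"
    unfolding open_return_image_def by blast
  moreover have "\<delta> > 0" by (simp add: \<delta>_def)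
  ultimately show False using ns unfolding non_swallowing_def by fastforce
qed

lemma hole_borel:
  assumes "markov_hole \<gamma> N0 H" shows "H \<in> sets borel"
proof -
  obtain \<I> where \<I>: "finite \<I>" "\<And>I. I \<in> \<I> \<Longrightarrow> is_interval I" "H = \<Union>\<I>"
    using assms unfolding markov_hole_def by metis
  show ?thesis unfolding \<I>(3) using \<I>(1,2)
    by (intro sets.finite_Union) (auto intro: real_interval_borel_measurable)
qed

lemma survivors_sets:
  assumes "markov_hole \<gamma> N0 H" shows "survivors \<gamma> H n \<in> sets unit_borel"
proof -
  note [measurable] = hole_borel[OF assms]
  have "survivors \<gamma> H n = {x \<in> space borel. x \<in> {0..1} \<and> (\<forall>i\<in>{..n}. (f ^^ i) x \<in> {0..1} - H)}"
    by (auto simp: survivors_def)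
  also have "\<dots> \<in> sets borel" by measurable
  finally show ?thesis by (auto simp: sets_restrict_space_iff survivors_def)
qed

lemma cyl_subset_survivors:
  assumes w: "length w = n + N" and a: "\<And>i. i \<le> n \<Longrightarrow> cyl (take N (drop i w)) \<inter> H = {}"
  shows "cyl w \<subseteq> survivors \<gamma> H n"
proof
  fix x assume x: "x \<in> cyl w"
  have "(f ^^ i) x \<in> {0..1} - H" if "i \<le> n" for i
  proof -
    have "(f ^^ i) x \<in> cyl (drop i w)" using x that w by (intro cyl_drop) auto
    then have "(f ^^ i) x \<in> cyl (take N (drop i w))" "(f ^^ i) x \<in> {0..1}"
      using cyl_take cyl_subset[of "drop i w"] by auto
    then show ?thesis using a[OF that] by blast
  qed
  moreover have "x \<in> {0..1}" using x cyl_subset[of w] by auto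
  ultimately show "x \<in> survivors \<gamma> H n" by (auto simp: survivors_def)
qed

end

section \<open>Ergodic measures with atoms, and codes as generators\<close>

lemma invariant_system_of_ergodic:
  assumes "ergodic_prob X T \<mu>" shows "invariant_system \<mu> T"
  using assms unfolding ergodic_prob_def invariant_prob_def
  by (intro invariant_system.intro invariant_system_axioms.intro) auto

context invariant_system begin

lemma entropy_of_partition_nonneg:
  assumes "finite_measurable_partition M \<xi>" shows "entropy_of_partition M T \<xi> \<ge> 0"
  by (rule LIMSEQ_le_const[OF entropy_of_partition_LIMSEQ[OF assms]])
    (auto intro!: exI[of _ 0] divide_nonneg_nonneg map_entropy_nonneg simple_function_itinerary
      simple_function_cell assms)

lemma KS_entropy_ge:
  assumes "finite_measurable_partition M \<xi>" shows "KS_entropy M T \<ge> ereal (entropy_of_partition M T \<xi>)"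
  unfolding KS_entropy_def using assms by (intro SUP_upper) simp

lemma KS_entropy_nonneg: "KS_entropy M T \<ge> 0"
proof -
  have "finite_measurable_partition M {space M}"
    using not_empty by (auto simp: finite_measurable_partition_def intro: partition_on_space)
  note \<xi> = this
  have "0 \<le> ereal (entropy_of_partition M T {space M})" using entropy_of_partition_nonneg[OF \<xi>] by simp
  also have "\<dots> \<le> KS_entropy M T" by (rule KS_entropy_ge[OF \<xi>])
  finally show ?thesis .
qed

text \<open>
  Itineraries take at most \<open>card F\<close> values, so their entropy stays bounded by \<open>ln (card F)\<close>.
\<close>

lemma KS_entropy_finite_carrier:
  assumes F: "finite F" "F \<subseteq> space M" "F \<in> events" "prob F = 1"
  shows "KS_entropy M T \<le> 0"
  unfolding KS_entropy_def
proof (rule SUP_least)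
  fix \<xi> assume "\<xi> \<in> Collect (finite_measurable_partition M)"
  then have \<xi>: "finite_measurable_partition M \<xi>" by simp
  let ?X = "itinerary T (cell \<xi>)"
  note sf = simple_function_itinerary[OF simple_function_cell[OF \<xi>]]
  have F0: "F \<noteq> {}" using F(4) by auto
  have "map_entropy M (?X n) / real n \<le> ln (card F) / real n" for n
  proof (rule divide_right_mono)
    have "map_entropy M (?X n) \<le> ln (card (?X n ` F))"
    proof (rule map_entropy_le_ln_card[OF sf])
      fix v assume "prob {\<omega>\<in>space M. ?X n \<omega> = v} > 0"
      then have "prob ({\<omega>\<in>space M. ?X n \<omega> = v} \<inter> F) > 0"
        using measure_space_inter[of "{\<omega>\<in>space M. ?X n \<omega> = v}" F] F simple_function_fibre[OF sf]
        by (simp add: prob_space)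
      then have "{\<omega>\<in>space M. ?X n \<omega> = v} \<inter> F \<noteq> {}" by (metis measure_empty less_irrefl)
      then show "v \<in> ?X n ` F" by blast
    qed (use F in auto)
    also have "\<dots> \<le> ln (card F)"
    proof -
      have "card (?X n ` F) \<le> card F" "card (?X n ` F) > 0"
        using F(1) F0 by (auto intro: card_image_le simp: card_gt_0_iff)
      then show ?thesis by simp
    qed
    finally show "map_entropy M (?X n) \<le> ln (card F)" .
  qed simp
  moreover have "(\<lambda>n. ln (real (card F)) / real n) \<longlonglongrightarrow> 0"
    by (intro tendsto_divide_0[OF tendsto_const] filterlim_real_sequentially
        filterlim_at_top_imp_at_infinity)
  ultimately have "entropy_of_partition M T \<xi> \<le> 0"
    using LIMSEQ_le[OF entropy_of_partition_LIMSEQ[OF \<xi>]] by blast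
  then show "ereal (entropy_of_partition M T \<xi>) \<le> 0" by simp
qed

text \<open>
  By invariance no point of the orbit has less mass than the atom.
\<close>

lemma atom_orbit_finite:
  assumes x: "x \<in> space M" "prob {x} > 0" and sing: "\<And>y. y \<in> space M \<Longrightarrow> {y} \<in> events"
  shows "finite (range (\<lambda>n. (T ^^ n) x))"
proof (rule ccontr)
  let ?O = "range (\<lambda>n. (T ^^ n) x)"
  assume "infinite ?O"
  \<comment> \<open>Any \<open>k\<close> points of the orbit would have total mass greater than \<open>1\<close>.\<close>
  obtain k :: nat where k: "real k * prob {x} > 1"
    using reals_Archimedean3[OF x(2)] by (metis less_le_trans zero_less_one)
  obtain S where S: "S \<subseteq> ?O" "finite S" "card S = k"
    using infinite_arbitrarily_large[OF \<open>infinite ?O\<close>] by blast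
  have mem: "y \<in> space M" if "y \<in> S" for y using S(1) that funpow_space[OF x(1)] by auto
  have "prob {x} \<le> prob {y}" if y: "y \<in> S" for y
  proof -
    obtain n where n: "y = (T ^^ n) x" using S(1) y by blast
    have "prob {x} \<le> prob {\<omega>\<in>space M. (T ^^ n) \<omega> \<in> {y}}"
    proof (rule finite_measure_mono)
      have "{\<omega>\<in>space M. (T ^^ n) \<omega> \<in> {y}} = (T ^^ n) -` {y} \<inter> space M" by auto
      then show "{\<omega>\<in>space M. (T ^^ n) \<omega> \<in> {y}} \<in> events"
        using measurable_sets[OF T_funpow sing[OF mem[OF y]]] by simp
    qed (use x n in auto)
    also have "\<dots> = prob {y}" by (rule prob_vimage_funpow[OF sing[OF mem[OF y]]])
    finally show ?thesis .
  qed
  then have "(\<Sum>y\<in>S. prob {x}) \<le> (\<Sum>y\<in>S. prob {y})" by (rule sum_mono)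
  also have "\<dots> = prob S"
    using S mem sing by (intro finite_measure_eq_sum_singleton[symmetric]) auto
  finally have "real k * prob {x} \<le> prob S" using S(3) by simp
  then show False using k prob_le_1[of S] by simp
qed

text \<open>
  The set of points whose orbit enters the orbit of the atom is invariant, so it has measure \<open>1\<close> by ergodicity;
  by invariance the finite orbit itself has the same measure.
\<close>

lemma atom_imp_KS_entropy_le_0:
  assumes x: "x \<in> space M" "prob {x} > 0" and sing: "\<And>y. y \<in> space M \<Longrightarrow> {y} \<in> events"
    and ergodic: "\<And>A. A \<in> events \<Longrightarrow> T -` A \<inter> space M = A \<Longrightarrow> prob A = 0 \<or> prob A = 1"
  shows "KS_entropy M T \<le> 0"
proof -
  define O' where "O' = range (\<lambda>n. (T ^^ n) x)"
  have O: "finite O'" "O' \<subseteq> space M"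
    using atom_orbit_finite[OF x sing] funpow_space[OF x(1)] by (auto simp: O'_def)
  have "(\<Union>y\<in>O'. {y}) \<in> events" using O sing by (intro sets.finite_UN) auto
  then have OE: "O' \<in> events" by simp
  have fwd: "T y \<in> O'" if y: "y \<in> O'" for y
  proof -
    obtain n where "y = (T ^^ n) x" using y unfolding O'_def by blast
    then have "T y = (T ^^ Suc n) x" by simp
    then show ?thesis unfolding O'_def by blast
  qed
  define B where "B n = {\<omega>\<in>space M. (T ^^ n) \<omega> \<in> O'}" for n
  have BE: "B n \<in> events" for n
  proof -
    have "B n = (T ^^ n) -` O' \<inter> space M" by (auto simp: B_def)
    then show ?thesis using measurable_sets[OF T_funpow OE] by simp
  qed
  have inc: "incseq B" by (intro incseq_SucI) (auto simp: B_def fwd)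
  have AE: "(\<Union>n. B n) \<in> events" using BE by (intro sets.countable_UN) auto
  have "T -` (\<Union>n. B n) \<inter> space M = (\<Union>n. B n)"
  proof (intro equalityI subsetI)
    fix \<omega> assume "\<omega> \<in> T -` (\<Union>n. B n) \<inter> space M"
    then obtain n where "\<omega> \<in> space M" "(T ^^ n) (T \<omega>) \<in> O'" by (auto simp: B_def)
    then have "\<omega> \<in> B (Suc n)" by (simp add: B_def funpow_swap1)
    then show "\<omega> \<in> (\<Union>n. B n)" by blast
  next
    fix \<omega> assume "\<omega> \<in> (\<Union>n. B n)"
    then obtain n where "\<omega> \<in> space M" "(T ^^ n) \<omega> \<in> O'" by (auto simp: B_def)
    then have "T \<omega> \<in> B n" using funpow_space[of \<omega> 1] fwd[of "(T ^^ n) \<omega>"]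
      by (simp add: B_def funpow_swap1)
    then show "\<omega> \<in> T -` (\<Union>n. B n) \<inter> space M" using \<open>\<omega> \<in> space M\<close> by blast
  qed
  from ergodic[OF AE this] have d: "prob (\<Union>n. B n) = 0 \<or> prob (\<Union>n. B n) = 1" .
  have "x = (T ^^ 0) x" by simp
  then have "x \<in> B 0" using x(1) unfolding B_def O'_def by blast
  then have "prob {x} \<le> prob (\<Union>n. B n)" by (intro finite_measure_mono AE) blast
  then have 1: "prob (\<Union>n. B n) = 1" using d x(2) by auto
  have "(\<lambda>n. prob (B n)) \<longlonglongrightarrow> prob (\<Union>n. B n)"
    using BE inc by (intro finite_Lim_measure_incseq) auto
  moreover have "prob (B n) = prob O'" for n
    unfolding B_def by (rule prob_vimage_funpow[OF OE])
  ultimately have "prob O' = 1" using 1 LIMSEQ_unique[OF _ tendsto_const] by fastforce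
  then show ?thesis using KS_entropy_finite_carrier[OF O OE] by simp
qed

end

context prob_space begin

text \<open>
  Both terms of \<open>- p ln p - (1 - p) ln (1 - p)\<close> are estimated with \<open>- ln x \<le> 1/x - 1\<close>, applied to \<open>x = sqrt p\<close> and
  to \<open>x = 1 - p\<close>.
\<close>

lemma map_entropy_bool_le:
  assumes D: "simple_function M D" and small: "prob {\<omega>\<in>space M. D \<omega>} < 1"
  shows "map_entropy M D \<le> 2 * sqrt (prob {\<omega>\<in>space M. D \<omega>}) + prob {\<omega>\<in>space M. D \<omega>}"
proof -
  let ?p = "prob {\<omega>\<in>space M. D \<omega>}"
  have ev: "{\<omega>\<in>space M. D \<omega>} \<in> events" using simple_function_fibre[OF D, of True] by simp
  have q: "prob {\<omega>\<in>space M. \<not> D \<omega>} = 1 - ?p"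
    using prob_compl[OF ev] by (simp add: set_diff_eq Collect_conj_eq[symmetric] cong: conj_cong)
  have "map_entropy M D = - (\<Sum>b\<in>{True, False}. prob {\<omega>\<in>space M. D \<omega> = b} * ln (prob {\<omega>\<in>space M. D \<omega> = b}))"
    unfolding map_entropy_def fibre_eq
  proof (intro arg_cong[where f=uminus] sum.mono_neutral_left ballI)
    fix b assume "b \<in> {True, False} - D ` space M"
    then have e: "{\<omega>\<in>space M. D \<omega> = b} = {}" by auto
    show "prob {\<omega>\<in>space M. D \<omega> = b} * ln (prob {\<omega>\<in>space M. D \<omega> = b}) = 0" unfolding e by simp
  qed auto
  also have "\<dots> = - (?p * ln ?p) + - ((1 - ?p) * ln (1 - ?p))" using q by simp
  also have "- (?p * ln ?p) \<le> 2 * sqrt ?p"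
  proof (cases "?p = 0")
    case False
    define s where "s = sqrt ?p"
    have s: "s > 0" "?p = s * s" using False measure_nonneg[of M] by (auto simp: s_def less_le)
    have "- ln s \<le> inverse s"
      using ln_le_minus_one[of "inverse s"] s(1) by (simp add: ln_inverse)
    then have "s * s * (2 * (- ln s)) \<le> s * s * (2 * inverse s)" using s(1) by (intro mult_left_mono) auto
    also have "\<dots> = 2 * s" using s(1) by simp
    also have "s * s * (2 * (- ln s)) = - (?p * ln ?p)" using s(1) unfolding s(2) by (simp add: ln_mult)
    finally show ?thesis by (simp only: s_def)
  qed simp
  also have "- ((1 - ?p) * ln (1 - ?p)) \<le> ?p"
  proof -
    have pos: "1 - ?p > 0" using small by simp
    have "- ln (1 - ?p) \<le> inverse (1 - ?p) - 1"
      using ln_le_minus_one[of "inverse (1 - ?p)"] pos by (simp add: ln_inverse)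
    then have "(1 - ?p) * (- ln (1 - ?p)) \<le> (1 - ?p) * (inverse (1 - ?p) - 1)"
      using pos by (intro mult_left_mono) auto
    also have "\<dots> = ?p" using pos by (simp add: field_simps)
    finally show ?thesis by simp
  qed
  finally show ?thesis by simp
qed

end

text \<open>
  An invariant probability measure of the map, seen through codes.
\<close>

locale coded_system = intermittent_map \<gamma> + invariant_system \<mu> "intermittent \<gamma>" for \<gamma> and \<mu> :: "real measure" +
  assumes sets_\<mu>: "sets \<mu> = sets unit_borel"
begin

lemma space_\<mu>: "space \<mu> = {0..1}"
  using sets_eq_imp_space_eq[OF sets_\<mu>] by (simp add: space_restrict_space)

lemma sets_\<mu>_iff: "A \<in> events \<longleftrightarrow> A \<subseteq> {0..1} \<and> A \<in> sets borel"
  by (auto simp: sets_\<mu> sets_restrict_space_iff)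

lemma simple_function_right_half: "simple_function \<mu> right_half"
proof -
  have "{1/2..1::real} \<in> events" "{0..<1/2::real} \<in> events"
    unfolding sets_\<mu>_iff by auto
  moreover have "right_half -` {True} \<inter> space \<mu> = {1/2..1}" "right_half -` {False} \<inter> space \<mu> = {0..<1/2}"
    unfolding space_\<mu> right_half_def vimage_def by auto
  ultimately have "right_half -` {b} \<inter> space \<mu> \<in> events" for b
    by (cases b) metis+
  moreover have "finite (right_half ` space \<mu>)" by (rule finite_subset[OF subset_UNIV finite])
  ultimately show ?thesis unfolding simple_function_def by blast
qed

lemma simple_function_code: "simple_function \<mu> (code n)"
  by (rule simple_function_itinerary[OF simple_function_right_half])

definition coded :: "nat \<Rightarrow> bool list set \<Rightarrow> real set" where
  "coded n W = {x \<in> space \<mu>. code n x \<in> W}"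

lemma coded_sets [measurable]: "coded n W \<in> events"
proof -
  have "finite (code n ` space \<mu>)" using simple_function_code by (rule simple_functionD)
  then have "(\<Union>v\<in>code n ` space \<mu> \<inter> W. {x\<in>space \<mu>. code n x = v}) \<in> events"
    using simple_function_fibre[OF simple_function_code] by (intro sets.finite_UN) auto
  also have "(\<Union>v\<in>code n ` space \<mu> \<inter> W. {x\<in>space \<mu>. code n x = v}) = coded n W" by (auto simp: coded_def)
  finally show ?thesis .
qed

lemma take_code: "n \<le> k \<Longrightarrow> take n (code k x) = code n x"
  by (simp add: itinerary_def take_map)

lemma coded_refine:
  assumes "n \<le> k" shows "coded n W = coded k {v. take n v \<in> W}"
  using take_code[OF assms] by (auto simp: coded_def)

text \<open>
  Sets that are unions of cylinders up to small measure. They form a sigma-algebra, and since cylinders shrink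
  to points it is that of all Borel sets (\<open>approximable_borel\<close>).
\<close>

definition approximable :: "real set \<Rightarrow> bool" where
  "approximable A \<longleftrightarrow> A \<in> events \<and> (\<forall>\<epsilon>>0. \<exists>n W. prob (sym_diff A (coded n W)) < \<epsilon>)"

lemma approximableE:
  assumes "approximable A" "\<epsilon> > 0"
  obtains n W where "prob (sym_diff A (coded n W)) < \<epsilon>"
  using assms unfolding approximable_def by blast

lemma approximable_Un:
  assumes "approximable A" "approximable B" shows "approximable (A \<union> B)"
  unfolding approximable_def
proof (intro conjI allI impI)
  have [measurable]: "A \<in> events" "B \<in> events" using assms by (auto simp: approximable_def)
  show "A \<union> B \<in> events" by simp
  fix \<epsilon> :: real assume "\<epsilon> > 0"
  then have "\<epsilon> / 2 > 0" by simp
  obtain n W where nW: "prob (sym_diff A (coded n W)) < \<epsilon> / 2"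
    by (rule approximableE[OF assms(1) \<open>\<epsilon> / 2 > 0\<close>])
  obtain k V where kV: "prob (sym_diff B (coded k V)) < \<epsilon> / 2"
    by (rule approximableE[OF assms(2) \<open>\<epsilon> / 2 > 0\<close>])
  let ?l = "max n k"
  have "coded n W \<union> coded k V = coded ?l ({v. take n v \<in> W} \<union> {v. take k v \<in> V})"
    by (subst coded_refine[of n ?l W], simp, subst coded_refine[of k ?l V], simp) (auto simp: coded_def)
  moreover have "prob (sym_diff (A \<union> B) (coded n W \<union> coded k V))
      \<le> prob (sym_diff A (coded n W) \<union> sym_diff B (coded k V))"
    by (intro finite_measure_mono) auto
  moreover have "\<dots> \<le> prob (sym_diff A (coded n W)) + prob (sym_diff B (coded k V))"
    by (intro measure_Un_le) auto
  ultimately have "prob (sym_diff (A \<union> B) (coded ?l ({v. take n v \<in> W} \<union> {v. take k v \<in> V}))) < \<epsilon>"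
    using nW kV by simp
  then show "\<exists>n W. prob (sym_diff (A \<union> B) (coded n W)) < \<epsilon>" by blast
qed

lemma approximable_limit:
  assumes A: "A \<in> events"
    and B: "\<And>\<epsilon>. \<epsilon> > 0 \<Longrightarrow> \<exists>B. approximable B \<and> prob (sym_diff A B) < \<epsilon>"
  shows "approximable A"
  unfolding approximable_def
proof (intro conjI allI impI A)
  fix \<epsilon> :: real assume "\<epsilon> > 0"
  then have e: "\<epsilon> / 2 > 0" by simp
  obtain B where B: "approximable B" "prob (sym_diff A B) < \<epsilon> / 2" using B[OF e] by blast
  obtain n W where nW: "prob (sym_diff B (coded n W)) < \<epsilon> / 2"
    by (rule approximableE[OF B(1) e])
  have [measurable]: "B \<in> events" "A \<in> events" using B A by (auto simp: approximable_def)
  have "prob (sym_diff A (coded n W)) \<le> prob (sym_diff A B \<union> sym_diff B (coded n W))"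
    by (intro finite_measure_mono) auto
  also have "\<dots> \<le> prob (sym_diff A B) + prob (sym_diff B (coded n W))"
    by (intro measure_Un_le) auto
  finally show "\<exists>n W. prob (sym_diff A (coded n W)) < \<epsilon>" using B nW by (intro exI[of _ n] exI[of _ W]) simp
qed

text \<open>
  The union of the cylinders that meet \<open>[0,a]\<close> exceeds \<open>[0,a]\<close> by at most one cylinder, which lies in a short
  interval to the right of \<open>a\<close>.
\<close>

lemma approximable_atMost: "approximable ({..a} \<inter> {0..1})"
  unfolding approximable_def
proof (intro conjI allI impI)
  show A: "{..a} \<inter> {0..1} \<in> events" by (simp add: sets_\<mu>_iff)
  fix \<epsilon> :: real assume \<epsilon>: "\<epsilon> > 0"
  let ?D = "\<lambda>j. {a<..a + 1 / real (Suc j)} \<inter> {0..1}"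
  have D: "?D j \<in> events" for j by (simp add: sets_\<mu>_iff)
  have "(\<lambda>j. prob (?D j)) \<longlonglongrightarrow> prob (\<Inter>j. ?D j)"
  proof (rule finite_Lim_measure_decseq)
    show "decseq ?D"
    proof (rule decseq_SucI)
      fix j
      have "1 / real (Suc (Suc j)) \<le> 1 / real (Suc j)" by (intro divide_left_mono) auto
      then show "?D (Suc j) \<subseteq> ?D j" by fastforce
    qed
  qed (use D in auto)
  also have "(\<Inter>j. ?D j) = {}"
  proof (rule ccontr)
    assume "(\<Inter>j. ?D j) \<noteq> {}"
    then obtain x where x: "\<And>j. x \<in> ?D j" by blast
    have "x - a > 0" using x[of 0] by simp
    then obtain j where "inverse (real (Suc j)) < x - a" using reals_Archimedean by blast
    then show False using x[of j] by (simp add: inverse_eq_divide)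
  qed
  finally have "(\<lambda>j. prob (?D j)) \<longlonglongrightarrow> 0" by simp
  then have "eventually (\<lambda>j. prob (?D j) < \<epsilon>) sequentially" using \<epsilon> by (rule order_tendstoD)
  then obtain j where j: "prob (?D j) < \<epsilon>" by (auto simp: eventually_sequentially)
  obtain N where N: "\<And>n x y. n \<ge> N \<Longrightarrow> x \<in> {0..1} \<Longrightarrow> y \<in> {0..1} \<Longrightarrow> code n x = code n y
      \<Longrightarrow> \<bar>x - y\<bar> < 1 / real (Suc j)"
    by (rule code_diameter[of "1 / real (Suc j)"], simp, rule that)
  let ?A = "{..a} \<inter> {0..1}"
  have "sym_diff ?A (coded N (code N ` ?A)) \<subseteq> ?D j"
  proof
    fix x assume x: "x \<in> sym_diff ?A (coded N (code N ` ?A))"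
    have "x \<in> coded N (code N ` ?A) - ?A"
      using x by (auto simp: coded_def space_\<mu>)
    then obtain y where y: "y \<in> ?A" "code N x = code N y" "x \<in> {0..1}" "x \<notin> ?A"
      unfolding coded_def space_\<mu> by blast
    then have "\<bar>x - y\<bar> < 1 / real (Suc j)" by (intro N[OF order_refl]) auto
    then show "x \<in> ?D j" using y by auto
  qed
  then have "prob (sym_diff ?A (coded N (code N ` ?A))) \<le> prob (?D j)"
    using D by (intro finite_measure_mono) auto
  then show "\<exists>n W. prob (sym_diff ?A (coded n W)) < \<epsilon>" using j by (meson le_less_trans)
qed

lemma approximable_borel:
  assumes "B \<in> sets borel" shows "approximable (B \<inter> {0..1})"
proof -
  have "B \<in> sigma_sets UNIV (range (\<lambda>a::real. {..a}))"
    using assms unfolding borel_eq_atMost by simp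
  then show ?thesis
  proof (induction rule: sigma_sets.induct)
    case (Basic A)
    then show ?case using approximable_atMost by auto
  next
    case Empty
    have "prob (sym_diff {} (coded 0 {})) = 0" by (simp add: coded_def)
    then have "\<exists>n W. prob (sym_diff {} (coded n W)) < \<epsilon>" if "\<epsilon> > 0" for \<epsilon>
      using that by (intro exI[of _ 0] exI[of _ "{}"]) simp
    then show ?case by (simp add: approximable_def)
  next
    case (Compl A)
    have eq: "(UNIV - A) \<inter> {0..1} = space \<mu> - A \<inter> {0..1}" by (auto simp: space_\<mu>)
    have sd: "sym_diff (space \<mu> - A \<inter> {0..1}) (coded n (- W)) = sym_diff (A \<inter> {0..1}) (coded n W)" for n W
      by (auto simp: coded_def space_\<mu>)
    show ?case
      unfolding approximable_def eq
    proof (intro conjI allI impI)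
      show "space \<mu> - A \<inter> {0..1} \<in> events" using Compl by (auto simp: approximable_def)
      fix \<epsilon> :: real assume "\<epsilon> > 0"
      obtain n W where "prob (sym_diff (A \<inter> {0..1}) (coded n W)) < \<epsilon>"
        by (rule approximableE[OF Compl(2) \<open>\<epsilon> > 0\<close>])
      then show "\<exists>n W. prob (sym_diff (space \<mu> - A \<inter> {0..1}) (coded n W)) < \<epsilon>"
        using sd[of n W] by metis
    qed
  next
    case (Union A)
    let ?A = "\<lambda>i. A i \<inter> {0..1}"
    let ?B = "\<lambda>k. \<Union>i\<le>k. ?A i"
    have ev: "?A i \<in> events" for i using Union(2) by (auto simp: approximable_def)
    have B: "approximable (?B k)" for k
    proof (induction k)
      case (Suc k)
      have "?B (Suc k) = ?B k \<union> ?A (Suc k)" by (auto simp: atMost_Suc)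
      then show ?case using approximable_Un[OF Suc Union(2)] by simp
    qed (use Union(2)[of 0] in simp)
    have Bev: "?B k \<in> events" for k using B by (auto simp: approximable_def)
    have U: "(\<Union>i. A i) \<inter> {0..1} = (\<Union>k. ?B k)" by auto
    have Uev: "(\<Union>k. ?B k) \<in> events" using Bev by (intro sets.countable_UN) auto
    have lim: "(\<lambda>k. prob (?B k)) \<longlonglongrightarrow> prob (\<Union>k. ?B k)"
      using Bev by (intro finite_Lim_measure_incseq) (auto simp: incseq_def intro: order_trans)
    show ?case
      unfolding U
    proof (rule approximable_limit[OF Uev])
      fix \<epsilon> :: real assume "\<epsilon> > 0"
      then have "eventually (\<lambda>k. prob (?B k) > prob (\<Union>k. ?B k) - \<epsilon>) sequentially"
        using lim by (intro order_tendstoD) auto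
      then obtain k where k: "prob (?B k) > prob (\<Union>k. ?B k) - \<epsilon>" by (auto simp: eventually_sequentially)
      have "sym_diff (\<Union>k. ?B k) (?B k) = (\<Union>k. ?B k) - ?B k" by blast
      then have "prob (sym_diff (\<Union>k. ?B k) (?B k)) = prob (\<Union>k. ?B k) - prob (?B k)"
        using finite_measure_Diff[OF Uev Bev[of k]] by auto
      then show "\<exists>B. approximable B \<and> prob (sym_diff (\<Union>k. ?B k) B) < \<epsilon>"
        using B[of k] k by (intro exI[of _ "?B k"]) simp
    qed
  qed
qed

text \<open>
  Given a union \<open>B\<close> of cylinders that approximates \<open>A\<close>, the event \<open>A\<close> is determined by \<open>B\<close> and the symmetric
  difference of \<open>A\<close> and \<open>B\<close>. So the conditional entropy of \<open>A\<close> is at most the entropy of an event of small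
  probability.
\<close>

lemma conditional_entropy_event_small:
  assumes A: "A \<in> events" and \<epsilon>: "\<epsilon> > 0"
  shows "\<exists>N. \<forall>n\<ge>N. cond_entropy \<mu> (\<lambda>x. x \<in> A) (code n) \<le> \<epsilon>"
proof -
  \<comment> \<open>Chosen so that the bound \<open>2 sqrt p + p\<close> of \<open>map_entropy_bool_le\<close> is at most \<open>\<epsilon>\<close> for \<open>p \<le> \<delta>\<close>.\<close>
  define \<delta> where "\<delta> = min (1/2) (min (\<epsilon> / 2) ((\<epsilon> / 4)^2))"
  have \<delta>: "\<delta> > 0" "\<delta> \<le> 1/2" "\<delta> \<le> \<epsilon> / 2" "\<delta> \<le> (\<epsilon> / 4)^2" using \<epsilon> by (auto simp: \<delta>_def)
  have "A = A \<inter> {0..1}" using A by (auto simp: sets_\<mu>_iff)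
  then have "approximable A" using approximable_borel[of A] A by (auto simp: sets_\<mu>_iff)
  then obtain N W where NW: "prob (sym_diff A (coded N W)) < \<delta>"
    using \<delta>(1) by (rule approximableE)
  have ind: "simple_function \<mu> (\<lambda>x. x \<in> E)" if "E \<in> events" for E
    using that sets.sets_into_space[OF that]
    by (auto simp: simple_function_def Int_absorb2 vimage_def intro!: finite_subset[OF subset_UNIV])
  let ?a = "\<lambda>x. x \<in> A" and ?b = "\<lambda>x. x \<in> coded N W" and ?d = "\<lambda>x. x \<in> sym_diff A (coded N W)"
  have sf: "simple_function \<mu> ?a" "simple_function \<mu> ?b" "simple_function \<mu> ?d"
    by (rule ind, use A in simp)+
  show ?thesis
  proof (intro exI[of _ N] allI impI)
    fix n assume n: "n \<ge> N"
    have "cond_entropy \<mu> ?a (code n)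
        \<le> map_entropy \<mu> (\<lambda>x. (?a x, ?b x)) - map_entropy \<mu> ?b"
    proof (rule conditional_entropy_antimono[OF sf(1) simple_function_code sf(2)])
      fix x y assume "x \<in> space \<mu>" "y \<in> space \<mu>" "code n x = code n y"
      moreover from this have "code N x = code N y" using n by (auto intro: itinerary_eq_mono)
      ultimately show "?b x = ?b y" by (simp add: coded_def)
    qed
    also have "map_entropy \<mu> (\<lambda>x. (?a x, ?b x)) = map_entropy \<mu> (\<lambda>x. (?d x, ?b x))"
      by (rule map_entropy_cong) (use sf in \<open>auto intro!: simple_function_Pair\<close>)
    also have "\<dots> \<le> map_entropy \<mu> ?d + map_entropy \<mu> ?b"
      by (rule map_entropy_subadditive[OF sf(3,2)])
    finally have "cond_entropy \<mu> ?a (code n) \<le> map_entropy \<mu> ?d" by simp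
    also have "\<dots> \<le> 2 * sqrt \<delta> + \<delta>"
    proof -
      have "sym_diff A (coded N W) \<in> events" using A by auto
      then have eq: "{x\<in>space \<mu>. ?d x} = sym_diff A (coded N W)"
        using sets.sets_into_space by blast
      have "map_entropy \<mu> ?d \<le> 2 * sqrt (prob {x\<in>space \<mu>. ?d x}) + prob {x\<in>space \<mu>. ?d x}"
        by (rule map_entropy_bool_le[OF sf(3)]) (use NW \<delta>(2) eq in simp)
      also have "\<dots> \<le> 2 * sqrt \<delta> + \<delta>" using NW unfolding eq by (intro add_mono mult_left_mono) auto
      finally show ?thesis .
    qed
    also have "\<dots> \<le> 2 * (\<epsilon> / 4) + \<epsilon> / 2"
    proof -
      have "sqrt \<delta> \<le> sqrt ((\<epsilon> / 4)^2)" using \<delta>(4) by (rule real_sqrt_le_mono)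
      then have "sqrt \<delta> \<le> \<epsilon> / 4" using \<epsilon> by simp
      then show ?thesis using \<delta>(3) by simp
    qed
    finally show "cond_entropy \<mu> ?a (code n) \<le> \<epsilon>" by simp
  qed
qed

text \<open>
  The code is a generator. The map \<open>X\<close> is assembled from the events \<open>X = v\<close> one value at a time.
\<close>

lemma conditional_entropy_small:
  assumes X: "simple_function \<mu> X" and \<epsilon>: "\<epsilon> > 0"
  shows "\<exists>N. \<forall>n\<ge>N. cond_entropy \<mu> X (code n) \<le> \<epsilon>"
proof -
  let ?S = "\<lambda>V x. {v \<in> V. X x = v}"
  have sfS: "simple_function \<mu> (?S V)" for V
    using simple_function_compose[OF X, of "\<lambda>u. {v\<in>V. u = v}"] by (simp add: comp_def)
  have sfv: "simple_function \<mu> (\<lambda>x. X x = v)" for v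
    using simple_function_compose[OF X, of "\<lambda>u. u = v"] by (simp add: comp_def)
  \<comment> \<open>The map \<open>?S V\<close> tells the value of \<open>X\<close> if it lies in \<open>V\<close>, and nothing else.\<close>
  have *: "\<exists>N. \<forall>n\<ge>N. cond_entropy \<mu> (?S V) (code n) \<le> \<epsilon>"
    if "finite V" "\<epsilon> > 0" for V \<epsilon>
    using that
  proof (induction V arbitrary: \<epsilon> rule: finite_induct)
    case empty
    have "map_entropy \<mu> (\<lambda>x. (?S {} x, code n x)) = map_entropy \<mu> (code n)" for n
      by (rule map_entropy_cong) (auto intro!: simple_function_Pair simple_function_code)
    then show ?case using empty by auto
  next
    case (insert v V)
    have e: "\<epsilon> / 2 > 0" using insert by simp
    obtain N where N: "\<And>n. n \<ge> N \<Longrightarrow> cond_entropy \<mu> (?S V) (code n) \<le> \<epsilon> / 2"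
      using insert.IH[OF e] by blast
    obtain K where K: "\<And>n. n \<ge> K \<Longrightarrow>
        cond_entropy \<mu> (\<lambda>x. x \<in> {x\<in>space \<mu>. X x = v}) (code n) \<le> \<epsilon> / 2"
      using conditional_entropy_event_small[OF simple_function_fibre[OF X] e] by blast
    show ?case
    proof (intro exI[of _ "max N K"] allI impI)
      fix n assume n: "max N K \<le> n"
      have sv: "simple_function \<mu> (\<lambda>x. x \<in> {x\<in>space \<mu>. X x = v})"
        using sfv[of v] by (rule simple_function_cong[THEN iffD1, rotated]) simp
      have "map_entropy \<mu> (\<lambda>x. (?S (insert v V) x, code n x))
          \<le> map_entropy \<mu> (\<lambda>x. ((?S V x, x \<in> {x\<in>space \<mu>. X x = v}), code n x))"
      proof (rule map_entropy_mono)
        fix x y assume xy: "x \<in> space \<mu>" "y \<in> space \<mu>"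
          "((?S V x, x \<in> {x\<in>space \<mu>. X x = v}), code n x) = ((?S V y, y \<in> {x\<in>space \<mu>. X x = v}), code n y)"
        then have "X x = v \<longleftrightarrow> X y = v" "?S V x = ?S V y" "code n x = code n y" by simp_all
        moreover from this have "?S (insert v V) x = ?S (insert v V) y" by blast
        ultimately show "(?S (insert v V) x, code n x) = (?S (insert v V) y, code n y)" by simp
      qed (intro simple_function_Pair sfS sv simple_function_code)+
      moreover have "cond_entropy \<mu> (\<lambda>x. (?S V x, x \<in> {x\<in>space \<mu>. X x = v})) (code n)
         \<le> cond_entropy \<mu> (?S V) (code n)
          + cond_entropy \<mu> (\<lambda>x. x \<in> {x\<in>space \<mu>. X x = v}) (code n)"
        by (rule conditional_entropy_subadditive[OF sfS sv simple_function_code])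
      ultimately show "cond_entropy \<mu> (?S (insert v V)) (code n) \<le> \<epsilon>"
        using N[of n] K[of n] n by simp
    qed
  qed
  have eq: "map_entropy \<mu> (\<lambda>x. (?S (X ` space \<mu>) x, code n x)) = map_entropy \<mu> (\<lambda>x. (X x, code n x))" for n
    by (rule map_entropy_cong) (use sfS X simple_function_code in \<open>auto intro!: simple_function_Pair\<close>)
  show ?thesis using *[OF simple_functionD(1)[OF X] \<epsilon>] unfolding eq .
qed

end

section \<open>Lower bounds for the mass of the surviving set\<close>

lemma liminf_ge_of_exponential_bound:
  fixes M c :: "nat \<Rightarrow> real"
  assumes c: "c \<longlonglongrightarrow> h"
    and bound: "\<And>\<epsilon>. \<epsilon> > 0 \<Longrightarrow> \<exists>C. \<forall>k. M k > 0 \<and> ln (M k) \<ge> real k * (c k - \<epsilon>) - C"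
  shows "ereal h \<le> liminf (\<lambda>k. ereal (1 / real k) * ln_ereal (M k))"
proof (rule ereal_le_epsilon2)
  fix \<epsilon> :: real assume "\<epsilon> > 0"
  from bound[OF this] obtain C where C: "\<And>k. M k > 0" "\<And>k. ln (M k) \<ge> real k * (c k - \<epsilon>) - C"
    by blast
  have "(\<lambda>k. c k - \<epsilon> - C / real k) \<longlonglongrightarrow> h - \<epsilon> - 0"
    by (intro tendsto_diff c tendsto_const tendsto_divide_0[OF tendsto_const]
        filterlim_at_top_imp_at_infinity filterlim_real_sequentially)
  then have "(\<lambda>k. ereal (c k - \<epsilon> - C / real k)) \<longlonglongrightarrow> ereal (h - \<epsilon>)" by simp
  then have "ereal (h - \<epsilon>) = liminf (\<lambda>k. ereal (c k - \<epsilon> - C / real k))"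
    by (intro lim_imp_Liminf[symmetric]) auto
  also have "\<dots> \<le> liminf (\<lambda>k. ereal (1 / real k) * ln_ereal (M k))"
  proof (rule Liminf_mono)
    show "eventually (\<lambda>k. ereal (c k - \<epsilon> - C / real k) \<le> ereal (1 / real k) * ln_ereal (M k)) sequentially"
      using eventually_gt_at_top[of 0]
    proof eventually_elim
      case (elim k)
      have "c k - \<epsilon> - C / real k = (1 / real k) * (real k * (c k - \<epsilon>) - C)"
        using elim by (simp add: field_simps)
      also have "\<dots> \<le> (1 / real k) * ln (M k)" using C(2)[of k] by (intro mult_left_mono) auto
      finally show ?case using C(1)[of k] by (simp add: ln_ereal_def)
    qed
  qed
  finally show "ereal h \<le> liminf (\<lambda>k. ereal (1 / real k) * ln_ereal (M k)) + ereal \<epsilon>"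
    by (cases "liminf (\<lambda>k. ereal (1 / real k) * ln_ereal (M k))") auto
qed

context coded_system begin

lemma log_deriv_integrable: "integrable \<mu> log_deriv"
proof (rule integrable_const_bound[of _ "ln 3"])
  show "AE x in \<mu>. norm (log_deriv x) \<le> ln 3"
    using log_deriv_nonneg log_deriv_le by (intro AE_I2) (simp add: space_\<mu>)
  show "log_deriv \<in> borel_measurable \<mu>"
    using measurable_restrict_space1[OF log_deriv_measurable, of "{0..1}"] measurable_cong_sets[OF sets_\<mu> refl]
    by blast
qed

lemma log_deriv_measurable_\<mu> [measurable]: "log_deriv \<in> borel_measurable \<mu>"
  using log_deriv_integrable by auto

lemma integral_birkhoff_log_deriv:
  "integrable \<mu> (\<lambda>x. birkhoff n x)"
  "(\<integral>x. birkhoff n x \<partial>\<mu>) = real n * (\<integral>x. log_deriv x \<partial>\<mu>)"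
proof -
  have i: "integrable \<mu> (\<lambda>x. log_deriv ((f ^^ k) x))" for k
    using integrable_distr[OF T_funpow[of k], where f = log_deriv] log_deriv_integrable by (simp add: distr_funpow)
  then show "integrable \<mu> (\<lambda>x. birkhoff n x)" by simp
  show "(\<integral>x. birkhoff n x \<partial>\<mu>) = real n * (\<integral>x. log_deriv x \<partial>\<mu>)"
    using i by (simp add: integral_funpow)
qed

text \<open>
  The Kolmogorov-Sinai theorem in quantitative form: up to \<open>\<epsilon>\<close> per step, the entropy of any finite partition is
  bounded by that of the codes. The length \<open>N\<close> may be enlarged at will, so that it can be matched with the word
  length at which the hole becomes a union of cylinders.
\<close>

lemma itinerary_entropy_le_code:
  assumes \<xi>: "finite_measurable_partition \<mu> \<xi>" and \<epsilon>: "\<epsilon> > 0"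
  shows "\<exists>N0. \<forall>N\<ge>N0. \<forall>k. map_entropy \<mu> (itinerary f (cell \<xi>) k) \<le> map_entropy \<mu> (code (k + N)) + real k * \<epsilon>"
proof -
  have X: "simple_function \<mu> (cell \<xi>)" by (rule simple_function_cell[OF \<xi>])
  obtain N0 where N0: "\<And>n. n \<ge> N0 \<Longrightarrow>
      cond_entropy \<mu> (cell \<xi>) (code n) \<le> \<epsilon>"
    using conditional_entropy_small[OF X \<epsilon>] by blast
  show ?thesis
  proof (intro exI[of _ N0] allI impI)
    fix N k assume N: "N \<ge> N0"
    have "map_entropy \<mu> (itinerary f (cell \<xi>) k) \<le> map_entropy \<mu> (itinerary f (code N) k)
        + real k * cond_entropy \<mu> (cell \<xi>) (code N)"
      by (rule itinerary_entropy_le[OF X simple_function_code])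
    moreover have "real k * cond_entropy \<mu> (cell \<xi>) (code N) \<le> real k * \<epsilon>"
      using N0[OF N] by (intro mult_left_mono) auto
    moreover have "map_entropy \<mu> (itinerary f (code N) k) \<le> map_entropy \<mu> (code (k + N))"
    proof (rule map_entropy_mono[OF simple_function_itinerary[OF simple_function_code] simple_function_code])
      fix x y assume xy: "code (k + N) x = code (k + N) y"
      show "itinerary f (code N) k x = itinerary f (code N) k y"
        unfolding itinerary_eq_iff
      proof (intro allI impI)
        fix i j assume "i < k" "j < N"
        have "right_half ((f ^^ (j + i)) x) \<longleftrightarrow> right_half ((f ^^ (j + i)) y)"
          using code_right_half[OF xy, of "j + i"] \<open>i < k\<close> \<open>j < N\<close> by simp
        then show "right_half ((f ^^ j) ((f ^^ i) x)) \<longleftrightarrow> right_half ((f ^^ j) ((f ^^ i) y))"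
          by (simp add: funpow_add)
      qed
    qed
    ultimately show "map_entropy \<mu> (itinerary f (cell \<xi>) k) \<le> map_entropy \<mu> (code (k + N)) + real k * \<epsilon>"
      by linarith
  qed
qed

text \<open>
  If the cylinder of \<open>u\<close> lay in \<open>half_open H\<close>, then the points with code \<open>u\<close> would lie in three null sets: the
  hole, the finitely many points by which \<open>half_open H\<close> exceeds it, and the countably many points whose orbit
  meets \<open>0\<close> or \<open>1\<close>. The last two are null for want of atoms.
\<close>

lemma charged_word_avoids_hole:
  assumes atomless: "\<And>x. prob {x} = 0" and hole: "markov_hole \<gamma> N0 H" and null: "prob (H \<inter> {0..1}) = 0"
    and dich: "cyl u \<subseteq> half_open H \<or> cyl u \<inter> H = {}"
    and pos: "prob {x\<in>space \<mu>. code (length u) x = u} > 0"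
  shows "cyl u \<inter> H = {}"
proof (rule ccontr)
  assume "cyl u \<inter> H \<noteq> {}"
  then have sub: "cyl u \<subseteq> half_open H" using dich by blast
  obtain \<I> where \<I>: "finite \<I>" "\<And>I. I \<in> \<I> \<Longrightarrow> is_interval I \<and> interior I \<noteq> {}" "H = \<Union>\<I>"
    using hole unfolding markov_hole_def by metis
  have sing: "{x} \<in> events" if "x \<in> {0..1}" for x using that by (simp add: sets_\<mu>_iff)
  define B where "B = (\<Union>k. {x\<in>space \<mu>. (f ^^ k) x \<in> {0, 1}})"
  define D where "D = (half_open H - H) \<inter> {0..1}"
  have D: "D \<in> null_sets \<mu>"
  proof -
    have "finite D" unfolding D_def using finite_half_open_diff[OF \<I>] by simp
    moreover have "{x} \<in> null_sets \<mu>" if "x \<in> D" for x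
      using atomless[of x] sing[of x] that by (auto simp: D_def null_sets_def emeasure_eq_measure)
    ultimately have "(\<Union>x\<in>D. {x}) \<in> null_sets \<mu>" by (intro null_sets.finite_UN) auto
    then show ?thesis by simp
  qed
  have B: "B \<in> null_sets \<mu>"
  proof -
    have e: "{0, 1} \<in> events" by (simp add: sets_\<mu>_iff)
    have "prob {0, 1} \<le> prob {0} + prob {1}"
      using measure_Un_le[of "{0}" \<mu> "{1}"] sing[of 0] sing[of 1] by (simp add: insert_commute)
    then have z: "prob {0, 1} = 0" using atomless[of 0] atomless[of 1] measure_nonneg[of \<mu> "{0, 1}"] by linarith
    have "{x\<in>space \<mu>. (f ^^ k) x \<in> {0, 1}} \<in> null_sets \<mu>" for k
    proof -
      have "{x\<in>space \<mu>. (f ^^ k) x \<in> {0, 1}} = (f ^^ k) -` {0, 1} \<inter> space \<mu>" by auto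
      then have "{x\<in>space \<mu>. (f ^^ k) x \<in> {0, 1}} \<in> events"
        using measurable_sets[OF T_funpow e] by simp
      then show ?thesis using prob_vimage_funpow[OF e, of k] z
        by (simp add: null_sets_def emeasure_eq_measure)
    qed
    then show ?thesis unfolding B_def by (intro null_sets_UN)
  qed
  have Hn: "H \<inter> {0..1} \<in> null_sets \<mu>"
    using null hole_borel[OF hole] by (simp add: null_sets_def emeasure_eq_measure sets_\<mu>_iff)
  have "{x\<in>space \<mu>. code (length u) x = u} \<subseteq> B \<union> D \<union> (H \<inter> {0..1})"
  proof
    fix x assume x: "x \<in> {x\<in>space \<mu>. code (length u) x = u}"
    then have I: "x \<in> {0..1}" by (simp add: space_\<mu>)
    show "x \<in> B \<union> D \<union> (H \<inter> {0..1})"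
    proof (cases "x \<in> B")
      case False
      then have "x \<in> cyl (code (length u) x)"
        using x by (intro code_in_cyl[OF I]) (auto simp: B_def)
      then have "x \<in> half_open H" using x sub by auto
      then show ?thesis using I by (auto simp: D_def)
    qed simp
  qed
  then have "prob {x\<in>space \<mu>. code (length u) x = u} \<le> prob (B \<union> D \<union> (H \<inter> {0..1}))"
    using B D Hn by (intro finite_measure_mono) auto
  moreover have "B \<union> D \<union> (H \<inter> {0..1}) \<in> null_sets \<mu>" using B D Hn by auto
  then have "prob (B \<union> D \<union> (H \<inter> {0..1})) = 0" by (simp add: null_sets_def emeasure_eq_measure)
  ultimately show False using pos by simp
qed

end

context intermittent_conformal begin

lemma sum_cyl_le_survivors:
  assumes hole: "markov_hole \<gamma> N0 H"
    and V: "finite V" "\<And>w. w \<in> V \<Longrightarrow> length w = k + N"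
      "\<And>w i. w \<in> V \<Longrightarrow> i \<le> k \<Longrightarrow> cyl (take N (drop i w)) \<inter> H = {}"
  shows "(\<Sum>w\<in>V. measure m (cyl w)) \<le> measure m (survivors \<gamma> H k)"
proof -
  have "(\<Sum>w\<in>V. measure m (cyl w)) = measure m (\<Union>w\<in>V. cyl w)"
  proof (rule finite_measure_finite_Union[symmetric, OF V(1)])
    show "cyl ` V \<subseteq> events" using cyl_sets by (auto simp: sets_m)
    show "disjoint_family_on cyl V"
      unfolding disjoint_family_on_def
    proof (intro ballI impI)
      fix v w assume vw: "v \<in> V" "w \<in> V" "v \<noteq> w"
      have "v = w" if "x \<in> cyl v" "x \<in> cyl w" for x
        using cyl_code[OF that(1)] cyl_code[OF that(2)] V(2)[OF vw(1)] V(2)[OF vw(2)] by simp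
      then show "cyl v \<inter> cyl w = {}" using vw(3) by blast
    qed
  qed
  also have "\<dots> \<le> measure m (survivors \<gamma> H k)"
  proof (rule finite_measure_mono)
    show "(\<Union>w\<in>V. cyl w) \<subseteq> survivors \<gamma> H k"
      using cyl_subset_survivors[OF V(2) V(3)] by blast
    show "survivors \<gamma> H k \<in> events" using survivors_sets[OF hole] by (simp add: sets_m)
  qed
  finally show ?thesis .
qed

text \<open>
  The word of zeros is the code of the fixed point \<open>0\<close>, where \<open>log f'\<close> vanishes along the orbit.
\<close>

lemma survivors_ge_neutral:
  assumes hole: "markov_hole \<gamma> N0 H" and ns: "non_swallowing \<gamma> N0 H"
    and mass: "measure m {0<..<1} > 0" and \<epsilon>: "\<epsilon> > 0"
  shows "\<exists>C. \<forall>k. measure m (survivors \<gamma> H k) > 0 \<and>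
    ln (measure m (survivors \<gamma> H k)) \<ge> real k * (- p - \<epsilon>) - C"
proof -
  obtain K where K: "K \<ge> 0"
    "\<And>n x. x \<in> {0..1} \<Longrightarrow> measure m (cyl (code n x)) \<ge>
      exp (- t * birkhoff n x - real n * (p + \<epsilon>) - K) * measure m {0<..<1}"
    by (rule measure_cyl_ge[OF \<epsilon>], rule that)
  obtain N where N: "\<And>w. N \<le> length w \<Longrightarrow> cyl w \<subseteq> half_open H \<or> cyl w \<inter> H = {}"
    using cyl_hole_dichotomy[OF hole] by blast
  have zero: "cyl (replicate N False) \<inter> H = {}"
    by (rule zero_cyl_avoids_hole[OF ns N]) simp
  show ?thesis
  proof (intro exI allI)
    fix k
    let ?w = "replicate (k + N) False"
    have code0: "code n 0 = replicate n False" for n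
      by (rule nth_equalityI) (auto simp: itinerary_def right_half_def)
    have "(\<Sum>w\<in>{?w}. measure m (cyl w)) \<le> measure m (survivors \<gamma> H k)"
      by (rule sum_cyl_le_survivors[OF hole, where N = N]) (use zero in \<open>auto simp: drop_replicate take_replicate min_def\<close>)
    then have "measure m (survivors \<gamma> H k) \<ge> exp (- (real (k + N) * (p + \<epsilon>)) - K) * measure m {0<..<1}"
      using K(2)[of 0 "k + N"] by (simp add: code0)
    moreover have pos: "exp (- (real (k + N) * (p + \<epsilon>)) - K) * measure m {0<..<1} > 0"
      using mass by simp
    ultimately have 1: "measure m (survivors \<gamma> H k) > 0" "ln (measure m (survivors \<gamma> H k)) \<ge>
        ln (exp (- (real (k + N) * (p + \<epsilon>)) - K) * measure m {0<..<1})"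
      by auto
    have "ln (exp (- (real (k + N) * (p + \<epsilon>)) - K) * measure m {0<..<1})
        = real k * (- p - \<epsilon>) - (real N * (p + \<epsilon>) + K - ln (measure m {0<..<1}))"
      using mass by (simp add: ln_mult algebra_simps)
    with 1 show "measure m (survivors \<gamma> H k) > 0 \<and>
      ln (measure m (survivors \<gamma> H k)) \<ge> real k * (- p - \<epsilon>) - (real N * (p + \<epsilon>) + K - ln (measure m {0<..<1}))"
      by simp
  qed
qed

text \<open>
  Words of length \<open>k + N\<close> are needed to decide survival up to time \<open>k\<close>, since \<open>N\<close> symbols are read at each time.
  The three error terms, from distortion within a cylinder, from the mass estimate and from the generator, are
  each allowed a third of \<open>\<epsilon>\<close> per step.
\<close>

lemma survivors_ge_entropy:
  assumes hole: "markov_hole \<gamma> N0 H" and mass: "measure m {0<..<1} > 0" and \<epsilon>: "\<epsilon> > 0"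
    and cs: "coded_system \<gamma> \<mu>" and atomless: "\<And>x. measure \<mu> {x} = 0"
    and null: "measure \<mu> (H \<inter> {0..1}) = 0" and \<xi>: "finite_measurable_partition \<mu> \<xi>"
  shows "\<exists>C. \<forall>k. measure m (survivors \<gamma> H k) > 0 \<and>
    ln (measure m (survivors \<gamma> H k)) \<ge>
      map_entropy \<mu> (itinerary f (cell \<xi>) k) + real k * (- t * (\<integral>x. log_deriv x \<partial>\<mu>) - p - \<epsilon>) - C"
proof -
  interpret \<mu>: coded_system \<gamma> \<mu> by (rule cs)
  define lyap where "lyap = (\<integral>x. log_deriv x \<partial>\<mu>)"
  define \<eta> where "\<eta> = \<epsilon> / 3"
  have \<eta>: "\<eta> > 0" using \<epsilon> by (simp add: \<eta>_def)
  obtain K1 where K1: "K1 \<ge> 0"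
    "\<And>n x y. x \<in> {0..1} \<Longrightarrow> y \<in> {0..1} \<Longrightarrow> code n x = code n y \<Longrightarrow>
      birkhoff n y \<le> birkhoff n x + real n * \<eta> + K1"
    by (rule birkhoff_distortion[OF \<eta>], rule that)
  obtain K2 where K2: "K2 \<ge> 0"
    "\<And>n x. x \<in> {0..1} \<Longrightarrow> measure m (cyl (code n x)) \<ge>
      exp (- t * birkhoff n x - real n * (p + \<eta>) - K2) * measure m {0<..<1}"
    by (rule measure_cyl_ge[OF \<eta>], rule that)
  obtain N1 where N1: "\<And>w. N1 \<le> length w \<Longrightarrow> cyl w \<subseteq> half_open H \<or> cyl w \<inter> H = {}"
    using cyl_hole_dichotomy[OF hole] by blast
  obtain N2 where N2: "\<And>N k. N \<ge> N2 \<Longrightarrow>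
      map_entropy \<mu> (itinerary f (cell \<xi>) k) \<le> map_entropy \<mu> (code (k + N)) + real k * \<eta>"
    using \<mu>.itinerary_entropy_le_code[OF \<xi> \<eta>] by blast
  define N where "N = max N1 N2"
  define C where "C = real N * (t * lyap + p + 2 * \<eta>) + K1 + K2 - ln (measure m {0<..<1})"
  show ?thesis
  proof (intro exI allI)
    fix k
    define n where "n = k + N"
    define V where "V = code n ` {0..1} \<inter> {w. \<forall>i\<le>k. cyl (take N (drop i w)) \<inter> H = {}}"
    \<comment> \<open>The weight of a word is the Birkhoff sum at one point with this code; by distortion the choice of the point
      does not matter.\<close>
    define rep where "rep w = (SOME x. x \<in> {0..1} \<and> code n x = w)" for w
    define S where "S x = birkhoff n x" for x
    have rep: "rep (code n x) \<in> {0..1}" "code n (rep (code n x)) = code n x" if "x \<in> {0..1}" for x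
      using someI[of "\<lambda>y. y \<in> {0..1} \<and> code n y = code n x" x] that by (simp_all add: rep_def)
    have sf: "simple_function \<mu> (code n)" by (rule \<mu>.simple_function_code)
    have finV: "finite V"
      using simple_functionD(1)[OF sf] by (auto simp: V_def \<mu>.space_\<mu>)
    have supp: "v \<in> V" if v: "v \<in> code n ` space \<mu>" "measure \<mu> {x\<in>space \<mu>. code n x = v} > 0" for v
    proof -
      have lv: "length v = n" using v(1) by auto
      have "cyl (take N (drop i v)) \<inter> H = {}" if i: "i \<le> k" for i
      proof (rule \<mu>.charged_word_avoids_hole[OF atomless hole null])
        have lu: "length (take N (drop i v)) = N" using lv i by (simp add: n_def)
        show "cyl (take N (drop i v)) \<subseteq> half_open H \<or> cyl (take N (drop i v)) \<inter> H = {}"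
          by (rule N1) (simp only: lu, simp add: N_def)
        let ?E = "{y\<in>space \<mu>. code N y = take N (drop i v)}"
        have ev: "?E \<in> sets \<mu>"
          by (rule simple_function_fibre[OF \<mu>.simple_function_code])
        have "measure \<mu> {x\<in>space \<mu>. code n x = v}
            \<le> measure \<mu> {x\<in>space \<mu>. (f ^^ i) x \<in> ?E}"
        proof (rule \<mu>.finite_measure_mono)
          show "{x\<in>space \<mu>. code n x = v} \<subseteq> {x\<in>space \<mu>. (f ^^ i) x \<in> ?E}"
          proof
            fix x assume x: "x \<in> {x\<in>space \<mu>. code n x = v}"
            have "take N (drop i v) = take N (code (n - i) ((f ^^ i) x))"
              using x drop_code[of i n x] i by (auto simp: n_def)
            also have "\<dots> = code N ((f ^^ i) x)" using i by (intro \<mu>.take_code) (simp add: n_def)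
            finally show "x \<in> {x\<in>space \<mu>. (f ^^ i) x \<in> ?E}"
              using x \<mu>.funpow_space[of x i] by simp
          qed
          have "{x\<in>space \<mu>. (f ^^ i) x \<in> ?E}
              = (f ^^ i) -` ?E \<inter> space \<mu>" by auto
          then show "{x\<in>space \<mu>. (f ^^ i) x \<in> ?E} \<in> sets \<mu>"
            using measurable_sets[OF \<mu>.T_funpow ev] by simp
        qed
        also have "\<dots> = measure \<mu> ?E"
          by (rule \<mu>.prob_vimage_funpow[OF ev])
        finally show "0 < measure \<mu> {x\<in>space \<mu>. code (length (take N (drop i v))) x = take N (drop i v)}"
          using v(2) unfolding lu by linarith
      qed
      then show ?thesis using v(1) by (simp add: V_def \<mu>.space_\<mu>)
    qed
    have "V \<noteq> {}" by (rule \<mu>.essential_range_nonempty[OF sf supp])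
    define Z where "Z = (\<Sum>w\<in>V. exp (- t * S (rep w)))"
    have Z: "Z > 0" unfolding Z_def using finV \<open>V \<noteq> {}\<close> by (intro sum_pos) auto
    have gibbs: "map_entropy \<mu> (code n) + (\<integral>x. - t * S (rep (code n x)) \<partial>\<mu>) \<le> ln Z"
      unfolding Z_def by (rule \<mu>.map_entropy_gibbs[OF sf finV supp])
    have pot: "(\<integral>x. - t * S (rep (code n x)) \<partial>\<mu>) \<ge> - t * (real n * lyap) - real n * \<eta> - K1"
    proof -
      have iS: "integrable \<mu> S" "(\<integral>x. S x \<partial>\<mu>) = real n * lyap"
        using \<mu>.integral_birkhoff_log_deriv[of n] by (simp_all add: S_def[abs_def] lyap_def)
      have "- t * (real n * lyap) - real n * \<eta> - K1 = (\<integral>x. - t * S x - (real n * \<eta> + K1) \<partial>\<mu>)"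
        using iS by (simp add: \<mu>.prob_space)
      also have "\<dots> \<le> (\<integral>x. - t * S (rep (code n x)) \<partial>\<mu>)"
      proof (rule integral_mono)
        show "integrable \<mu> (\<lambda>x. - t * S x - (real n * \<eta> + K1))" using iS(1) by simp
        show "integrable \<mu> (\<lambda>x. - t * S (rep (code n x)))"
          using simple_function_compose[OF sf, of "\<lambda>w. - t * S (rep w)"]
          by (intro \<mu>.simple_integrable) (simp add: comp_def)
        fix x assume "x \<in> space \<mu>"
        then have x: "x \<in> {0..1}" by (simp add: \<mu>.space_\<mu>)
        have "S (rep (code n x)) \<le> S x + (real n * \<eta> + K1)"
          using K1(2)[OF x rep(1)[OF x] rep(2)[OF x, symmetric]] by (simp add: S_def)
        then have "t * S (rep (code n x)) \<le> t * S x + t * (real n * \<eta> + K1)"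
          using t mult_left_mono[of "S (rep (code n x))" "S x + (real n * \<eta> + K1)" t]
          by (simp add: distrib_left)
        also have "t * (real n * \<eta> + K1) \<le> 1 * (real n * \<eta> + K1)"
          using t \<eta> K1(1) by (intro mult_right_mono) auto
        finally show "- t * S x - (real n * \<eta> + K1) \<le> - t * S (rep (code n x))" by simp
      qed
      finally show ?thesis .
    qed
    define E where "E = exp (- real n * (p + \<eta>) - K2) * measure m {0<..<1}"
    have E: "E > 0" using mass by (simp add: E_def)
    have "Z * E = (\<Sum>w\<in>V. exp (- t * S (rep w)) * E)" by (simp add: Z_def sum_distrib_right)
    also have "\<dots> \<le> (\<Sum>w\<in>V. measure m (cyl w))"
    proof (rule sum_mono)
      fix w assume "w \<in> V"
      then obtain x where x: "x \<in> {0..1}" "w = code n x" by (auto simp: V_def)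
      have "measure m (cyl (code n (rep w))) \<ge>
          exp (- t * S (rep w) - real n * (p + \<eta>) - K2) * measure m {0<..<1}"
        using K2(2)[of "rep w" n] rep(1)[OF x(1)] x(2) by (simp add: S_def)
      also have "exp (- t * S (rep w) - real n * (p + \<eta>) - K2) * measure m {0<..<1} = exp (- t * S (rep w)) * E"
        by (simp add: E_def exp_add[symmetric] mult.assoc[symmetric] algebra_simps)
      finally show "exp (- t * S (rep w)) * E \<le> measure m (cyl w)" using rep(2)[OF x(1)] x(2) by simp
    qed
    also have "\<dots> \<le> measure m (survivors \<gamma> H k)"
      by (rule sum_cyl_le_survivors[OF hole finV, where N = N]) (auto simp: V_def n_def)
    finally have le: "Z * E \<le> measure m (survivors \<gamma> H k)" .
    have pos: "measure m (survivors \<gamma> H k) > 0" using le mult_pos_pos[OF Z E] by linarith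
    have "ln (Z * E) \<le> ln (measure m (survivors \<gamma> H k))" using le mult_pos_pos[OF Z E] by simp
    moreover have "ln (Z * E) = ln Z - real n * (p + \<eta>) - K2 + ln (measure m {0<..<1})"
      using Z mass by (simp add: ln_mult E_def)
    moreover have "map_entropy \<mu> (itinerary f (cell \<xi>) k) \<le> map_entropy \<mu> (code n) + real k * \<eta>"
      unfolding n_def by (rule N2) (simp add: N_def)
    ultimately have "ln (measure m (survivors \<gamma> H k)) \<ge> map_entropy \<mu> (itinerary f (cell \<xi>) k)
        - real k * \<eta> - t * (real n * lyap) - real n * \<eta> - K1 - real n * (p + \<eta>) - K2 + ln (measure m {0<..<1})"
      using gibbs pot by linarith
    also have "map_entropy \<mu> (itinerary f (cell \<xi>) k)
        - real k * \<eta> - t * (real n * lyap) - real n * \<eta> - K1 - real n * (p + \<eta>) - K2 + ln (measure m {0<..<1})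
      = map_entropy \<mu> (itinerary f (cell \<xi>) k) + real k * (- t * lyap - p - \<epsilon>) - C"
      by (simp add: C_def n_def \<eta>_def algebra_simps)
    finally show "measure m (survivors \<gamma> H k) > 0 \<and>
      ln (measure m (survivors \<gamma> H k)) \<ge>
        map_entropy \<mu> (itinerary f (cell \<xi>) k) + real k * (- t * (\<integral>x. log_deriv x \<partial>\<mu>) - p - \<epsilon>) - C"
      using pos by (simp add: lyap_def)
  qed
qed

end

section \<open>The fair coin measure\<close>

context intermittent_map begin

text \<open>
  The number in \<open>[0,1]\<close> whose binary digits are the symbols of the code. It conjugates \<open>f\<close> to the doubling map,
  and it is the distribution function of the measure under which the symbols are fair coin tosses.
\<close>

definition binary :: "real \<Rightarrow> real" where
  "binary x = (\<Sum>k. of_bool (right_half ((f ^^ k) x)) * (1/2) ^ Suc k)"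

lemma binary_summable: "summable (\<lambda>k. of_bool (right_half ((f ^^ k) x)) * (1/2::real) ^ Suc k)"
  by (rule summable_comparison_test'[OF sums_summable[OF power_half_series], of 0]) auto

lemma binary_bounds: "0 \<le> binary x" "binary x \<le> 1"
proof -
  show "0 \<le> binary x" unfolding binary_def by (intro suminf_nonneg binary_summable) auto
  have "binary x \<le> (\<Sum>k. (1/2) ^ Suc k)"
    unfolding binary_def by (intro suminf_le binary_summable sums_summable[OF power_half_series]) auto
  also have "\<dots> = 1" by (rule sums_unique[OF power_half_series, symmetric])
  finally show "binary x \<le> 1" .
qed

lemma binary_rec: "binary x = (of_bool (right_half x) + binary (f x)) / 2"
proof -
  have "binary x = of_bool (right_half x) / 2
      + (\<Sum>k. of_bool (right_half ((f ^^ Suc k) x)) * (1/2) ^ Suc (Suc k))"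
    using suminf_split_head[OF binary_summable[of x]] unfolding binary_def[of x]
    by (simp del: funpow.simps(2) power_Suc add: power_Suc[of "1/2" 0])
  also have "(\<Sum>k. of_bool (right_half ((f ^^ Suc k) x)) * (1/2::real) ^ Suc (Suc k))
      = (\<Sum>k. (1/2) * (of_bool (right_half ((f ^^ k) (f x))) * (1/2) ^ Suc k))"
    by (intro suminf_cong) (simp add: funpow_swap1)
  also have "\<dots> = (1/2) * binary (f x)" unfolding binary_def by (rule suminf_mult[OF binary_summable])
  finally show ?thesis by simp
qed

lemma binary_0: "binary 0 = 0" and binary_half: "binary (1/2) = 1/2" and binary_1: "binary 1 = 1"
proof -
  show 0: "binary 0 = 0" using binary_rec[of 0] by (simp add: right_half_def)
  show "binary (1/2) = 1/2" using binary_rec[of "1/2"] 0 f_half by (simp add: right_half_def)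
  show "binary 1 = 1" using binary_rec[of 1] by (simp add: right_half_def)
qed

lemma binary_code_close: "code n x = code n y \<Longrightarrow> \<bar>binary x - binary y\<bar> \<le> (1/2) ^ n"
proof (induction n arbitrary: x y)
  case 0
  show ?case using binary_bounds[of x] binary_bounds[of y] by simp
next
  case (Suc n)
  then have "right_half x = right_half y" "code n (f x) = code n (f y)" by (simp_all add: code_Suc)
  then have "binary x - binary y = (binary (f x) - binary (f y)) / 2" "\<bar>binary (f x) - binary (f y)\<bar> \<le> (1/2) ^ n"
    using binary_rec[of x] binary_rec[of y] Suc.IH by (simp_all add: diff_divide_distrib add_divide_distrib)
  then show ?case by (simp only: abs_divide power_Suc) simp
qed

lemma binary_mono:
  assumes "x \<in> {0..1}" "y \<in> {0..1}" "x \<le> y" shows "binary x \<le> binary y"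
proof (rule field_le_epsilon)
  fix \<epsilon> :: real assume "\<epsilon> > 0"
  have step: "binary x \<le> binary y + (1/2) ^ n" if "x \<in> {0..1}" "y \<in> {0..1}" "x \<le> y" for n x y
    using that
  proof (induction n arbitrary: x y)
    case 0
    show ?case using binary_bounds[of x] binary_bounds[of y] by simp
  next
    case (Suc n)
    show ?case
    proof (cases "right_half x \<longleftrightarrow> right_half y")
      case True
      have "f x \<le> f y" by (rule f_mono) (use Suc.prems True in auto)
      then have "binary (f x) \<le> binary (f y) + (1/2) ^ n" using Suc.prems by (intro Suc.IH f_mem)
      then show ?thesis using binary_rec[of x] binary_rec[of y] True by simp
    next
      case False
      then have "\<not> right_half x" "right_half y" using Suc.prems(3) by (auto simp: right_half_def)
      then have "binary x \<le> 1/2" "1/2 \<le> binary y"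
        using binary_rec[of x] binary_rec[of y] binary_bounds[of "f x"] binary_bounds[of "f y"] by simp_all
      then show ?thesis by (simp add: add_increasing2)
    qed
  qed
  obtain n where "(1/2::real) ^ n < \<epsilon>" using real_arch_pow_inv[OF \<open>\<epsilon> > 0\<close>, of "1/2"] by auto
  then show "binary x \<le> binary y + \<epsilon>" using step[OF assms, of n] by simp
qed

lemma f_tendsto_right:
  assumes "0 \<le> x" "x < 1" shows "(f \<longlongrightarrow> f x) (at_right x)"
proof (cases "x < 1/2")
  case True
  have "continuous_on {0..1/2} (\<lambda>x. x * (1 + (2 * x) powr \<gamma>))" by (rule continuous_on_left)
  then have "((\<lambda>x. x * (1 + (2 * x) powr \<gamma>)) \<longlongrightarrow> x * (1 + (2 * x) powr \<gamma>)) (at x within {0..1/2})"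
    using assms True by (simp add: continuous_on_def)
  then have "((\<lambda>x. x * (1 + (2 * x) powr \<gamma>)) \<longlongrightarrow> f x) (at x within {x..1/2})"
    unfolding f_left[OF assms(1) True] by (rule tendsto_within_subset) (use assms in auto)
  then have "((\<lambda>x. x * (1 + (2 * x) powr \<gamma>)) \<longlongrightarrow> f x) (at_right x)"
    using at_within_Icc_at_right[OF True] by simp
  moreover have "eventually (\<lambda>y. y * (1 + (2 * y) powr \<gamma>) = f y) (at_right x)"
    using eventually_at_right_real[OF True] by eventually_elim (use assms f_left in simp)
  ultimately show ?thesis by (rule Lim_transform_eventually)
next
  case False
  have "((\<lambda>y. 2 * y - 1) \<longlongrightarrow> 2 * x - 1) (at_right x)" by (intro tendsto_intros)
  moreover have "eventually (\<lambda>y. 2 * y - 1 = f y) (at_right x)"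
    using eventually_at_right_real[OF assms(2)] by eventually_elim (use False f_right in simp)
  ultimately have "(f \<longlongrightarrow> 2 * x - 1) (at_right x)" by (rule Lim_transform_eventually)
  then show ?thesis using False by (simp add: f_right)
qed

lemma right_half_right_constant:
  assumes "x < 1" shows "eventually (\<lambda>y. right_half y \<longleftrightarrow> right_half x) (at_right x)"
proof (cases "x < 1/2")
  case True
  show ?thesis using eventually_at_right_real[OF True]
    by eventually_elim (use True in \<open>simp add: right_half_def\<close>)
next
  case False
  show ?thesis using eventually_at_right_real[OF assms]
    by eventually_elim (use False in \<open>simp add: right_half_def\<close>)
qed

lemma f_less_1: "0 \<le> x \<Longrightarrow> x < 1 \<Longrightarrow> f x < 1"
  using f_left_le[of x] f_right[of x] by (cases "x < 1/2") auto

text \<open>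
  Branches are closed on the left, so every code is constant on some interval to the right of a point.
  This makes \<open>binary\<close> continuous from the right.
\<close>

lemma code_right_constant:
  assumes "0 \<le> x" "x < 1" shows "eventually (\<lambda>y. code n y = code n x) (at_right x)"
  using assms
proof (induction n arbitrary: x)
  case (Suc n)
  have fx: "0 \<le> f x" "f x < 1" using f_mem[of x] f_less_1[of x] Suc.prems by auto
  have "filterlim f (at_right (f x)) (at_right x)"
    unfolding filterlim_at
  proof (intro conjI f_tendsto_right Suc.prems)
    show "eventually (\<lambda>y. f y \<in> {f x<..} \<and> f y \<noteq> f x) (at_right x)"
      using right_half_right_constant[OF Suc.prems(2)] eventually_at_right_real[OF Suc.prems(2)]
    proof eventually_elim
      case (elim y)
      have "f x < f y" by (rule f_strict_mono) (use elim Suc.prems in auto)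
      then show ?case by auto
    qed
  qed
  from filterlim_iff[THEN iffD1, OF this, rule_format, OF Suc.IH[OF fx]]
  show ?case using right_half_right_constant[OF Suc.prems(2)]
    by eventually_elim (simp add: code_Suc)
qed simp

definition binary_cdf :: "real \<Rightarrow> real" where
  "binary_cdf x = (if x < 0 then 0 else if 1 \<le> x then 1 else binary x)"

lemma binary_cdf_eq_binary: "x \<in> {0..1} \<Longrightarrow> binary_cdf x = binary x"
  by (auto simp: binary_cdf_def binary_1)

lemma binary_cdf_mono: "x \<le> y \<Longrightarrow> binary_cdf x \<le> binary_cdf y"
  using binary_bounds[of x] binary_bounds[of y] binary_mono[of x y] by (auto simp: binary_cdf_def)

lemma binary_cdf_right_continuous: "continuous (at_right x) binary_cdf"
proof -
  have loc: "continuous (at_right x) binary_cdf" if "eventually (\<lambda>y. binary_cdf y = binary_cdf x) (at_right x)"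
    unfolding continuous_within by (rule tendsto_eventually[OF that])
  consider "x < 0" | "1 \<le> x" | "0 \<le> x" "x < 1" by linarith
  then show ?thesis
  proof cases
    case 1
    show ?thesis by (rule loc) (use eventually_at_right_real[OF 1] in eventually_elim, use 1 in \<open>simp add: binary_cdf_def\<close>)
  next
    case 2
    have "x < x + 1" by simp
    show ?thesis by (rule loc) (use eventually_at_right_real[OF \<open>x < x + 1\<close>] in eventually_elim, use 2 in \<open>simp add: binary_cdf_def\<close>)
  next
    case 3
    show ?thesis
      unfolding continuous_within
    proof (rule tendstoI)
      fix \<epsilon> :: real assume "\<epsilon> > 0"
      obtain n where n: "(1/2::real) ^ n < \<epsilon>" using real_arch_pow_inv[OF \<open>\<epsilon> > 0\<close>, of "1/2"] by auto
      show "eventually (\<lambda>y. dist (binary_cdf y) (binary_cdf x) < \<epsilon>) (at_right x)"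
        using code_right_constant[OF 3, of n] eventually_at_right_real[OF 3(2)]
      proof eventually_elim
        case (elim y)
        then have "\<bar>binary y - binary x\<bar> \<le> (1/2) ^ n" by (intro binary_code_close) simp
        then show ?case using elim 3 n by (simp add: binary_cdf_def dist_real_def)
      qed
    qed
  qed
qed

lemma binary_cdf_at_bot: "(binary_cdf \<longlongrightarrow> 0) at_bot"
  by (rule tendsto_eventually) (use eventually_gt_at_bot[of 0] in eventually_elim, simp add: binary_cdf_def)

lemma binary_cdf_at_top: "(binary_cdf \<longlongrightarrow> 1) at_top"
  by (rule tendsto_eventually) (use eventually_ge_at_top[of 1] in eventually_elim, simp add: binary_cdf_def)

lemma binary_near_1: "y \<in> {1 - (1/2) ^ n..1} \<Longrightarrow> binary y \<ge> 1 - (1/2) ^ n"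
proof (induction n arbitrary: y)
  case 0
  show ?case using binary_bounds[of y] by simp
next
  case (Suc n)
  have "(1/2::real) ^ n \<le> 1" by (rule power_le_one) auto
  then have y: "1/2 \<le> y" "right_half y" using Suc.prems by (simp_all add: right_half_def)
  have "binary (f y) \<ge> 1 - (1/2) ^ n"
    using Suc.prems by (intro Suc.IH) (simp add: f_right[OF y(1)])
  then show ?case using binary_rec[of y] y(2) by simp
qed

definition coin :: "real measure" where "coin = interval_measure binary_cdf"

lemma real_distribution_coin: "real_distribution coin"
  unfolding coin_def
  by (rule real_distribution_interval_measure[OF binary_cdf_mono binary_cdf_right_continuous binary_cdf_at_bot binary_cdf_at_top])

lemma measure_coin_atMost: "measure coin {..a} = binary_cdf a"
  unfolding coin_def
  by (rule measure_interval_measure_Iic[OF binary_cdf_mono binary_cdf_right_continuous binary_cdf_at_bot])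

definition branch :: "bool \<Rightarrow> real set" where
  "branch b = (if b then {1/2..1} else {0..<1/2})"

lemma branch_iff: "x \<in> branch b \<longleftrightarrow> x \<in> {0..1} \<and> right_half x = b"
  by (cases b) (auto simp: branch_def right_half_def)

lemma branch_borel [measurable]: "branch b \<in> sets borel"
  by (simp add: branch_def)

lemma coin_left:
  assumes "0 \<le> a" "a < 1" shows "measure coin (branch False \<inter> f -` {..a}) = binary a / 2"
proof -
  interpret real_distribution coin by (rule real_distribution_coin)
  obtain g where g: "0 \<le> g" "g < 1/2" "f g = a"
  proof (cases "a = 0")
    case True
    then show ?thesis using that[of 0] by simp
  next
    case False
    then obtain x where "x \<in> {0<..<1/2}" "f x = a" using left_branch_onto[of a] assms by auto
    then show ?thesis using that[of x] by simp
  qed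
  have eq: "branch False \<inter> f -` {..a} = {0..g}"
  proof (intro equalityI subsetI)
    fix x assume x: "x \<in> branch False \<inter> f -` {..a}"
    have "\<not> g < x"
    proof
      assume "g < x"
      then have "f g < f x" using x g by (intro f_strict_mono) (auto simp: branch_def right_half_def)
      then show False using x g by simp
    qed
    then show "x \<in> {0..g}" using x by (simp add: branch_def)
  next
    fix x assume x: "x \<in> {0..g}"
    have "f x \<le> f g" by (rule f_mono) (use x g in \<open>auto simp: right_half_def\<close>)
    then show "x \<in> branch False \<inter> f -` {..a}" using x g by (simp add: branch_def)
  qed
  have "prob {0..g} \<le> prob {..g}" by (intro finite_measure_mono) auto
  moreover have "prob {..g} \<le> prob ({..0} \<union> {0..g})" by (intro finite_measure_mono) auto
  moreover have "\<dots> \<le> prob {..0} + prob {0..g}" by (intro measure_Un_le) auto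
  moreover have "prob {..0} = 0" by (simp add: measure_coin_atMost binary_cdf_def binary_0)
  moreover have "prob {..g} = binary a / 2"
    using g binary_rec[of g] by (simp add: measure_coin_atMost binary_cdf_def right_half_def)
  ultimately show ?thesis unfolding eq by linarith
qed

text \<open>
  The distribution function gives mass \<open>1/2\<close> to \<open>{..1/2}\<close>. That none of it sits at the break point \<open>1/2\<close> follows by
  applying \<open>coin_left\<close> with \<open>a\<close> close to \<open>1\<close>.
\<close>

lemma coin_branch_False: "measure coin (branch False) = 1/2" "measure coin {..<1/2} = 1/2"
proof -
  interpret real_distribution coin by (rule real_distribution_coin)
  have sub: "prob (branch False) \<le> prob {..<1/2}" "prob {..<1/2} \<le> prob {..1/2}"
    by (intro finite_measure_mono; auto simp: branch_def)+
  have half: "prob {..1/2} = 1/2" by (simp add: measure_coin_atMost binary_cdf_def binary_half)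
  have "1/2 \<le> prob (branch False)"
  proof (rule field_le_epsilon)
    fix \<epsilon> :: real assume "\<epsilon> > 0"
    obtain n where n: "(1/2::real) ^ n < \<epsilon>" using real_arch_pow_inv[OF \<open>\<epsilon> > 0\<close>, of "1/2"] by auto
    have p: "(1/2::real) ^ n \<le> 1" by (rule power_le_one) auto
    have "(1 - (1/2) ^ n) / 2 \<le> binary (1 - (1/2) ^ n) / 2"
      using binary_near_1[of "1 - (1/2) ^ n" n] by simp
    also have "\<dots> = prob (branch False \<inter> f -` {..1 - (1/2) ^ n})"
      by (rule coin_left[symmetric]) (use p in auto)
    also have "\<dots> \<le> prob (branch False)" by (intro finite_measure_mono) auto
    finally have "1/2 \<le> prob (branch False) + (1/2) ^ n / 2" by (simp add: diff_divide_distrib)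
    moreover have "(1/2::real) ^ n / 2 \<le> \<epsilon>" using n \<open>\<epsilon> > 0\<close> by linarith
    ultimately show "1/2 \<le> prob (branch False) + \<epsilon>" by simp
  qed
  then show "prob (branch False) = 1/2" "prob {..<1/2} = 1/2" using sub half by linarith+
qed

lemma coin_right:
  assumes "0 \<le> a" "a \<le> 1" shows "measure coin (branch True \<inter> f -` {..a}) = binary a / 2"
proof -
  interpret real_distribution coin by (rule real_distribution_coin)
  define h where "h = (a + 1) / 2"
  have h: "1/2 \<le> h" "h \<le> 1" "f h = a" using assms by (auto simp: h_def f_right field_simps)
  have eq: "branch True \<inter> f -` {..a} = {..h} - {..<1/2}"
    using assms by (auto simp: branch_def h_def f_right)
  have "prob ({..h} - {..<1/2}) = prob {..h} - prob {..<1/2}"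
    by (intro finite_measure_Diff) (use h in auto)
  also have "prob {..h} = binary h" using h binary_cdf_eq_binary[of h] by (simp add: measure_coin_atMost)
  also have "binary h = (1 + binary a) / 2" using binary_rec[of h] h by (simp add: right_half_def)
  finally show ?thesis unfolding eq coin_branch_False by (simp add: add_divide_distrib)
qed

text \<open>
  The measure is self-similar: on each branch, its image under \<open>f\<close> is half of the measure itself. It is enough
  to compare distribution functions.
\<close>

lemma coin_branch_vimage:
  assumes A: "A \<in> sets borel"
  shows "measure coin (branch b \<inter> f -` A) = measure coin A / 2"
proof -
  interpret real_distribution coin by (rule real_distribution_coin)
  \<comment> \<open>Not normalized: \<open>N\<close> and \<open>M\<close> both have total mass \<open>1/2\<close>.\<close>
  define D where "D = density coin (indicator (branch b))"
  define N where "N = distr D borel f"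
  define M where "M = scale_measure (ennreal (1/2)) coin"
  have sD: "sets D = sets borel" "space D = UNIV" by (simp_all add: D_def)
  have fD: "f \<in> measurable D borel"
    unfolding measurable_cong_sets[OF sD(1) refl] by (rule f_measurable_borel)
  have N: "emeasure N B = emeasure coin (branch b \<inter> f -` B)" if "B \<in> sets borel" for B
  proof -
    have fB: "f -` B \<in> sets borel" using measurable_sets[OF f_measurable_borel that] by simp
    have "emeasure N B = emeasure D (f -` B)" unfolding N_def using that fD by (simp add: emeasure_distr sD)
    also have "\<dots> = emeasure coin (branch b \<inter> f -` B)"
      unfolding D_def using fB by (subst emeasure_restricted) auto
    finally show ?thesis .
  qed
  have mN: "measure N B = prob (branch b \<inter> f -` B)" if "B \<in> sets borel" for B
    using N[OF that] by (simp add: measure_def)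
  have mM: "measure M B = prob B / 2" for B
    unfolding M_def by (subst measure_scale_measure) auto
  have "N = M"
  proof (rule cdf_unique')
    show "finite_borel_measure N"
    proof (intro finite_borel_measure.intro finite_measureI finite_borel_measure_axioms.intro)
      show "emeasure N (space N) \<noteq> \<infinity>" using N[of UNIV] by (simp add: N_def emeasure_eq_measure)
    qed (simp add: N_def)
    show "finite_borel_measure M"
    proof (intro finite_borel_measure.intro finite_measureI finite_borel_measure_axioms.intro)
      show "emeasure M (space M) \<noteq> \<infinity>"
        unfolding M_def emeasure_scale_measure space_scale_measure
        by (simp add: emeasure_eq_measure ennreal_mult_eq_top_iff)
    qed (simp add: M_def)
    show "cdf N = cdf M"
    proof
      fix a :: real
      consider "a < 0" | "0 \<le> a" "a < 1" | "1 \<le> a" by linarith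
      then have "prob (branch b \<inter> f -` {..a}) = binary_cdf a / 2"
      proof cases
        case 1
        then have "branch b \<inter> f -` {..a} = {}" using f_mem by (fastforce simp: branch_iff)
        then show ?thesis using 1 by (simp add: binary_cdf_def)
      next
        case 2
        then show ?thesis using coin_left[of a] coin_right[of a] by (cases b) (auto simp: binary_cdf_def)
      next
        case 3
        have "branch b \<inter> f -` {..a} = branch b" using f_mem 3 by (fastforce simp: branch_iff)
        moreover have "branch True \<inter> f -` {..1} = branch True" using f_mem by (fastforce simp: branch_iff)
        then have "prob (branch True) = 1/2" using coin_right[of 1] by (simp add: binary_1)
        ultimately show ?thesis using 3 coin_branch_False(1) by (cases b) (auto simp: binary_cdf_def)
      qed
      then show "cdf N a = cdf M a" by (simp add: cdf_def mN mM measure_coin_atMost)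
    qed
  qed
  then show ?thesis using mN[OF A] mM[of A] by simp
qed

definition bernoulli :: "real measure" where "bernoulli = restrict_space coin {0..1}"

lemma coin_unit: "measure coin {0..1} = 1"
proof -
  interpret real_distribution coin by (rule real_distribution_coin)
  have "prob {..1} \<le> prob ({..0} \<union> {0..1})" by (intro finite_measure_mono) auto
  also have "\<dots> \<le> prob {..0} + prob {0..1}" by (intro measure_Un_le) auto
  finally have "1 \<le> prob {0..1}" by (simp add: measure_coin_atMost binary_cdf_def binary_0)
  then show ?thesis using prob_le_1[of "{0..1}"] by simp
qed

lemma sets_bernoulli: "sets bernoulli = sets unit_borel"
  unfolding bernoulli_def coin_def by (rule sets_restrict_space_cong) simp

lemma space_bernoulli: "space bernoulli = {0..1}"
  by (simp add: bernoulli_def coin_def space_restrict_space)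

lemma measure_bernoulli: "A \<subseteq> {0..1} \<Longrightarrow> measure bernoulli A = measure coin A"
proof -
  interpret real_distribution coin by (rule real_distribution_coin)
  show "A \<subseteq> {0..1} \<Longrightarrow> measure bernoulli A = measure coin A"
    unfolding bernoulli_def by (intro measure_restrict_space) auto
qed

lemma prob_space_bernoulli: "prob_space bernoulli"
proof -
  interpret real_distribution coin by (rule real_distribution_coin)
  show ?thesis unfolding bernoulli_def
    by (intro prob_space_restrict_space) (auto simp: emeasure_eq_measure coin_unit)
qed

lemma bernoulli_branch_vimage:
  assumes "A \<in> sets bernoulli"
  shows "measure bernoulli {x\<in>{0..1}. right_half x = b \<and> f x \<in> A} = measure bernoulli A / 2"
proof -
  have A: "A \<in> sets borel" "A \<subseteq> {0..1}"
    using assms by (auto simp: sets_bernoulli sets_restrict_space_iff)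
  have "{x\<in>{0..1}. right_half x = b \<and> f x \<in> A} = branch b \<inter> f -` A" by (auto simp: branch_iff)
  moreover have "branch b \<inter> f -` A \<subseteq> {0..1}" by (auto simp: branch_iff)
  ultimately show ?thesis using coin_branch_vimage[OF A(1), of b] A(2) by (simp add: measure_bernoulli)
qed

lemma coded_system_bernoulli: "coded_system \<gamma> bernoulli"
proof -
  interpret prob_space bernoulli by (rule prob_space_bernoulli)
  have f: "f \<in> measurable bernoulli bernoulli"
    using measurable_cong_sets[OF sets_bernoulli sets_bernoulli] f_measurable by simp
  show ?thesis
  proof
    show "f \<in> measurable bernoulli bernoulli" by (rule f)
    fix A assume A: "A \<in> events"
    have ev: "{x\<in>{0..1}. right_half x = b \<and> f x \<in> A} \<in> events" for b
    proof -
      have "A \<in> sets borel" using A by (auto simp: sets_bernoulli sets_restrict_space_iff)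
      then have "branch b \<inter> f -` A \<in> sets borel"
        using measurable_sets[OF f_measurable_borel] by (intro sets.Int) auto
      moreover have "{x\<in>{0..1}. right_half x = b \<and> f x \<in> A} = branch b \<inter> f -` A" by (auto simp: branch_iff)
      ultimately show ?thesis by (auto simp: sets_bernoulli sets_restrict_space_iff)
    qed
    have "f -` A \<inter> space bernoulli
        = {x\<in>{0..1}. right_half x = True \<and> f x \<in> A} \<union> {x\<in>{0..1}. right_half x = False \<and> f x \<in> A}"
      by (auto simp: space_bernoulli)
    then have "prob (f -` A \<inter> space bernoulli)
        = prob {x\<in>{0..1}. right_half x = True \<and> f x \<in> A} + prob {x\<in>{0..1}. right_half x = False \<and> f x \<in> A}"
      by (simp only:, intro finite_measure_Union ev) auto
    also have "\<dots> = prob A" unfolding bernoulli_branch_vimage[OF A] by simp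
    finally show "emeasure bernoulli (f -` A \<inter> space bernoulli) = emeasure bernoulli A"
      by (simp add: emeasure_eq_measure)
  qed (rule sets_bernoulli)
qed

text \<open>
  The symbols are independent fair coin tosses, also independently of the future after them.
\<close>

lemma bernoulli_word:
  assumes A: "A \<in> sets bernoulli"
  shows "measure bernoulli {x\<in>{0..1}. code (length w) x = w \<and> (f ^^ length w) x \<in> A}
    = measure bernoulli A / 2 ^ length w"
proof -
  interpret coded_system \<gamma> bernoulli by (rule coded_system_bernoulli)
  show ?thesis
  proof (induction w)
    case Nil
    have "{x\<in>{0..1}. x \<in> A} = A" using sets.sets_into_space[OF A] by (auto simp: space_bernoulli)
    then show ?case by simp
  next
    case (Cons b w)
    let ?C = "{x\<in>{0..1}. code (length w) x = w \<and> (f ^^ length w) x \<in> A}"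
    have "?C = coded (length w) {w} \<inter> ((f ^^ length w) -` A \<inter> space bernoulli)"
      by (auto simp: coded_def space_\<mu>)
    also have "\<dots> \<in> events" by (rule sets.Int[OF coded_sets measurable_sets[OF T_funpow A]])
    finally have C: "?C \<in> events" .
    have "{x\<in>{0..1}. code (length (b # w)) x = b # w \<and> (f ^^ length (b # w)) x \<in> A}
        = {x\<in>{0..1}. right_half x = b \<and> f x \<in> ?C}"
      using f_mem by (auto simp: code_Suc funpow_swap1)
    then show ?case using bernoulli_branch_vimage[OF C, of b] Cons by simp
  qed
qed

text \<open>
  An invariant set \<open>A\<close> belongs to the future after any word, so it is independent of all unions of cylinders.
  As these approximate \<open>A\<close>, the set is independent of itself.
\<close>

lemma bernoulli_ergodic: "ergodic_prob unit_borel f bernoulli"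
proof -
  interpret coded_system \<gamma> bernoulli by (rule coded_system_bernoulli)
  have "prob A = 0 \<or> prob A = 1" if A: "A \<in> events" and inv: "f -` A \<inter> space bernoulli = A" for A
  proof -
    have invn: "(f ^^ n) x \<in> A \<longleftrightarrow> x \<in> A" if x: "x \<in> {0..1}" for n x
      using x
    proof (induction n arbitrary: x)
      case (Suc n)
      have "(f ^^ Suc n) x \<in> A \<longleftrightarrow> f x \<in> A" using Suc.IH[OF f_mem[OF Suc.prems]] by (simp add: funpow_swap1)
      also have "\<dots> \<longleftrightarrow> x \<in> A" using inv Suc.prems by (auto simp: space_\<mu>)
      finally show ?case .
    qed simp
    have word: "prob ({x\<in>space bernoulli. code n x = w} \<inter> A) = prob {x\<in>space bernoulli. code n x = w} * prob A"
      if w: "length w = n" for n w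
    proof -
      have "{x\<in>space bernoulli. code n x = w} \<inter> A = {x\<in>{0..1}. code (length w) x = w \<and> (f ^^ length w) x \<in> A}"
        using invn w by (auto simp: space_\<mu>)
      moreover have "{x\<in>space bernoulli. code n x = w}
          = {x\<in>{0..1}. code (length w) x = w \<and> (f ^^ length w) x \<in> space bernoulli}"
        using funpow_mem w by (auto simp: space_\<mu>)
      ultimately show ?thesis
        using bernoulli_word[OF A, of w] bernoulli_word[OF sets.top, of w] by (simp add: prob_space)
    qed
    have indep: "prob (coded n W \<inter> A) = prob (coded n W) * prob A" for n W
    proof -
      let ?V = "code n ` space bernoulli \<inter> W"
      let ?c = "\<lambda>w. {x\<in>space bernoulli. code n x = w}"
      have fin: "finite ?V" using simple_functionD(1)[OF simple_function_code[of n]] by simp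
      have ev: "?c w \<in> events" for w by (rule simple_function_fibre[OF simple_function_code])
      have U: "coded n W = (\<Union>w\<in>?V. ?c w)" by (auto simp: coded_def)
      have U': "coded n W \<inter> A = (\<Union>w\<in>?V. ?c w \<inter> A)" unfolding U by blast
      have "prob (coded n W \<inter> A) = (\<Sum>w\<in>?V. prob (?c w \<inter> A))"
        unfolding U' using fin ev A by (intro finite_measure_finite_Union) (auto simp: disjoint_family_on_def)
      also have "\<dots> = (\<Sum>w\<in>?V. prob (?c w) * prob A)" by (intro sum.cong refl word) auto
      also have "\<dots> = (\<Sum>w\<in>?V. prob (?c w)) * prob A" by (simp add: sum_distrib_right)
      also have "(\<Sum>w\<in>?V. prob (?c w)) = prob (coded n W)"
        unfolding U using fin ev
        by (intro finite_measure_finite_Union[symmetric]) (auto simp: disjoint_family_on_def)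
      finally show ?thesis .
    qed
    have "\<bar>prob A - prob A * prob A\<bar> \<le> 0"
    proof (rule field_le_epsilon)
      fix \<epsilon> :: real assume "\<epsilon> > 0"
      then have e: "\<epsilon> / 2 > 0" by simp
      have "A = A \<inter> {0..1}" using A by (auto simp: sets_\<mu>_iff)
      then have "approximable A" using approximable_borel[of A] A by (auto simp: sets_\<mu>_iff)
      then obtain n W where nW: "prob (sym_diff A (coded n W)) < \<epsilon> / 2" using e by (rule approximableE)
      let ?B = "coded n W"
      have s: "sym_diff A ?B \<in> events" using A by auto
      have "prob A \<le> prob ((?B \<inter> A) \<union> sym_diff A ?B)" using A s by (intro finite_measure_mono) auto
      also have "\<dots> \<le> prob (?B \<inter> A) + prob (sym_diff A ?B)" using A s by (intro measure_Un_le) auto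
      finally have 1: "prob A \<le> prob ?B * prob A + \<epsilon> / 2" using nW indep by simp
      have 2: "prob ?B * prob A \<le> prob A"
        unfolding indep[symmetric] using A by (intro finite_measure_mono) auto
      have "prob A \<le> prob (?B \<union> sym_diff A ?B)" using A s by (intro finite_measure_mono) auto
      also have "\<dots> \<le> prob ?B + prob (sym_diff A ?B)" using A s by (intro measure_Un_le) auto
      finally have "prob A \<le> prob ?B + \<epsilon> / 2" using nW by simp
      moreover have "prob ?B \<le> prob (A \<union> sym_diff A ?B)" using A s by (intro finite_measure_mono) auto
      moreover have "\<dots> \<le> prob A + prob (sym_diff A ?B)" using A s by (intro measure_Un_le) auto
      ultimately have "\<bar>prob ?B - prob A\<bar> \<le> \<epsilon> / 2" using nW by linarith
      then have "\<bar>prob ?B - prob A\<bar> * prob A \<le> (\<epsilon> / 2) * 1" using e by (intro mult_mono) auto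
      then have "\<bar>prob ?B * prob A - prob A * prob A\<bar> \<le> \<epsilon> / 2"
        by (simp add: left_diff_distrib[symmetric] abs_mult)
      then show "\<bar>prob A - prob A * prob A\<bar> \<le> 0 + \<epsilon>" using 1 2 by linarith
    qed
    then have "prob A * (1 - prob A) = 0" by (simp add: algebra_simps)
    then show ?thesis by simp
  qed
  then show ?thesis
    unfolding ergodic_prob_def invariant_prob_def
    using sets_\<mu> prob_space_axioms T invariant by blast
qed

lemma bernoulli_entropy: "KS_entropy bernoulli f \<ge> ereal (ln 2)"
proof -
  interpret coded_system \<gamma> bernoulli by (rule coded_system_bernoulli)
  let ?\<xi> = "{branch False, branch True}"
  have ne: "0 \<in> branch False" "1 \<in> branch True" by (simp_all add: branch_def)
  have part: "partition_on (space bernoulli) ?\<xi>"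
  proof (rule partition_onI)
    show "\<Union> ?\<xi> = space bernoulli" by (auto simp: branch_iff space_\<mu>)
    show "disjnt p q" if "p \<in> ?\<xi>" "q \<in> ?\<xi>" "p \<noteq> q" for p q
      using that by (auto simp: branch_iff disjnt_def)
    show "{} \<notin> ?\<xi>" using ne by blast
  qed
  have \<xi>: "finite_measurable_partition bernoulli ?\<xi>"
    using part by (auto simp: finite_measurable_partition_def sets_\<mu>_iff branch_iff)
  have cell: "cell ?\<xi> x = branch (right_half x)" if "x \<in> {0..1}" for x
    by (rule cell_eqI[OF part]) (use that in \<open>auto simp: branch_iff\<close>)
  have inj: "branch b = branch c \<longleftrightarrow> b = c" for b c
  proof
    assume *: "branch b = branch c"
    have "(if b then 1 else 0) \<in> branch b" by (auto simp: branch_def)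
    then show "b = c" using * by (auto simp: branch_iff right_half_def split: if_splits)
  qed simp
  have "map_entropy bernoulli (itinerary f (cell ?\<xi>) n) = real n * ln 2" for n
  proof -
    have "map_entropy bernoulli (itinerary f (cell ?\<xi>) n) = map_entropy bernoulli (code n)"
    proof (rule map_entropy_cong[OF simple_function_itinerary[OF simple_function_cell[OF \<xi>]] simple_function_code])
      fix x y assume "x \<in> space bernoulli" "y \<in> space bernoulli"
      then have "cell ?\<xi> ((f ^^ k) x) = cell ?\<xi> ((f ^^ k) y)
          \<longleftrightarrow> right_half ((f ^^ k) x) = right_half ((f ^^ k) y)" for k
        using funpow_mem[of x k] funpow_mem[of y k] by (simp add: cell inj space_\<mu>)
      then show "code n x = code n y \<longleftrightarrow> itinerary f (cell ?\<xi>) n x = itinerary f (cell ?\<xi>) n y"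
        unfolding itinerary_eq_iff by blast
    qed
    also have "\<dots> = (\<integral>x. real n * ln 2 \<partial>bernoulli)"
      unfolding map_entropy_integral[OF simple_function_code]
    proof (intro Bochner_Integration.integral_cong refl)
      fix x
      have "{y\<in>space bernoulli. code n y = code n x}
          = {y\<in>{0..1}. code (length (code n x)) y = code n x \<and> (f ^^ length (code n x)) y \<in> space bernoulli}"
        using funpow_mem by (auto simp: space_\<mu>)
      then have "fibre_prob bernoulli (code n) x = 1 / 2 ^ n"
        using bernoulli_word[OF sets.top, of "code n x"] by (simp add: fibre_prob_def prob_space)
      then show "- ln (fibre_prob bernoulli (code n) x) = real n * ln 2"
        by (simp add: ln_div ln_realpow)
    qed
    also have "\<dots> = real n * ln 2" by (simp add: prob_space)
    finally show ?thesis .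
  qed
  then have "(\<lambda>n. real n * ln 2 / real n) \<longlonglongrightarrow> entropy_of_partition bernoulli f ?\<xi>"
    using entropy_of_partition_LIMSEQ[OF \<xi>] by simp
  moreover have "(\<lambda>n. real n * ln 2 / real n) \<longlonglongrightarrow> ln 2"
    by (rule tendsto_eventually) (use eventually_gt_at_top[of 0] in eventually_elim, simp)
  ultimately have "entropy_of_partition bernoulli f ?\<xi> = ln 2" by (rule LIMSEQ_unique)
  then show ?thesis using KS_entropy_ge[OF \<xi>] by simp
qed

end

section \<open>Pressure and the escape rate\<close>

context coded_system begin

lemma ext_integral_log_deriv:
  assumes t: "t \<ge> 0" and \<psi>: "AE x in \<mu>. \<psi> x = ereal (- t * log_deriv x)"
  shows "(\<integral>\<^sup>+x. e2ennreal (- \<psi> x) \<partial>\<mu>) < \<infinity>"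
    and "ext_integral \<mu> \<psi> = ereal (- t * (\<integral>x. log_deriv x \<partial>\<mu>))"
proof -
  have nn: "AE x in \<mu>. 0 \<le> t * log_deriv x"
    using t log_deriv_nonneg by (intro AE_I2) (simp add: space_\<mu>)
  have "(\<integral>\<^sup>+x. e2ennreal (\<psi> x) \<partial>\<mu>) = (\<integral>\<^sup>+x. 0 \<partial>\<mu>)"
  proof (rule nn_integral_cong_AE)
    show "AE x in \<mu>. e2ennreal (\<psi> x) = 0"
      using \<psi> nn by eventually_elim (simp add: ennreal_neg)
  qed
  then have pos: "(\<integral>\<^sup>+x. e2ennreal (\<psi> x) \<partial>\<mu>) = 0" by simp
  have "(\<integral>\<^sup>+x. e2ennreal (- \<psi> x) \<partial>\<mu>) = (\<integral>\<^sup>+x. ennreal (t * log_deriv x) \<partial>\<mu>)"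
  proof (rule nn_integral_cong_AE)
    show "AE x in \<mu>. e2ennreal (- \<psi> x) = ennreal (t * log_deriv x)"
      using \<psi> by eventually_elim simp
  qed
  also have "\<dots> = ennreal (\<integral>x. t * log_deriv x \<partial>\<mu>)"
    using log_deriv_integrable nn by (intro nn_integral_eq_integral) auto
  finally have neg: "(\<integral>\<^sup>+x. e2ennreal (- \<psi> x) \<partial>\<mu>) = ennreal (t * (\<integral>x. log_deriv x \<partial>\<mu>))" by simp
  then show "(\<integral>\<^sup>+x. e2ennreal (- \<psi> x) \<partial>\<mu>) < \<infinity>" by simp
  have "0 \<le> (\<integral>x. t * log_deriv x \<partial>\<mu>)" using nn by (rule integral_nonneg_AE)
  then show "ext_integral \<mu> \<psi> = ereal (- t * (\<integral>x. log_deriv x \<partial>\<mu>))"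
    unfolding ext_integral_def pos neg by (simp add: zero_ennreal.rep_eq)
qed

end

context intermittent_map begin

lemma coded_system_of_ergodic:
  assumes "ergodic_prob unit_borel f \<mu>" shows "coded_system \<gamma> \<mu>"
proof -
  interpret invariant_system \<mu> f by (rule invariant_system_of_ergodic[OF assms])
  show ?thesis
    by unfold_locales (use assms in \<open>simp add: ergodic_prob_def invariant_prob_def\<close>)
qed

lemma scale_geom_potential:
  "x \<in> {0..1} \<Longrightarrow> scale_potential t (geom_potential \<gamma>) x = ereal (- t * log_deriv x)"
  by (simp add: scale_potential_def geom_potential_eq)

lemma closed_pressure_ge:
  assumes t: "t \<ge> 0" and \<mu>: "ergodic_prob unit_borel f \<mu>"
  shows "closed_pressure \<gamma> t \<ge> KS_entropy \<mu> f + ereal (- t * (\<integral>x. log_deriv x \<partial>\<mu>))"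
proof -
  interpret \<mu>: coded_system \<gamma> \<mu> by (rule coded_system_of_ergodic[OF \<mu>])
  let ?\<psi> = "scale_potential t (geom_potential \<gamma>)"
  have "AE x in \<mu>. ?\<psi> x = ereal (- t * log_deriv x)"
    by (intro AE_I2 scale_geom_potential) (simp add: \<mu>.space_\<mu>)
  note E = \<mu>.ext_integral_log_deriv[OF t this]
  have "KS_entropy \<mu> f + ext_integral \<mu> ?\<psi> \<le> closed_pressure \<gamma> t"
    unfolding closed_pressure_def pressure_def by (rule SUP_upper) (use \<mu> E(1) in simp)
  then show ?thesis unfolding E(2) .
qed

lemma dirac_0_ergodic: "ergodic_prob unit_borel f (return unit_borel 0)"
proof -
  have 0: "0 \<in> space unit_borel" by (simp add: space_restrict_space)
  have f: "f \<in> measurable (return unit_borel 0) (return unit_borel 0)"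
    using f_measurable by simp
  have "emeasure (return unit_borel 0) (f -` A \<inter> space (return unit_borel 0)) = emeasure (return unit_borel 0) A"
    if A: "A \<in> sets unit_borel" for A
  proof -
    have "f -` A \<inter> space unit_borel \<in> sets unit_borel" by (rule measurable_sets[OF f_measurable A])
    then show ?thesis using A 0 by (simp add: indicator_def)
  qed
  moreover have "measure (return unit_borel 0) A = 0 \<or> measure (return unit_borel 0) A = 1"
    if "A \<in> sets unit_borel" for A
    using measure_return[OF that, of 0] by (simp add: indicator_def)
  ultimately show ?thesis
    unfolding ergodic_prob_def invariant_prob_def
    using prob_space_return[OF 0] f by auto
qed

text \<open>
  The point mass at \<open>0\<close> has free energy \<open>0\<close> for every \<open>t\<close>.
\<close>

lemma closed_pressure_nonneg: assumes "t \<ge> 0" shows "closed_pressure \<gamma> t \<ge> 0"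
proof -
  let ?\<delta> = "return unit_borel (0::real)"
  interpret \<delta>: coded_system \<gamma> ?\<delta> by (rule coded_system_of_ergodic[OF dirac_0_ergodic])
  have "(\<integral>x. log_deriv x \<partial>?\<delta>) = log_deriv 0"
    using \<delta>.log_deriv_measurable_\<mu> by (intro integral_return) (auto simp: space_restrict_space)
  then have "KS_entropy ?\<delta> f + 0 \<le> closed_pressure \<gamma> t"
    using closed_pressure_ge[OF assms dirac_0_ergodic] by (simp add: zero_ereal_def)
  then show ?thesis using \<delta>.KS_entropy_nonneg by (simp add: order_trans)
qed

lemma closed_pressure_0_pos: "closed_pressure \<gamma> 0 > 0"
proof -
  have "0 < ereal (ln 2)" by simp
  also have "\<dots> \<le> KS_entropy bernoulli f" by (rule bernoulli_entropy)
  also have "\<dots> \<le> closed_pressure \<gamma> 0"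
    using closed_pressure_ge[OF _ bernoulli_ergodic, of 0] by (simp add: zero_ereal_def[symmetric])
  finally show ?thesis .
qed

text \<open>
  With infinite pressure the conformal weight would be \<open>exp (-\<infinity>) = 0\<close>, and both branches would have mass \<open>0\<close>.
\<close>

lemma closed_pressure_finite:
  assumes m: "geom_conformal_prob \<gamma> t m" shows "closed_pressure \<gamma> t \<noteq> \<infinity>"
proof
  assume inf: "closed_pressure \<gamma> t = \<infinity>"
  have sm: "sets m = sets unit_borel" and "prob_space m" using m by (auto simp: geom_conformal_prob_def)
  interpret prob_space m by fact
  have zero: "emeasure m (branch b) = 0" for b
  proof -
    have inj: "inj_on f (branch b)"
      by (rule inj_onI) (use f_inj in \<open>auto simp: branch_iff\<close>)
    have "branch b \<in> events" using branch_borel[of b] by (auto simp: sm sets_restrict_space_iff branch_iff)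
    then have "emeasure m (branch b) = (\<integral>\<^sup>+y. exp_ereal (scale_potential t (geom_potential \<gamma>)
        (inv_into (branch b) f y) - closed_pressure \<gamma> t) * indicator (f ` branch b) y \<partial>m)"
      using m inj by (simp add: geom_conformal_prob_def conformal_def)
    also have "\<dots> = (\<integral>\<^sup>+y. 0 \<partial>m)"
    proof (rule nn_integral_cong)
      fix y
      show "exp_ereal (scale_potential t (geom_potential \<gamma>) (inv_into (branch b) f y) - closed_pressure \<gamma> t)
          * indicator (f ` branch b) y = 0"
      proof (cases "y \<in> f ` branch b")
        case True
        then have "inv_into (branch b) f y \<in> {0..1}" using inv_into_into[OF True] by (simp add: branch_iff)
        then show ?thesis by (simp add: scale_geom_potential inf exp_ereal_def)
      qed simp
    qed
    finally show ?thesis by simp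
  qed
  have "space m = branch False \<union> branch True"
    using sets_eq_imp_space_eq[OF sm] by (simp add: space_restrict_space branch_def ivl_disj_un)
  moreover have "branch False \<in> events" "branch True \<in> events"
    using branch_borel by (auto simp: sm sets_restrict_space_iff branch_iff)
  ultimately have "emeasure m (space m) \<le> emeasure m (branch False) + emeasure m (branch True)"
    by (simp add: emeasure_subadditive)
  then show False using zero emeasure_space_1 by simp
qed

text \<open>
  Measures that charge the hole do not enter the open pressure, because the potential is \<open>-\<infinity>\<close> there.
\<close>

lemma hole_null:
  assumes cs: "coded_system \<gamma> \<mu>" and hole: "markov_hole \<gamma> N0 H"
    and fin: "(\<integral>\<^sup>+x. e2ennreal (- scale_potential t (punctured_potential \<gamma> H) x) \<partial>\<mu>) < \<infinity>"
  shows "measure \<mu> (H \<inter> {0..1}) = 0"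
proof (rule ccontr)
  interpret \<mu>: coded_system \<gamma> \<mu> by (rule cs)
  assume "measure \<mu> (H \<inter> {0..1}) \<noteq> 0"
  then have pos: "emeasure \<mu> (H \<inter> {0..1}) \<noteq> 0" by (simp add: \<mu>.emeasure_eq_measure)
  have ev: "H \<inter> {0..1} \<in> \<mu>.events" using hole_borel[OF hole] by (simp add: \<mu>.sets_\<mu>_iff)
  have "\<infinity> = \<infinity> * emeasure \<mu> (H \<inter> {0..1})" using pos by (simp add: ennreal_top_mult)
  also have "\<dots> = (\<integral>\<^sup>+x. \<infinity> * indicator (H \<inter> {0..1}) x \<partial>\<mu>)"
    using ev by (simp add: nn_integral_cmult_indicator)
  also have "\<dots> \<le> (\<integral>\<^sup>+x. e2ennreal (- scale_potential t (punctured_potential \<gamma> H) x) \<partial>\<mu>)"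
    by (intro nn_integral_mono)
      (auto simp: indicator_def scale_potential_def punctured_potential_def e2ennreal_infty)
  finally show False using fin by simp
qed

end

context intermittent_conformal begin

text \<open>
  The two cases of the argument: measures with an atom have free energy at most \<open>0\<close> and are covered by
  \<open>survivors_ge_neutral\<close>, all others by \<open>survivors_ge_entropy\<close>.
\<close>

lemma escape_rate_ge_free_energy:
  assumes hole: "markov_hole \<gamma> N0 H" and ns: "non_swallowing \<gamma> N0 H"
    and p0: "p \<ge> 0" and tp: "t = 0 \<Longrightarrow> p > 0"
    and \<mu>: "ergodic_prob unit_borel f \<mu>"
    and fin: "(\<integral>\<^sup>+x. e2ennreal (- scale_potential t (punctured_potential \<gamma> H) x) \<partial>\<mu>) < \<infinity>"
  shows "KS_entropy \<mu> f + ext_integral \<mu> (scale_potential t (punctured_potential \<gamma> H))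
    \<le> log_lower_escape \<gamma> H m + ereal p"
proof -
  interpret \<mu>: coded_system \<gamma> \<mu> by (rule coded_system_of_ergodic[OF \<mu>])
  note mass = interior_mass_pos[OF p0 tp]
  let ?L = "log_lower_escape \<gamma> H m"
  define lyap where "lyap = (\<integral>x. log_deriv x \<partial>\<mu>)"
  have null: "measure \<mu> (H \<inter> {0..1}) = 0" by (rule hole_null[OF \<mu>.coded_system_axioms hole fin])
  have ev: "H \<inter> {0..1} \<in> \<mu>.events" using hole_borel[OF hole] by (simp add: \<mu>.sets_\<mu>_iff)
  have "AE x in \<mu>. x \<notin> H \<inter> {0..1}"
    using ev null by (intro AE_not_in) (simp add: null_sets_def \<mu>.emeasure_eq_measure)
  then have "AE x in \<mu>. scale_potential t (punctured_potential \<gamma> H) x = ereal (- t * log_deriv x)"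
    using AE_space
  proof eventually_elim
    case (elim x)
    then have "scale_potential t (punctured_potential \<gamma> H) x = scale_potential t (geom_potential \<gamma>) x"
      by (simp add: scale_potential_def punctured_potential_def \<mu>.space_\<mu>)
    then show ?case using elim scale_geom_potential by (simp add: \<mu>.space_\<mu>)
  qed
  then have ext: "ext_integral \<mu> (scale_potential t (punctured_potential \<gamma> H)) = ereal (- t * lyap)"
    unfolding lyap_def using t by (intro \<mu>.ext_integral_log_deriv(2)) auto
  show ?thesis
  proof (cases "\<exists>x. measure \<mu> {x} > 0")
    case True
    then obtain x where x: "measure \<mu> {x} > 0" by blast
    have sing: "{y} \<in> \<mu>.events" if "y \<in> space \<mu>" for y using that by (simp add: \<mu>.sets_\<mu>_iff \<mu>.space_\<mu>)
    have "{x} \<in> \<mu>.events" using x measure_notin_sets[of "{x}" \<mu>] by force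
    then have "x \<in> space \<mu>" using sets.sets_into_space by blast
    then have "KS_entropy \<mu> f \<le> 0"
      by (rule \<mu>.atom_imp_KS_entropy_le_0[OF _ x sing]) (use \<mu> in \<open>auto simp: ergodic_prob_def\<close>)
    moreover have "lyap \<ge> 0"
      unfolding lyap_def by (intro integral_nonneg_AE AE_I2 log_deriv_nonneg) (simp add: \<mu>.space_\<mu>)
    then have "ereal (- t * lyap) \<le> 0" using t by simp
    ultimately have "KS_entropy \<mu> f + ereal (- t * lyap) \<le> 0 + 0" by (rule add_mono)
    also have "0 + 0 \<le> ?L + ereal p"
    proof -
      have "ereal (- p) \<le> ?L"
        unfolding log_lower_escape_def
        by (rule liminf_ge_of_exponential_bound[OF tendsto_const])
          (use survivors_ge_neutral[OF hole ns mass] in auto)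
      then show ?thesis by (cases ?L) auto
    qed
    finally show ?thesis unfolding ext .
  next
    case False
    then have atomless: "measure \<mu> {x} = 0" for x
      using measure_nonneg[of \<mu> "{x}"] by (simp add: less_le)
    have "KS_entropy \<mu> f \<le> ?L + ereal (p + t * lyap)"
      unfolding KS_entropy_def
    proof (rule SUP_least)
      fix \<xi> assume "\<xi> \<in> Collect (finite_measurable_partition \<mu>)"
      then have \<xi>: "finite_measurable_partition \<mu> \<xi>" by simp
      let ?h = "entropy_of_partition \<mu> f \<xi>"
      let ?a = "\<lambda>k. map_entropy \<mu> (itinerary f (cell \<xi>) k)"
      have a0: "?a k \<ge> 0" for k
        by (intro \<mu>.map_entropy_nonneg \<mu>.simple_function_itinerary simple_function_cell \<xi>)
      have "ereal (?h + (- t * lyap - p)) \<le> ?L"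
        unfolding log_lower_escape_def
      proof (rule liminf_ge_of_exponential_bound)
        show "(\<lambda>k. ?a k / real k + (- t * lyap - p)) \<longlonglongrightarrow> ?h + (- t * lyap - p)"
          by (intro tendsto_add tendsto_const \<mu>.entropy_of_partition_LIMSEQ \<xi>)
        fix \<epsilon> :: real assume \<epsilon>: "\<epsilon> > 0"
        obtain C where C: "\<And>k. measure m (survivors \<gamma> H k) > 0 \<and>
            ln (measure m (survivors \<gamma> H k)) \<ge> ?a k + real k * (- t * lyap - p - \<epsilon>) - C"
          using survivors_ge_entropy[OF hole mass \<epsilon> \<mu>.coded_system_axioms atomless null \<xi>]
          unfolding lyap_def by blast
        have "real k * (?a k / real k + (- t * lyap - p) - \<epsilon>) \<le> ?a k + real k * (- t * lyap - p - \<epsilon>)" for k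
          using a0[of k] by (cases "k = 0") (auto simp: algebra_simps)
        then show "\<exists>C. \<forall>k. measure m (survivors \<gamma> H k) > 0 \<and> ln (measure m (survivors \<gamma> H k))
            \<ge> real k * (?a k / real k + (- t * lyap - p) - \<epsilon>) - C"
          using C by (intro exI[of _ C]) (meson diff_right_mono order_trans)
      qed
      then show "ereal ?h \<le> ?L + ereal (p + t * lyap)" by (cases ?L) (auto simp: algebra_simps)
    qed
    then show ?thesis unfolding ext by (cases "KS_entropy \<mu> f"; cases ?L) (auto simp: algebra_simps)
  qed
qed

end

theorem proposition1p3:
  fixes \<gamma> t :: real and N0 :: nat and H :: "real set" and m\<^sub>t :: "real measure"
  assumes "0 < \<gamma>" and "\<gamma> < 1"
    and "1 \<le> N0" and "markov_hole \<gamma> N0 H" and "non_swallowing \<gamma> N0 H"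
    and "t \<in> {0..1}" and "geom_conformal_prob \<gamma> t m\<^sub>t"
  shows "log_lower_escape \<gamma> H m\<^sub>t \<ge> open_pressure \<gamma> H t - closed_pressure \<gamma> t"
proof -
  interpret intermittent_map \<gamma> by unfold_locales (use assms in auto)
  have "closed_pressure \<gamma> t \<ge> 0" using assms by (intro closed_pressure_nonneg) simp
  moreover have "closed_pressure \<gamma> t \<noteq> \<infinity>" by (rule closed_pressure_finite) fact
  ultimately obtain p where P: "closed_pressure \<gamma> t = ereal p" "p \<ge> 0"
    by (cases "closed_pressure \<gamma> t") auto
  interpret intermittent_conformal \<gamma> t p m\<^sub>t
    by unfold_locales (use assms P in auto)
  have tp: "p > 0" if "t = 0" using closed_pressure_0_pos P that by simp
  have "open_pressure \<gamma> H t \<le> log_lower_escape \<gamma> H m\<^sub>t + ereal p"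
    unfolding open_pressure_def pressure_def
    by (intro SUP_least escape_rate_ge_free_energy[OF assms(4,5) P(2) tp]) auto
  then show ?thesis
    unfolding P(1) by (cases "open_pressure \<gamma> H t"; cases "log_lower_escape \<gamma> H m\<^sub>t") auto
qed

end
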